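(* Given a regular game $\mathcal{G}=\langle A,\mathsf{act},\sim,\lambda\rangle$ with imperfect information (with color alphabet $C=\{0,1\}$) and a rectangular morphism $h:\Gamma^*\to P$ for $\mathcal{G}$, the synthesis problem for almost-sure reachability and Büchi objectives (i.e., deciding whether the player has a strategy that is almost-sure winning for the objective $\mathsf{Reach}=0^*1\{0,1\}^\omega$, respectively for the objective $\mathsf{B\ddot uchi}=(0^*1)^\omega$) can be solved in time $O(|P|^2)$ (assuming a constant number of actions).
   Context: **Games.** $\Gamma$ is a finite set of moves, $A$ a nonempty set of actions, $\mathsf{act}:\Gamma\to A$ is surjective. In each of infinitely many rounds the player chooses an action $a\in A$, then the environment chooses a move $c\in\Gamma$ with $\mathsf{act}(c)=a$. A history is an element of $\Gamma^*$, a play an element of $\Gamma^\omega$. The relation $\sim$ on $\Gamma^*$ is an indistinguishability relation: an equivalence such that (i) $\tau\sim\tau'$ implies $|\tau|=|\tau'|$; (ii) $\tau c\sim\tau'c'$ (with $c,c'\in\Gamma$) implies $\tau\sim\tau'$ and $\mathsf{act}(c)=\mathsf{act}(c')$. $[\tau]_\sim$ is the equivalence class (information set) of $\tau$. The coloring function $\lambda:\Gamma^*\to C$ is regular (computed by a finite-state Moore machine reading the history) and information consistent: $\tau\sim\tau'$ implies $\lambda(\tau)=\lambda(\tau')$. For a play $\pi=c_1c_2\dots$, $\hat\lambda(\pi)=\lambda(c_1)\lambda(c_1c_2)\cdots\in C^\omega$. **Strategies.** $\mathcal{D}(S)$ denotes the set of probability distributions on $S$. A (randomized) player strategy is a function $\alpha:\Gamma^*\to\mathcal{D}(A)$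 with $\alpha(\tau)=\alpha(\tau')$ whenever $\tau\sim\tau'$. An environment strategy is a function $\beta:\Gamma^*\times A\to\mathcal{D}(\Gamma)$ such that $\beta(\tau,a)(c)>0$ implies $\mathsf{act}(c)=a$. $\Pr^{\alpha,\beta}$ is the probability measure on $\Gamma^\omega$ with $\Pr^{\alpha,\beta}(c_1\dots c_k\Gamma^\omega)=\prod_{i=1}^k\alpha(c_1\dots c_{i-1})(\mathsf{act}(c_i))\cdot\beta(c_1\dots c_{i-1},\mathsf{act}(c_i))(c_i)$. A player strategy $\alpha$ is almost-sure winning (from the empty history) for $L\subseteq C^\omega$ if $\Pr^{\alpha,\beta}(\{\pi:\hat\lambda(\pi)\in L\})=1$ for all environment strategies $\beta$. **Rectangular morphism, regular game.** A rectangular morphism for $\mathcal{G}$ is a surjective function $h:\Gamma^*\to P$, for some finite set $P$, such that for all $\tau,\tau'\in\Gamma^*$ with $h(\tau)=h(\tau')$ and all $c\in\Gamma$: $h([\tau]_\sim)=h([\tau']_\sim)$ (images of sets), $h(\tau c)=h(\tau'c)$, and $\lambda(\tau)=\lambda(\tau')$. A game is regular if it admits such a rectangular morphism. Being a finite-valued morphism, $h$ can be represented by an automaton with input alphabet $\Gamma$ and state space $P$.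
   Formalization: The time bound is O(|P|^2 + |P||Γ|), with constant depending only on the number of actions: the automaton for h has |P||Γ| transitions, all of which may have to be read, so O(|P|^2) independent of |Γ| is impossible; for a fixed Γ, or |Γ| = O(|P|), it is O(|P|^2). *)

theory Defs
  imports "HOL-Probability.Probability"
begin

section \<open>Games with imperfect information\<close>

text \<open>Finite words over the set of moves are lists in \<open>lists (moves G)\<close>, with the most recent
  move at the end; infinite words are streams.\<close>

record ('c, 'a, 'col) game =
  moves :: "'c set"
  actions :: "'a set"
  act :: "'c \<Rightarrow> 'a"
  indist :: "('c list \<times> 'c list) set"
  colors :: "'col set"
  color :: "'c list \<Rightarrow> 'col"

definition histories :: "('c, 'a, 'col) game \<Rightarrow> 'c list set" where
  "histories G = lists (moves G)"

definition indistinguishability :: "('c, 'a, 'col) game \<Rightarrow> bool" where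
  "indistinguishability G \<longleftrightarrow>
     equiv (histories G) (indist G) \<and>
     (\<forall>\<tau> \<tau>'. (\<tau>, \<tau>') \<in> indist G \<longrightarrow> length \<tau> = length \<tau>') \<and>
     (\<forall>\<tau> \<tau>' c c'. (\<tau> @ [c], \<tau>' @ [c']) \<in> indist G \<longrightarrow>
        (\<tau>, \<tau>') \<in> indist G \<and> act G c = act G c')"

definition information_set :: "('c, 'a, 'col) game \<Rightarrow> 'c list \<Rightarrow> 'c list set" where
  "information_set G \<tau> = indist G `` {\<tau>}"

text \<open>The machine is in state \<open>foldl \<delta> q0 \<tau>\<close> after reading \<open>\<tau>\<close>. Finite state spaces can be
  taken to consist of natural numbers.\<close>

definition moore_computable :: "'c set \<Rightarrow> ('c list \<Rightarrow> 'col) \<Rightarrow> bool" where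
  "moore_computable \<Gamma> f \<longleftrightarrow>
     (\<exists>(Q :: nat set) q0 \<delta> out. finite Q \<and> q0 \<in> Q \<and> (\<forall>q\<in>Q. \<forall>c\<in>\<Gamma>. \<delta> q c \<in> Q) \<and>
        (\<forall>\<tau>\<in>lists \<Gamma>. f \<tau> = out (foldl \<delta> q0 \<tau>)))"

definition imperfect_information_game :: "('c, 'a, 'col) game \<Rightarrow> bool" where
  "imperfect_information_game G \<longleftrightarrow>
     finite (moves G) \<and> actions G \<noteq> {} \<and> act G ` moves G = actions G \<and>
     indistinguishability G \<and>
     color G ` histories G \<subseteq> colors G \<and>
     moore_computable (moves G) (color G) \<and>
     (\<forall>(\<tau>, \<tau>')\<in>indist G. color G \<tau> = color G \<tau>')"

text \<open>The colour of the empty history does not occur in the colour sequence of a play.\<close>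

definition color_sequence :: "('c, 'a, 'col) game \<Rightarrow> 'c stream \<Rightarrow> 'col stream" where
  "color_sequence G \<pi> = smap (\<lambda>i. color G (stake (Suc i) \<pi>)) nats"


section \<open>Strategies and almost-sure winning\<close>

definition player_strategy :: "('c, 'a, 'col) game \<Rightarrow> ('c list \<Rightarrow> 'a pmf) \<Rightarrow> bool" where
  "player_strategy G \<alpha> \<longleftrightarrow>
     (\<forall>\<tau>\<in>histories G. set_pmf (\<alpha> \<tau>) \<subseteq> actions G) \<and>
     (\<forall>(\<tau>, \<tau>')\<in>indist G. \<alpha> \<tau> = \<alpha> \<tau>')"

definition environment_strategy ::
  "('c, 'a, 'col) game \<Rightarrow> ('c list \<Rightarrow> 'a \<Rightarrow> 'c pmf) \<Rightarrow> bool" where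
  "environment_strategy G \<beta> \<longleftrightarrow>
     (\<forall>\<tau>\<in>histories G. \<forall>a\<in>actions G.
        set_pmf (\<beta> \<tau> a) \<subseteq> moves G \<and> (\<forall>c. pmf (\<beta> \<tau> a) c > 0 \<longrightarrow> act G c = a))"

definition play_measure ::
  "('c, 'a, 'col) game \<Rightarrow> ('c list \<Rightarrow> 'a pmf) \<Rightarrow> ('c list \<Rightarrow> 'a \<Rightarrow> 'c pmf) \<Rightarrow> 'c stream measure" where
  "play_measure G \<alpha> \<beta> =
     (THE M. prob_space M \<and> sets M = sets (stream_space (count_space (moves G))) \<and>
        (\<forall>\<tau>\<in>histories G.
           measure M {\<pi> \<in> streams (moves G). stake (length \<tau>) \<pi> = \<tau>} =
           (\<Prod>i<length \<tau>. pmf (\<alpha> (take i \<tau>)) (act G (\<tau> ! i)) *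
                         pmf (\<beta> (take i \<tau>) (act G (\<tau> ! i))) (\<tau> ! i))))"

definition almost_sure_winning ::
  "('c, 'a, 'col) game \<Rightarrow> 'col stream set \<Rightarrow> ('c list \<Rightarrow> 'a pmf) \<Rightarrow> bool" where
  "almost_sure_winning G L \<alpha> \<longleftrightarrow>
     (\<forall>\<beta>. environment_strategy G \<beta> \<longrightarrow>
        measure (play_measure G \<alpha> \<beta>) {\<pi> \<in> streams (moves G). color_sequence G \<pi> \<in> L} = 1)"

definition Reach :: "nat stream set" where
  "Reach = {(replicate m 0 @ [1]) @- w | m w. w \<in> streams {0, 1}}"

definition Buchi :: "nat stream set" where
  "Buchi = {flat (smap (\<lambda>m. replicate m 0 @ [1]) ms) | ms. True}"


section \<open>Rectangular morphisms\<close>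

definition rectangular_morphism ::
  "('c, 'a, 'col) game \<Rightarrow> 'p set \<Rightarrow> ('c list \<Rightarrow> 'p) \<Rightarrow> bool" where
  "rectangular_morphism G P h \<longleftrightarrow>
     finite P \<and> h ` histories G = P \<and>
     (\<forall>\<tau>\<in>histories G. \<forall>\<tau>'\<in>histories G. h \<tau> = h \<tau>' \<longrightarrow>
        h ` information_set G \<tau> = h ` information_set G \<tau>' \<and>
        (\<forall>c\<in>moves G. h (\<tau> @ [c]) = h (\<tau>' @ [c])) \<and>
        color G \<tau> = color G \<tau>')"

definition regular_game :: "('c, 'a, 'col) game \<Rightarrow> bool" where
  "regular_game G \<longleftrightarrow>
     imperfect_information_game G \<and> (\<exists>(P :: nat set) h. rectangular_morphism G P h)"


section \<open>Random access machines\<close>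

text \<open>A structured programming language for the unit-cost random access machine with addition and
  truncated subtraction. A program uses finitely many named arrays of natural numbers; a scalar
  variable is an array that is used at index 0 only. There is deliberately no multiplication:
  at unit cost it would make the machine unreasonably powerful.\<close>

type_synonym vname = string
type_synonym state = "vname \<Rightarrow> nat \<Rightarrow> nat"

datatype aexp =
    Const nat
  | Load vname aexp
  | Plus aexp aexp
  | Minus aexp aexp

datatype bexp =
    Less aexp aexp
  | Not bexp
  | And bexp bexp

datatype com =
    Skip
  | Store vname aexp aexp
  | Seq com com
  | If bexp com com
  | While bexp com

fun aval :: "aexp \<Rightarrow> state \<Rightarrow> nat" where
  "aval (Const m) s = m"
| "aval (Load x e) s = s x (aval e s)"
| "aval (Plus e1 e2) s = aval e1 s + aval e2 s"
| "aval (Minus e1 e2) s = aval e1 s - aval e2 s"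

fun bval :: "bexp \<Rightarrow> state \<Rightarrow> bool" where
  "bval (Less e1 e2) s \<longleftrightarrow> aval e1 s < aval e2 s"
| "bval (Not b) s \<longleftrightarrow> \<not> bval b s"
| "bval (And b1 b2) s \<longleftrightarrow> bval b1 s \<and> bval b2 s"

fun acost :: "aexp \<Rightarrow> nat" where
  "acost (Const m) = 1"
| "acost (Load x e) = 1 + acost e"
| "acost (Plus e1 e2) = 1 + acost e1 + acost e2"
| "acost (Minus e1 e2) = 1 + acost e1 + acost e2"

fun bcost :: "bexp \<Rightarrow> nat" where
  "bcost (Less e1 e2) = 1 + acost e1 + acost e2"
| "bcost (Not b) = 1 + bcost b"
| "bcost (And b1 b2) = 1 + bcost b1 + bcost b2"

text \<open>\<open>exec p s t s'\<close>: started in state \<open>s\<close>, the program \<open>p\<close> halts after \<open>t\<close> steps in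
  state \<open>s'\<close>.\<close>

inductive exec :: "com \<Rightarrow> state \<Rightarrow> nat \<Rightarrow> state \<Rightarrow> bool" where
  Skip: "exec Skip s 1 s"
| Store: "exec (Store x e1 e2) s (1 + acost e1 + acost e2)
            (s(x := (s x)(aval e1 s := aval e2 s)))"
| Seq: "exec p1 s1 t1 s2 \<Longrightarrow> exec p2 s2 t2 s3 \<Longrightarrow> exec (Seq p1 p2) s1 (t1 + t2) s3"
| IfTrue: "bval b s \<Longrightarrow> exec p1 s t s' \<Longrightarrow> exec (If b p1 p2) s (1 + bcost b + t) s'"
| IfFalse: "\<not> bval b s \<Longrightarrow> exec p2 s t s' \<Longrightarrow> exec (If b p1 p2) s (1 + bcost b + t) s'"
| WhileFalse: "\<not> bval b s \<Longrightarrow> exec (While b p) s (1 + bcost b) s"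
| WhileTrue: "bval b s1 \<Longrightarrow> exec p s1 t1 s2 \<Longrightarrow> exec (While b p) s2 t2 s3 \<Longrightarrow>
                exec (While b p) s1 (1 + bcost b + t1 + t2) s3"


section \<open>Games as inputs of programs\<close>

text \<open>Moves, actions and elements of \<open>P\<close> are numbered from 0. The input is the automaton of
  \<open>h\<close> over the alphabet of moves (its transition table stored row by row), the function \<open>act\<close>,
  and the colour and the set \<open>h ` information_set G \<tau>\<close> for each \<open>h \<tau>\<close>, the sets
  being given by their characteristic functions; these are well defined because \<open>h\<close> is a
  rectangular morphism. All memory cells that are not mentioned may have arbitrary contents.\<close>

definition input_state ::
  "(nat, nat, nat) game \<Rightarrow> nat \<Rightarrow> (nat list \<Rightarrow> nat) \<Rightarrow> state \<Rightarrow> bool" where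
  "input_state G n h s \<longleftrightarrow>
     s ''states'' 0 = n \<and>
     s ''moves'' 0 = card (moves G) \<and>
     s ''actions'' 0 = card (actions G) \<and>
     s ''init'' 0 = h [] \<and>
     (\<forall>c\<in>moves G. s ''act'' c = act G c) \<and>
     (\<forall>\<tau>\<in>histories G. \<forall>c\<in>moves G.
        s ''delta'' (h \<tau> * card (moves G) + c) = h (\<tau> @ [c])) \<and>
     (\<forall>\<tau>\<in>histories G. s ''color'' (h \<tau>) = color G \<tau>) \<and>
     (\<forall>\<tau>\<in>histories G. \<forall>q<n.
        s ''info'' (h \<tau> * n + q) = (if q \<in> h ` information_set G \<tau> then 1 else 0))"

text \<open>\<open>synthesis_in_time prog L k T\<close>: on regular games with \<open>k\<close> actions, given with a
  rectangular morphism onto a set of size \<open>n\<close>, the program decides the synthesis problem for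
  \<open>L\<close> in at most \<open>T n g\<close> steps, where \<open>g\<close> is the number of moves. The transition table has
  \<open>n * g\<close> entries, each of which can affect the answer, so no \<open>T\<close> that is independent of \<open>g\<close> is
  possible; over a fixed set of moves, \<open>K * (n ^ 2 + n * g)\<close> is quadratic in \<open>n\<close>.\<close>

definition synthesis_in_time ::
  "com \<Rightarrow> nat stream set \<Rightarrow> nat \<Rightarrow> (nat \<Rightarrow> nat \<Rightarrow> nat) \<Rightarrow> bool" where
  "synthesis_in_time prog L k T \<longleftrightarrow>
     (\<forall>(G :: (nat, nat, nat) game) g n h s.
        regular_game G \<and> moves G = {..<g} \<and> actions G = {..<k} \<and> colors G = {0, 1} \<and>
        rectangular_morphism G {..<n} h \<and> input_state G n h s \<longrightarrow>
        (\<exists>t s'. exec prog s t s' \<and> t \<le> T n g \<and>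
           s' ''out'' 0 =
             (if \<exists>\<alpha>. player_strategy G \<alpha> \<and> almost_sure_winning G L \<alpha> then 1 else 0)))"

end

theory Submission
  imports Defs
begin

text \<open>
  Two states \<open>p, q \<in> P\<close> are equivalent when \<open>q\<close> occurs in the image of the information set of a
  history mapped to \<open>p\<close>. A set of states is sustained if it is a union of equivalence classes, if
  every state in it has an action that keeps its whole class inside the set, and if such actions
  suffice to force colour 1 when the player knows the current state. From the greatest
  sustained set the player wins almost surely by playing all class-safe actions uniformly:
  within boundedly many rounds colour 1 appears with probability bounded away from 0.
  Conversely the states reached by an almost surely winning strategy form a sustained set, since
  outside the attractor the environment can avoid colour 1 against every action in the support.
  For reachability the moves out of states of colour 1 are dropped.

  The greatest sustained set is the complement of iteratively removed traps, as for alternating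
  Buchi games. Recomputing the attractor from scratch after each removal would be cubic. As in
  the algorithm of Chatterjee and Henzinger, a round at level \<open>d\<close> searches only for traps whose
  states have at most \<open>d\<close> live incoming state-action pairs, at cost \<open>O(n k d)\<close>; levels double
  until a trap is found, and then it contains a state with more than \<open>d / 2\<close> live incoming pairs,
  all of which die with it. The total is \<open>O((n k)\<^sup>2)\<close>, apart from reading the transition table.
\<close>

section \<open>Almost-sure attractors with information classes\<close>

text \<open>Rectangularity makes the image of an information set a function of the state, so
  indistinguishability descends to an equivalence on \<open>P\<close>; knowledge is then handled by
  closing sets under classes, without a construction on sets of states. The class restricts only the
  safe actions: one action must be safe for every history that the player cannot tell apart.
  Progress needs no knowledge, since a uniform choice among the safe actions agrees with any
  required one with probability at least \<open>1 / k\<close>. The colour of the empty history is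
  not seen, so \<open>h []\<close> may have colour 1 without the goal having been met. Sustained
  sets therefore concern nonempty histories, and the first action is chosen separately. In a round
  at level \<open>d\<close> the states with more than \<open>d\<close> live incoming pairs are put
  into the attractor without proof. This only enlarges it: winning states stay inside and the
  complement is still a trap. The price is that traps containing such a state can be missed, until
  the level is high enough. The level may return to 1 after a removal because the pairs and states
  that died pay for climbing again.\<close>

locale arena =
  fixes n k :: nat
    and edge :: "nat \<Rightarrow> nat \<Rightarrow> nat \<Rightarrow> bool"
    and target :: "nat \<Rightarrow> bool"
    and eqv :: "nat \<Rightarrow> nat \<Rightarrow> bool"
begin

definition allowed :: "nat set \<Rightarrow> nat \<Rightarrow> nat \<Rightarrow> bool" where
  "allowed X p a \<longleftrightarrow> (\<forall>p' q. eqv p p' \<longrightarrow> edge p' a q \<longrightarrow> q \<in> X)"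

inductive_set attr :: "nat set \<Rightarrow> nat set" for X where
  target: "target p \<Longrightarrow> p \<in> attr X"
| step: "a < k \<Longrightarrow> allowed X p a \<Longrightarrow> (\<And>q. edge p a q \<Longrightarrow> q \<in> attr X) \<Longrightarrow> p \<in> attr X"

text \<open>An allowed action is demanded separately from membership in \<open>attr X\<close>,
  because a target belongs to \<open>attr X\<close> even when no action is safe for its
  class.\<close>

definition sustained :: "nat set \<Rightarrow> bool" where
  "sustained X \<longleftrightarrow> X \<subseteq> {..<n} \<and> (\<forall>p\<in>X. \<forall>q. eqv p q \<longrightarrow> q \<in> X) \<and>
     (\<forall>p\<in>X. (\<exists>a<k. allowed X p a) \<and> p \<in> attr X)"

definition winning :: "nat set" where
  "winning = \<Union>{X. sustained X}"

lemma allowed_mono: "X \<subseteq> Y \<Longrightarrow> allowed X p a \<Longrightarrow> allowed Y p a"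
  by (auto simp: allowed_def)

lemma attr_mono:
  assumes "X \<subseteq> Y"
  shows "attr X \<subseteq> attr Y"
proof
  fix p assume "p \<in> attr X"
  then show "p \<in> attr Y"
  proof induction
    case (step a p)
    then show ?case
      using allowed_mono[OF assms] attr.step by blast
  qed (rule attr.target)
qed

lemma sustained_subset_winning: "sustained X \<Longrightarrow> X \<subseteq> winning"
  by (auto simp: winning_def)

text \<open>Both \<open>allowed\<close> and \<open>attr\<close> are monotone in the set, so a union
  of sustained sets is sustained; \<open>winning\<close> is thus the greatest one.\<close>

lemma sustained_winning: "sustained winning"
  unfolding sustained_def[of winning]
proof (intro conjI ballI allI impI)
  show "winning \<subseteq> {..<n}"
    unfolding winning_def sustained_def by blast
next
  fix p q assume "p \<in> winning" "eqv p q"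
  then show "q \<in> winning"
    unfolding winning_def sustained_def by blast
next
  fix p assume "p \<in> winning"
  then obtain X where X: "sustained X" "p \<in> X"
    by (auto simp: winning_def)
  note le = sustained_subset_winning[OF X(1)]
  obtain a where "a < k" "allowed X p a" "p \<in> attr X"
    using X unfolding sustained_def by blast
  then show "\<exists>a<k. allowed winning p a" "p \<in> attr winning"
    using allowed_mono[OF le] attr_mono[OF le] by blast+
qed

end

section \<open>The probability measure on plays\<close>

text \<open>Cylinders over single points determine the measure: singletons together with the empty
  set are closed under intersection and, as \<open>S\<close> is countable, generate all subsets of
  \<open>S\<close>.\<close>

lemma stream_measure_eqI:
  fixes S :: "'c set"
  assumes P: "prob_space M" "prob_space N" and S: "countable S"
    and sets: "sets M = sets (stream_space (count_space S))" "sets N = sets (stream_space (count_space S))"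
    and eq: "\<And>\<tau>. \<tau> \<in> lists S \<Longrightarrow> measure M {\<pi> \<in> streams S. stake (length \<tau>) \<pi> = \<tau>} =
                   measure N {\<pi> \<in> streams S. stake (length \<tau>) \<pi> = \<tau>}"
  shows "M = N"
proof -
  interpret M: prob_space M by fact
  interpret N: prob_space N by fact
  let ?G = "insert {} ((\<lambda>x. {x}) ` S)"
  have cyl: "scylinder S (map (\<lambda>x. {x}) \<tau>) = {\<pi> \<in> streams S. stake (length \<tau>) \<pi> = \<tau>}" for \<tau>
  proof (induction \<tau>)
    case (Cons x \<tau>)
    have "stl \<pi> \<in> streams S" if "\<pi> \<in> streams S" for \<pi>
      using that by (rule streams_stl)
    then show ?case
      by (simp add: Cons set_eq_iff) blast
  qed simp
  have empty: "scylinder S xs = {}" if "{} \<in> set xs" for xs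
    using that by (induction xs) auto
  have "emeasure M (scylinder S xs) = emeasure N (scylinder S xs)" if "xs \<in> lists ?G" for xs
  proof (cases "{} \<in> set xs")
    case False
    then have "xs \<in> lists ((\<lambda>x. {x}) ` S)"
      using that by (auto simp: lists_eq_set)
    then obtain \<tau> where \<tau>: "\<tau> \<in> lists S" "xs = map (\<lambda>x. {x}) \<tau>"
      by (auto simp: lists_image)
    then show ?thesis
      using eq[of \<tau>] by (simp add: cyl M.emeasure_eq_measure N.emeasure_eq_measure)
  qed (simp add: empty)
  then show ?thesis
  proof (intro stream_space_eq_scylinder[OF P, of ?G "count_space S" "(\<lambda>x. {x}) ` S"] sets)
    show "Int_stable ?G"
      by (auto simp: Int_stable_def)
    show "sets (count_space S) = sets (sigma (space (count_space S)) ?G)"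
    proof -
      have "sigma_sets S ((\<lambda>x. {x}) ` S) \<subseteq> sigma_sets S ?G"
        by (rule sigma_sets_mono') auto
      moreover have "sigma_sets S ?G \<subseteq> Pow S"
        by (auto dest: sigma_sets_into_sp[rotated])
      moreover have "A \<in> sigma_sets S ?G" if "A \<subseteq> S" for A
      proof -
        have "(\<Union>x\<in>A. {x}) \<in> sets (sigma S ?G)"
          using that S by (intro sets.countable_UN' countable_subset[OF that S]) auto
        then show ?thesis
          by (subst (asm) sets_measure_of) auto
      qed
      ultimately show ?thesis
        by (subst sets_measure_of) auto
    qed
  qed (use S in auto)
qed

primrec run_prefix :: "('c list \<Rightarrow> 'c) \<Rightarrow> nat \<Rightarrow> 'c list" where
  "run_prefix \<omega> 0 = []"
| "run_prefix \<omega> (Suc i) = run_prefix \<omega> i @ [\<omega> (run_prefix \<omega> i)]"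

lemma length_run_prefix [simp]: "length (run_prefix \<omega> i) = i"
  by (induction i) auto

lemma run_prefix_eq_iff:
  "run_prefix \<omega> (length \<tau>) = \<tau> \<longleftrightarrow> (\<forall>i<length \<tau>. \<omega> (take i \<tau>) = \<tau> ! i)"
proof (induction \<tau> rule: rev_induct)
  case (snoc c \<tau>)
  have "(\<forall>i<Suc (length \<tau>). \<omega> (take i (\<tau> @ [c])) = (\<tau> @ [c]) ! i) \<longleftrightarrow>
      (\<forall>i<length \<tau>. \<omega> (take i \<tau>) = \<tau> ! i) \<and> \<omega> \<tau> = c"
    by (auto simp: less_Suc_eq nth_append)
  with snoc show ?case
    by auto
qed simp

text \<open>All moves are drawn in advance, independently for every history; the play then follows
  deterministically.\<close>

lemma markov_measure_exists:
  fixes K :: "'c::countable list \<Rightarrow> 'c pmf"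
  assumes K: "\<And>\<tau>. \<tau> \<in> lists S \<Longrightarrow> set_pmf (K \<tau>) \<subseteq> S"
  shows "\<exists>M. prob_space M \<and> sets M = sets (stream_space (count_space S)) \<and>
    (\<forall>\<tau>\<in>lists S. measure M {\<pi> \<in> streams S. stake (length \<tau>) \<pi> = \<tau>} =
      (\<Prod>i<length \<tau>. pmf (K (take i \<tau>)) (\<tau> ! i)))"
proof -
  have "set_pmf (K []) \<noteq> {}" "set_pmf (K []) \<subseteq> S"
    using K[of "[]"] by (auto simp: set_pmf_not_empty)
  then obtain c0 where c0: "c0 \<in> S"
    by auto
  define P where "P = Pi\<^sub>M UNIV (\<lambda>\<tau>. measure_pmf (K \<tau>))"
  interpret P: product_prob_space "\<lambda>\<tau>. measure_pmf (K \<tau>)" UNIV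
    by unfold_locales
  \<comment> \<open>The drawn moves lie in \<open>S\<close> only almost surely; redirecting the
    others to \<open>c0\<close> makes \<open>play \<omega>\<close> a stream over \<open>S\<close>
    for every \<open>\<omega>\<close>.\<close>
  define fix_up where "fix_up \<omega> \<tau> = (if \<omega> \<tau> \<in> S then \<omega> \<tau> else c0)" for \<omega> :: "'c list \<Rightarrow> 'c" and \<tau>
  define play where "play \<omega> = to_stream (\<lambda>i. fix_up \<omega> (run_prefix (fix_up \<omega>) i))" for \<omega>
  have fix_up: "(\<lambda>\<omega>. fix_up \<omega> \<tau>) \<in> measurable P (count_space S)" for \<tau>
  proof -
    have "(\<lambda>\<omega>. \<omega> \<tau>) \<in> measurable P (measure_pmf (K \<tau>))"
      unfolding P_def by measurable
    then have "(\<lambda>\<omega>. \<omega> \<tau>) \<in> measurable P (count_space UNIV)"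
      by (simp cong: measurable_cong_sets)
    then show ?thesis
      unfolding fix_up_def by (rule measurable_compose) (auto simp: c0)
  qed
  have prefix: "(\<lambda>\<omega>. run_prefix (fix_up \<omega>) i) \<in> measurable P (count_space UNIV)" for i
  proof (induction i)
    case (Suc i)
    have *: "(\<lambda>\<omega>. \<tau> @ [fix_up \<omega> \<tau>]) \<in> measurable P (count_space UNIV)" for \<tau>
      by (rule measurable_compose[OF fix_up]) auto
    show ?case
      using measurable_compose_countable[OF * Suc] by simp
  qed simp
  have play: "play \<in> measurable P (stream_space (count_space S))"
    unfolding play_def
    by (rule measurable_stream_space2)
      (auto simp: to_stream_def intro!: measurable_compose_countable[OF fix_up prefix])
  have stake_play: "stake i (play \<omega>) = run_prefix (fix_up \<omega>) i" for i \<omega>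
    by (induction i) (simp_all add: stake_Suc play_def to_stream_def del: stake.simps)
  have play_streams: "play \<omega> \<in> streams S" for \<omega>
    unfolding play_def by (auto simp: to_stream_in_streams fix_up_def c0)
  have P: "prob_space P"
    unfolding P_def by (rule P.prob_space_axioms)
  have "measure (distr P (stream_space (count_space S)) play) {\<pi> \<in> streams S. stake (length \<tau>) \<pi> = \<tau>} =
      (\<Prod>i<length \<tau>. pmf (K (take i \<tau>)) (\<tau> ! i))" if \<tau>: "\<tau> \<in> lists S" for \<tau>
  proof -
    have cyl: "{\<pi> \<in> streams S. stake (length \<tau>) \<pi> = \<tau>} \<in> sets (stream_space (count_space S))"
    proof -
      have "{\<pi> \<in> streams S. stake (length \<tau>) \<pi> = \<tau>} =
        {\<pi> \<in> space (stream_space (count_space S)). \<forall>i<length \<tau>. \<pi> !! i = \<tau> ! i}"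
        by (auto simp: space_stream_space list_eq_iff_nth_eq)
      also have "\<dots> \<in> sets (stream_space (count_space S))"
        by measurable
      finally show ?thesis .
    qed
    let ?J = "(\<lambda>i. take i \<tau>) ` {..<length \<tau>}"
    have inj: "inj_on (\<lambda>i. take i \<tau>) {..<length \<tau>}"
      by (rule inj_onI) (metis length_take lessThan_iff min.absorb4)
    have AE: "AE \<omega> in P. \<forall>j\<in>?J. \<omega> j \<in> S"
    proof (rule AE_finite_allI)
      fix j assume "j \<in> ?J"
      then have "set_pmf (K j) \<subseteq> S"
        using \<tau> by (intro K) (auto dest: in_set_takeD)
      then have "AE x in measure_pmf (K j). x \<in> S"
        by (auto simp: AE_measure_pmf_iff)
      then show "AE \<omega> in P. \<omega> j \<in> S"
        unfolding P_def by (rule P.AE_component[rotated]) simp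
    qed simp
    have "measure (distr P (stream_space (count_space S)) play) {\<pi> \<in> streams S. stake (length \<tau>) \<pi> = \<tau>} =
        measure P {\<omega> \<in> space P. \<forall>i<length \<tau>. fix_up \<omega> (take i \<tau>) = \<tau> ! i}"
      using play cyl
      by (subst measure_distr)
         (auto simp: stake_play run_prefix_eq_iff play_streams intro!: arg_cong2[where f = measure])
    \<comment> \<open>Only finitely many coordinates matter, and on them the redirection is almost
      surely void. The prefixes of \<open>\<tau>\<close> are distinct coordinates, hence
      independent; the position of the move is recovered as the length of the prefix.\<close>
    also have "\<dots> = measure P {\<omega> \<in> space P. \<forall>j\<in>?J. \<omega> j \<in> {\<tau> ! length j}}"
    proof (rule measure_eq_AE)
      show "AE \<omega> in P. (\<omega> \<in> {\<omega> \<in> space P. \<forall>i<length \<tau>. fix_up \<omega> (take i \<tau>) = \<tau> ! i}) =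
          (\<omega> \<in> {\<omega> \<in> space P. \<forall>j\<in>?J. \<omega> j \<in> {\<tau> ! length j}})"
        using AE by eventually_elim (auto simp: fix_up_def min_def)
      show "{\<omega> \<in> space P. \<forall>i<length \<tau>. fix_up \<omega> (take i \<tau>) = \<tau> ! i} \<in> sets P"
        using fix_up[measurable] \<tau> by measurable
      show "{\<omega> \<in> space P. \<forall>j\<in>?J. \<omega> j \<in> {\<tau> ! length j}} \<in> sets P"
        unfolding P_def by measurable
    qed
    also have "\<dots> = (\<Prod>j\<in>?J. pmf (K j) (\<tau> ! length j))"
      using P.emeasure_PiM_Collect[of ?J "\<lambda>j. {\<tau> ! length j}"]
      unfolding P_def[symmetric] finite_measure.emeasure_eq_measure[OF prob_space.finite_measure[OF P]]
      by (simp add: emeasure_pmf_single prod_ennreal prod_nonneg del: ball_simps image_iff ball_UN)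
    also have "\<dots> = (\<Prod>i<length \<tau>. pmf (K (take i \<tau>)) (\<tau> ! i))"
      by (subst prod.reindex[OF inj]) (simp add: min_def)
    finally show ?thesis .
  qed
  then show ?thesis
    using prob_space.prob_space_distr[OF P play]
    by (intro exI[of _ "distr P (stream_space (count_space S)) play"]) auto
qed

definition transition :: "('c list \<Rightarrow> 'a pmf) \<Rightarrow> ('c list \<Rightarrow> 'a \<Rightarrow> 'c pmf) \<Rightarrow> 'c list \<Rightarrow> 'c pmf" where
  "transition \<alpha> \<beta> \<tau> = bind_pmf (\<alpha> \<tau>) (\<beta> \<tau>)"

text \<open>A move determines its action, so in the mixture over actions only the term of
  \<open>act G c\<close> survives.\<close>

lemma
  assumes \<alpha>: "player_strategy G \<alpha>" and \<beta>: "environment_strategy G \<beta>" and \<tau>: "\<tau> \<in> histories G"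
  shows pmf_transition: "pmf (transition \<alpha> \<beta> \<tau>) c = pmf (\<alpha> \<tau>) (act G c) * pmf (\<beta> \<tau> (act G c)) c"
    and set_transition: "set_pmf (transition \<alpha> \<beta> \<tau>) \<subseteq> moves G"
proof -
  have act: "set_pmf (\<alpha> \<tau>) \<subseteq> actions G"
    using \<alpha> \<tau> by (auto simp: player_strategy_def)
  have env: "set_pmf (\<beta> \<tau> a) \<subseteq> moves G" "pmf (\<beta> \<tau> a) c > 0 \<Longrightarrow> act G c = a" if "a \<in> actions G" for a c
    using \<beta> \<tau> that by (auto simp: environment_strategy_def)
  have "pmf (transition \<alpha> \<beta> \<tau>) c = (\<integral>a. pmf (\<beta> \<tau> a) c \<partial>measure_pmf (\<alpha> \<tau>))"
    by (simp add: transition_def pmf_bind)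
  also have "\<dots> = (\<Sum>a\<in>{act G c}. pmf (\<beta> \<tau> a) c * pmf (\<alpha> \<tau>) a)"
  proof (rule integral_measure_pmf_real)
    fix a assume a: "a \<in> set_pmf (\<alpha> \<tau>)" "pmf (\<beta> \<tau> a) c \<noteq> 0"
    then have "pmf (\<beta> \<tau> a) c > 0"
      by (simp add: pmf_pos)
    then show "a \<in> {act G c}"
      using a act env by auto
  qed simp
  finally show "pmf (transition \<alpha> \<beta> \<tau>) c = pmf (\<alpha> \<tau>) (act G c) * pmf (\<beta> \<tau> (act G c)) c"
    by simp
  show "set_pmf (transition \<alpha> \<beta> \<tau>) \<subseteq> moves G"
    using act env by (auto simp: transition_def)
qed

definition weight :: "('c list \<Rightarrow> 'a pmf) \<Rightarrow> ('c list \<Rightarrow> 'a \<Rightarrow> 'c pmf) \<Rightarrow> 'c list \<Rightarrow> real" where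
  "weight \<alpha> \<beta> \<tau> = (\<Prod>i<length \<tau>. pmf (transition \<alpha> \<beta> (take i \<tau>)) (\<tau> ! i))"

lemma weight_Nil [simp]: "weight \<alpha> \<beta> [] = 1"
  by (simp add: weight_def)

lemma weight_snoc [simp]: "weight \<alpha> \<beta> (\<tau> @ [c]) = weight \<alpha> \<beta> \<tau> * pmf (transition \<alpha> \<beta> \<tau>) c"
  by (simp add: weight_def nth_append)

lemma weight_nonneg: "weight \<alpha> \<beta> \<tau> \<ge> 0"
  by (simp add: weight_def prod_nonneg)

text \<open>Existence and uniqueness of the measure turn the definite description in
  \<open>play_measure\<close> into usable facts.\<close>

lemma play_measure:
  fixes G :: "('c::countable, 'a, 'col) game"
  assumes \<alpha>: "player_strategy G \<alpha>" and \<beta>: "environment_strategy G \<beta>"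
  shows "prob_space (play_measure G \<alpha> \<beta>)"
    and "sets (play_measure G \<alpha> \<beta>) = sets (stream_space (count_space (moves G)))"
    and "\<tau> \<in> histories G \<Longrightarrow>
      measure (play_measure G \<alpha> \<beta>) {\<pi> \<in> streams (moves G). stake (length \<tau>) \<pi> = \<tau>} = weight \<alpha> \<beta> \<tau>"
proof -
  define P where "P M \<longleftrightarrow> prob_space M \<and> sets M = sets (stream_space (count_space (moves G))) \<and>
        (\<forall>\<tau>\<in>histories G. measure M {\<pi> \<in> streams (moves G). stake (length \<tau>) \<pi> = \<tau>} =
           (\<Prod>i<length \<tau>. pmf (\<alpha> (take i \<tau>)) (act G (\<tau> ! i)) *
                         pmf (\<beta> (take i \<tau>) (act G (\<tau> ! i))) (\<tau> ! i)))" for M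
  have take: "take i \<tau> \<in> histories G" if "\<tau> \<in> histories G" for i \<tau>
    using that by (auto simp: histories_def dest: in_set_takeD)
  have weight: "(\<Prod>i<length \<tau>. pmf (\<alpha> (take i \<tau>)) (act G (\<tau> ! i)) *
      pmf (\<beta> (take i \<tau>) (act G (\<tau> ! i))) (\<tau> ! i)) = weight \<alpha> \<beta> \<tau>" if "\<tau> \<in> histories G" for \<tau>
    unfolding weight_def using take[OF that] by (simp add: pmf_transition[OF \<alpha> \<beta>])
  have "\<exists>M. prob_space M \<and> sets M = sets (stream_space (count_space (moves G))) \<and>
    (\<forall>\<tau>\<in>lists (moves G). measure M {\<pi> \<in> streams (moves G). stake (length \<tau>) \<pi> = \<tau>} =
      (\<Prod>i<length \<tau>. pmf (transition \<alpha> \<beta> (take i \<tau>)) (\<tau> ! i)))"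
    using set_transition[OF \<alpha> \<beta>] by (intro markov_measure_exists) (auto simp: histories_def)
  then have "\<exists>M. P M"
    unfolding P_def using weight by (auto simp: histories_def weight_def)
  moreover have "M = N" if "P M" "P N" for M N
    using that unfolding P_def
    by (intro stream_measure_eqI[of M N "moves G"]) (auto simp: histories_def)
  ultimately have "\<exists>!M. P M"
    by blast
  moreover have "play_measure G \<alpha> \<beta> = (THE M. P M)"
    by (simp add: play_measure_def P_def)
  ultimately have "P (play_measure G \<alpha> \<beta>)"
    using theI'[of P] by simp
  then show "prob_space (play_measure G \<alpha> \<beta>)"
    "sets (play_measure G \<alpha> \<beta>) = sets (stream_space (count_space (moves G)))"
    "\<tau> \<in> histories G \<Longrightarrow>
      measure (play_measure G \<alpha> \<beta>) {\<pi> \<in> streams (moves G). stake (length \<tau>) \<pi> = \<tau>} = weight \<alpha> \<beta> \<tau>"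
    by (auto simp: P_def weight)
qed

section \<open>Almost-sure winning and sustained sets\<close>

lemma split_at_first_one:
  fixes w :: "nat stream"
  assumes w: "w \<in> streams {0, 1}" and one: "\<exists>i. w !! i = 1"
  defines "m \<equiv> LEAST i. w !! i = 1"
  shows "w = (replicate m 0 @ [1]) @- sdrop (Suc m) w"
proof -
  have m: "w !! m = 1"
    unfolding m_def using one by (rule LeastI_ex)
  have less: "w !! i = 0" if "i < m" for i
    using not_less_Least[of i "\<lambda>i. w !! i = 1"] that w by (auto simp: m_def streams_iff_snth)
  have "stake (Suc m) w = replicate m 0 @ [1]"
    by (rule nth_equalityI) (auto simp: less_Suc_eq nth_append less m simp del: stake.simps)
  then show ?thesis
    by (metis stake_sdrop)
qed

lemma sdrop_in_streams: "w \<in> streams A \<Longrightarrow> sdrop m w \<in> streams A"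
  unfolding streams_iff_snth sdrop_snth by blast

lemma Reach_iff: "w \<in> streams {0, 1} \<Longrightarrow> w \<in> Reach \<longleftrightarrow> (\<exists>i. w !! i = 1)"
proof
  assume "w \<in> Reach"
  then obtain m w' where "w = (replicate m 0 @ [1]) @- w'"
    by (auto simp: Reach_def)
  then have "w !! m = 1"
    by simp
  then show "\<exists>i. w !! i = 1" ..
next
  assume "w \<in> streams {0, 1}" "\<exists>i. w !! i = 1"
  then show "w \<in> Reach"
    using split_at_first_one sdrop_in_streams unfolding Reach_def by blast
qed

lemma Buchi_iff:
  assumes w: "w \<in> streams {0, 1}"
  shows "w \<in> Buchi \<longleftrightarrow> (\<forall>m. \<exists>i\<ge>m. w !! i = 1)"
proof
  let ?block = "\<lambda>m. replicate m (0::nat) @ [1]"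
  assume "w \<in> Buchi"
  then obtain ms where w_ms: "w = flat (smap ?block ms)"
    by (auto simp: Buchi_def)
  \<comment> \<open>If position \<open>m\<close> lies beyond the first block, drop that block; it
    has length \<open>shd ms + 1\<close>, so \<open>m\<close> strictly decreases.\<close>
  have "\<exists>i\<ge>m. flat (smap ?block ms) !! i = 1" for m ms
  proof (induction m arbitrary: ms rule: less_induct)
    case (less m)
    have unfold: "flat (smap ?block ms) = ?block (shd ms) @- flat (smap ?block (stl ms))"
      by (subst flat_unfold) auto
    show ?case
    proof (cases "m \<le> shd ms")
      case True
      then show ?thesis
        by (intro exI[of _ "shd ms"]) (subst unfold, simp)
    next
      case False
      then have "m - Suc (shd ms) < m"
        by simp
      from less[OF this, of "stl ms"] obtain i where
        "i \<ge> m - Suc (shd ms)" "flat (smap ?block (stl ms)) !! i = 1"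
        by auto
      then show ?thesis
        unfolding unfold shift_snth by (intro exI[of _ "i + Suc (shd ms)"]) auto
    qed
  qed
  then show "\<forall>m. \<exists>i\<ge>m. w !! i = 1"
    by (simp add: w_ms)
next
  let ?block = "\<lambda>m. replicate m (0::nat) @ [1]"
  assume inf: "\<forall>m. \<exists>i\<ge>m. w !! i = 1"
  \<comment> \<open>The stream is cut after each 1. \<open>good\<close> is preserved by
    \<open>rest\<close>, which keeps the least position in \<open>gap\<close> meaningful
    forever.\<close>
  define gap where "gap w = (LEAST i. w !! i = (1::nat))" for w
  define rest where "rest w = sdrop (Suc (gap w)) w" for w
  define good where "good w \<longleftrightarrow> w \<in> streams {0, 1::nat} \<and> (\<forall>m. \<exists>i\<ge>m. w !! i = 1)" for w
  define F where "F w = flat (smap ?block (smap gap (siterate rest w)))" for w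
  have rest: "w = ?block (gap w) @- rest w \<and> good (rest w)" if "good w" for w
  proof -
    have w: "w \<in> streams {0, 1}" and often: "\<exists>i\<ge>m. w !! i = 1" for m
      using that by (simp_all add: good_def)
    then have "w = ?block (gap w) @- rest w"
      unfolding gap_def rest_def by (intro split_at_first_one) blast+
    moreover have "\<exists>i\<ge>m. rest w !! i = 1" for m
    proof -
      obtain i where "i \<ge> m + Suc (gap w)" "w !! i = 1"
        using often[of "m + Suc (gap w)"] by blast
      then show ?thesis
        by (intro exI[of _ "i - Suc (gap w)"]) (auto simp: rest_def sdrop_snth simp del: sdrop.simps)
    qed
    moreover have "rest w \<in> streams {0, 1}"
      unfolding rest_def by (rule sdrop_in_streams[OF w])
    ultimately show ?thesis
      by (auto simp: good_def)
  qed
  have F: "F w = ?block (gap w) @- F (rest w)" for w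
    unfolding F_def by (subst flat_unfold) auto
  \<comment> \<open>Equality is checked position by position: blocks are nonempty, so passing to
    \<open>rest w\<close> strictly decreases the index.\<close>
  have "F w !! i = w !! i" if "good w" for i w
    using that
  proof (induction i arbitrary: w rule: less_induct)
    case (less i)
    have eq: "w = ?block (gap w) @- rest w" and "good (rest w)"
      using rest[OF less.prems] by auto
    have 1: "F w !! i = (?block (gap w) @- F (rest w)) !! i"
      using F[of w] by (rule arg_cong)
    have 2: "w !! i = (?block (gap w) @- rest w) !! i"
      using eq by (rule arg_cong)
    show ?case
      using less.IH[OF _ \<open>good (rest w)\<close>, of "i - Suc (gap w)"]
      unfolding 1 2 shift_snth by simp
  qed
  moreover have "good w"
    using w inf by (simp add: good_def)
  ultimately have "F w = w"
    by (metis stream_smap_nats ext)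
  then show "w \<in> Buchi"
    unfolding Buchi_def F_def by (metis (mono_tags, lifting) mem_Collect_eq)
qed

section \<open>The arena of a game with a rectangular morphism\<close>

locale numbered_game =
  fixes G :: "(nat, nat, nat) game" and g n k :: nat and h :: "nat list \<Rightarrow> nat"
    and succ :: "nat \<Rightarrow> nat \<Rightarrow> nat" and col :: "nat \<Rightarrow> nat" and r :: bool
  assumes game: "imperfect_information_game G"
    and moves: "moves G = {..<g}" and actions: "actions G = {..<k}" and colors: "colors G = {0, 1}"
    and morphism: "rectangular_morphism G {..<n} h"
    and succ: "\<And>\<tau> c. \<tau> \<in> histories G \<Longrightarrow> c < g \<Longrightarrow> succ (h \<tau>) c = h (\<tau> @ [c])"
    and col: "\<And>\<tau>. \<tau> \<in> histories G \<Longrightarrow> col (h \<tau>) = color G \<tau>"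
begin

text \<open>For reachability a state of colour 1 has no outgoing edges, so after the goal has been
  met no safety condition remains. Indistinguishable histories have equal colours, hence this
  affects whole classes.\<close>

definition game_edge :: "nat \<Rightarrow> nat \<Rightarrow> nat \<Rightarrow> bool" where
  "game_edge p a q \<longleftrightarrow> \<not> (r \<and> col p = 1) \<and> (\<exists>c<g. act G c = a \<and> q = succ p c)"

definition game_eqv :: "nat \<Rightarrow> nat \<Rightarrow> bool" where
  "game_eqv p q \<longleftrightarrow> (\<exists>\<tau> \<tau>'. (\<tau>, \<tau>') \<in> indist G \<and> h \<tau> = p \<and> h \<tau>' = q)"

definition game_target :: "nat \<Rightarrow> bool" where
  "game_target p \<longleftrightarrow> col p = 1"

sublocale arena n k game_edge game_target game_eqv .

abbreviation "objective \<equiv> if r then Reach else Buchi"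

lemma Nil_history [simp]: "[] \<in> histories G"
  by (simp add: histories_def)

lemma snoc_history [simp]: "\<tau> @ [c] \<in> histories G \<longleftrightarrow> \<tau> \<in> histories G \<and> c < g"
  by (auto simp: histories_def moves)

lemma take_history: "\<tau> \<in> histories G \<Longrightarrow> take i \<tau> \<in> histories G"
  by (auto simp: histories_def dest: in_set_takeD)

lemma equiv: "equiv (histories G) (indist G)"
  using game by (simp add: imperfect_information_game_def indistinguishability_def)

lemma indist_histories: "(\<tau>, \<tau>') \<in> indist G \<Longrightarrow> \<tau> \<in> histories G \<and> \<tau>' \<in> histories G"
  using equiv by (auto simp: equiv_def)

lemma indist_refl: "\<tau> \<in> histories G \<Longrightarrow> (\<tau>, \<tau>) \<in> indist G"
  using equiv by (auto simp: equiv_def refl_on_def)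

lemma indist_sym: "(\<tau>, \<tau>') \<in> indist G \<Longrightarrow> (\<tau>', \<tau>) \<in> indist G"
  using equiv by (auto simp: equiv_def sym_def)

lemma indist_trans: "(\<tau>, \<tau>') \<in> indist G \<Longrightarrow> (\<tau>', \<tau>'') \<in> indist G \<Longrightarrow> (\<tau>, \<tau>'') \<in> indist G"
  using equiv unfolding equiv_def by (blast dest: transD)

lemma indist_length: "(\<tau>, \<tau>') \<in> indist G \<Longrightarrow> length \<tau> = length \<tau>'"
  using game by (simp add: imperfect_information_game_def indistinguishability_def)

lemma indist_snoc: "(\<tau> @ [c], \<tau>' @ [c']) \<in> indist G \<Longrightarrow> (\<tau>, \<tau>') \<in> indist G \<and> act G c = act G c'"
  using game unfolding imperfect_information_game_def indistinguishability_def by blast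

lemma indist_color: "(\<tau>, \<tau>') \<in> indist G \<Longrightarrow> color G \<tau> = color G \<tau>'"
  using game by (auto simp: imperfect_information_game_def)

lemma h_less: "\<tau> \<in> histories G \<Longrightarrow> h \<tau> < n"
  using morphism by (auto simp: rectangular_morphism_def)

lemma act_image: "act G ` {..<g} = {..<k}"
  using game by (simp add: imperfect_information_game_def moves actions)

lemma k_pos: "k > 0"
  using game by (auto simp: imperfect_information_game_def actions)

lemma color_cases: "\<tau> \<in> histories G \<Longrightarrow> color G \<tau> \<in> {0, 1}"
  using game by (auto simp: imperfect_information_game_def colors)

text \<open>By rectangularity a witness for the equivalence can be moved to any history with the
  same image. Transitivity of \<open>game_eqv\<close> rests on this.\<close>

lemma game_eqv_iff:
  assumes "\<tau> \<in> histories G"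
  shows "game_eqv (h \<tau>) q \<longleftrightarrow> (\<exists>\<tau>'. (\<tau>, \<tau>') \<in> indist G \<and> h \<tau>' = q)"
proof
  assume "game_eqv (h \<tau>) q"
  then obtain \<sigma> \<sigma>' where \<sigma>: "(\<sigma>, \<sigma>') \<in> indist G" "h \<sigma> = h \<tau>" "h \<sigma>' = q"
    by (auto simp: game_eqv_def)
  then have "h ` information_set G \<sigma> = h ` information_set G \<tau>"
    using morphism assms indist_histories unfolding rectangular_morphism_def by blast
  moreover have "q \<in> h ` information_set G \<sigma>"
    using \<sigma> by (auto simp: information_set_def)
  ultimately show "\<exists>\<tau>'. (\<tau>, \<tau>') \<in> indist G \<and> h \<tau>' = q"
    by (auto simp: information_set_def)
qed (auto simp: game_eqv_def)

lemma game_eqv_info: "\<tau> \<in> histories G \<Longrightarrow> q \<in> h ` information_set G \<tau> \<longleftrightarrow> game_eqv (h \<tau>) q"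
  by (auto simp: game_eqv_iff information_set_def)

lemma game_eqv_refl: "\<tau> \<in> histories G \<Longrightarrow> game_eqv (h \<tau>) (h \<tau>)"
  using indist_refl by (auto simp: game_eqv_def)

lemma game_eqv_sym: "game_eqv p q \<Longrightarrow> game_eqv q p"
  using indist_sym by (auto simp: game_eqv_def)

lemma game_eqv_trans:
  assumes "game_eqv p q" "game_eqv q s"
  shows "game_eqv p s"
proof -
  obtain \<tau> \<tau>' where \<tau>: "(\<tau>, \<tau>') \<in> indist G" "h \<tau> = p" "h \<tau>' = q"
    using assms by (auto simp: game_eqv_def)
  then obtain \<tau>'' where "(\<tau>', \<tau>'') \<in> indist G" "h \<tau>'' = s"
    using assms game_eqv_iff[of \<tau>' s] indist_histories by auto
  then show ?thesis
    using \<tau> indist_trans unfolding game_eqv_def by blast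
qed

text \<open>One formula serves both objectives because of its negation: there is a prefix of length
  \<open>m\<close> after which no 1 occurs and, for reachability, inside which none occurred. The
  bound \<open>m \<ge> 1\<close> makes this prefix a nonempty history.\<close>

lemma objective_iff:
  assumes "\<pi> \<in> streams (moves G)"
  shows "color_sequence G \<pi> \<in> objective \<longleftrightarrow>
    (\<forall>m\<ge>1. (\<exists>i\<ge>m. color G (stake (Suc i) \<pi>) = 1) \<or> (r \<and> (\<exists>i<m. color G (stake (Suc i) \<pi>) = 1)))"
proof -
  have snth: "color_sequence G \<pi> !! i = color G (stake (Suc i) \<pi>)" for i
    by (simp add: color_sequence_def)
  have "stake i \<pi> \<in> histories G" for i
    using assms by (auto simp: histories_def streams_iff_snth in_set_conv_nth)
  then have bits: "color_sequence G \<pi> \<in> streams {0, 1}"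
    using color_cases by (simp add: streams_iff_snth snth del: stake.simps)
  have "(\<forall>m\<ge>1. (\<exists>i\<ge>m. P i) \<or> (\<exists>i<m. P i)) \<longleftrightarrow> (\<exists>i. P i)" for P :: "nat \<Rightarrow> bool"
    by (meson le_less_linear order_refl)
  moreover have "(\<forall>m\<ge>1. \<exists>i\<ge>m. P i) \<longleftrightarrow> (\<forall>m. \<exists>i\<ge>m. P i)" for P :: "nat \<Rightarrow> bool"
    by (metis le_add2 le_trans nat_le_linear)
  ultimately show ?thesis
    by (cases r) (simp_all add: Reach_iff[OF bits] Buchi_iff[OF bits] snth del: stake.simps)
qed

text \<open>Only the colours of the next \<open>j\<close> proper extensions of \<open>\<tau>\<close>
  are constrained, not the colour of \<open>\<tau>\<close> itself; for Buchi, \<open>\<tau>\<close>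
  may just have visited colour 1.\<close>

definition avoiding :: "nat list \<Rightarrow> nat \<Rightarrow> nat stream set" where
  "avoiding \<tau> j = {\<pi> \<in> streams (moves G). stake (length \<tau>) \<pi> = \<tau> \<and>
     (\<forall>i. length \<tau> \<le> i \<and> i < length \<tau> + j \<longrightarrow> color G (stake (Suc i) \<pi>) \<noteq> 1)}"

lemma avoiding_Suc:
  "avoiding \<tau> (Suc j) = (\<Union>c\<in>{c. c < g \<and> color G (\<tau> @ [c]) \<noteq> 1}. avoiding (\<tau> @ [c]) j)"
  (is "?L = ?R")
proof (intro set_eqI iffI)
  fix \<pi> assume \<pi>: "\<pi> \<in> ?L"
  define c where "c = \<pi> !! length \<tau>"
  have stake: "stake (Suc (length \<tau>)) \<pi> = \<tau> @ [c]"
    using \<pi> by (simp add: avoiding_def stake_Suc c_def del: stake.simps)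
  have "c < g"
    using \<pi> by (simp add: avoiding_def moves streams_iff_snth c_def)
  moreover have "color G (\<tau> @ [c]) \<noteq> 1"
    using \<pi> stake by (auto simp: avoiding_def simp del: stake.simps dest: spec[of _ "length \<tau>"])
  moreover have "\<pi> \<in> avoiding (\<tau> @ [c]) j"
    using \<pi> stake by (auto simp: avoiding_def simp del: stake.simps)
  ultimately show "\<pi> \<in> ?R"
    by auto
next
  fix \<pi> assume "\<pi> \<in> ?R"
  then obtain c where c: "c < g" "color G (\<tau> @ [c]) \<noteq> 1" "\<pi> \<in> avoiding (\<tau> @ [c]) j"
    by auto
  then have \<pi>: "\<pi> \<in> streams (moves G)" and stake: "stake (Suc (length \<tau>)) \<pi> = \<tau> @ [c]"
    by (auto simp: avoiding_def simp del: stake.simps)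
  then have "stake (length \<tau>) \<pi> = \<tau>"
    by (simp add: stake_Suc del: stake.simps)
  moreover have "color G (stake (Suc i) \<pi>) \<noteq> 1" if "length \<tau> \<le> i" "i < length \<tau> + Suc j" for i
  proof (cases "i = length \<tau>")
    case True
    then show ?thesis
      using stake c by (simp del: stake.simps)
  next
    case False
    then show ?thesis
      using c(3) that by (simp add: avoiding_def del: stake.simps)
  qed
  ultimately show "\<pi> \<in> ?L"
    using \<pi> by (simp add: avoiding_def del: stake.simps)
qed

lemma avoiding_measurable [measurable]:
  "avoiding \<tau> j \<in> sets (stream_space (count_space (moves G)))"
proof (induction j arbitrary: \<tau>)
  case 0
  have "avoiding \<tau> 0 = {\<pi> \<in> space (stream_space (count_space (moves G))). \<forall>i<length \<tau>. \<pi> !! i = \<tau> ! i}"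
    by (auto simp: avoiding_def space_stream_space list_eq_iff_nth_eq)
  also have "\<dots> \<in> sets (stream_space (count_space (moves G)))"
    by measurable
  finally show ?case .
next
  case (Suc j)
  then show ?case
    unfolding avoiding_Suc by (intro sets.finite_UN) auto
qed

definition unreached :: "nat list \<Rightarrow> bool" where
  "unreached \<tau> \<longleftrightarrow> (\<forall>i. r \<longrightarrow> 0 < i \<longrightarrow> i \<le> length \<tau> \<longrightarrow> color G (take i \<tau>) \<noteq> 1)"

lemma avoiding_forever_objective:
  assumes \<pi>: "\<pi> \<in> (\<Inter>j. avoiding \<tau> j)" and \<tau>: "\<tau> \<noteq> []" "unreached \<tau>"
  shows "color_sequence G \<pi> \<notin> objective"
proof -
  have str: "\<pi> \<in> streams (moves G)" and stake: "stake (length \<tau>) \<pi> = \<tau>"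
    using \<pi> by (auto simp: avoiding_def)
  have "color G (stake (Suc i) \<pi>) \<noteq> 1" if "i \<ge> length \<tau>" for i
  proof -
    have "\<pi> \<in> avoiding \<tau> (Suc i)"
      using \<pi> by blast
    then show ?thesis
      using that unfolding avoiding_def by auto
  qed
  moreover have "color G (stake (Suc i) \<pi>) \<noteq> 1" if r "i < length \<tau>" for i
  proof -
    have "stake (Suc i) \<pi> = take (Suc i) \<tau>"
      using that(2) stake by (metis Suc_leI take_stake min.absorb2 min.commute)
    then show ?thesis
      using \<tau>(2) that unfolding unreached_def by (simp del: stake.simps)
  qed
  moreover have "length \<tau> \<ge> 1"
    using \<tau>(1) by (simp add: Suc_le_eq)
  ultimately show ?thesis
    using objective_iff[OF str] by blast
qed

end

section \<open>The probability of missing colour 1 under fixed strategies\<close>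

locale strategies = numbered_game +
  fixes \<alpha> :: "nat list \<Rightarrow> nat pmf" and \<beta> :: "nat list \<Rightarrow> nat \<Rightarrow> nat pmf"
  assumes player: "player_strategy G \<alpha>" and environment: "environment_strategy G \<beta>"
begin

abbreviation "M \<equiv> play_measure G \<alpha> \<beta>"
abbreviation "K \<equiv> transition \<alpha> \<beta>"

sublocale M: prob_space M
  using play_measure(1)[OF player environment] .

lemma sets_M [measurable_cong]: "sets M = sets (stream_space (count_space (moves G)))"
  using play_measure(2)[OF player environment] .

lemma space_M: "space M = streams (moves G)"
  using sets_eq_imp_space_eq[OF sets_M] by (simp add: space_stream_space)

lemma sum_K:
  assumes "\<tau> \<in> histories G"
  shows "(\<Sum>c<g. pmf (K \<tau>) c) = 1"
  using set_transition[OF player environment assms] by (intro sum_pmf_eq_1) (auto simp: moves)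

text \<open>The conditional probability, given \<open>\<tau>\<close>, of not seeing colour 1 in the
  next \<open>j\<close> rounds. The recursion keeps it meaningful for histories of weight 0.\<close>

fun miss :: "nat list \<Rightarrow> nat \<Rightarrow> real" where
  "miss \<tau> 0 = 1"
| "miss \<tau> (Suc j) = (\<Sum>c<g. pmf (K \<tau>) c * (if color G (\<tau> @ [c]) = 1 then 0 else miss (\<tau> @ [c]) j))"

lemma measure_avoiding:
  "\<tau> \<in> histories G \<Longrightarrow> measure M (avoiding \<tau> j) = weight \<alpha> \<beta> \<tau> * miss \<tau> j"
proof (induction j arbitrary: \<tau>)
  case 0
  then show ?case
    using play_measure(3)[OF player environment] by (simp add: avoiding_def)
next
  case (Suc j)
  let ?C = "{c. c < g \<and> color G (\<tau> @ [c]) \<noteq> 1}"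
  have "measure M (avoiding \<tau> (Suc j)) = (\<Sum>c\<in>?C. measure M (avoiding (\<tau> @ [c]) j))"
    unfolding avoiding_Suc
  proof (rule M.finite_measure_finite_Union)
    show "disjoint_family_on (\<lambda>c. avoiding (\<tau> @ [c]) j) ?C"
      by (auto simp: disjoint_family_on_def avoiding_def simp del: stake.simps)
  qed auto
  also have "\<dots> = (\<Sum>c\<in>?C. weight \<alpha> \<beta> \<tau> * (pmf (K \<tau>) c * miss (\<tau> @ [c]) j))"
    using Suc by (intro sum.cong) (auto simp: mult.assoc)
  also have "\<dots> = (\<Sum>c<g. weight \<alpha> \<beta> \<tau> * (pmf (K \<tau>) c * (if color G (\<tau> @ [c]) = 1 then 0 else miss (\<tau> @ [c]) j)))"
    by (intro sum.mono_neutral_cong_left) auto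
  finally show ?case
    by (simp add: sum_distrib_left)
qed

lemma miss_le_1: "\<tau> \<in> histories G \<Longrightarrow> miss \<tau> j \<le> 1"
proof (induction j arbitrary: \<tau>)
  case (Suc j)
  have "miss \<tau> (Suc j) \<le> (\<Sum>c<g. pmf (K \<tau>) c * 1)"
    unfolding miss.simps using Suc by (intro sum_mono mult_left_mono) auto
  then show ?case
    using sum_K[OF Suc.prems] by simp
qed simp

lemma miss_antimono: "\<tau> \<in> histories G \<Longrightarrow> i \<le> j \<Longrightarrow> miss \<tau> j \<le> miss \<tau> i"
proof (induction i arbitrary: \<tau> j)
  case 0
  then show ?case
    using miss_le_1 by simp
next
  case (Suc i)
  then obtain j' where "j = Suc j'" "i \<le> j'"
    by (cases j) auto
  then show ?case
    using Suc by (auto intro!: sum_mono mult_left_mono)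
qed

lemma measure_avoiding_forever:
  "measure M (\<Inter>j. avoiding \<tau> j) \<le> measure M (avoiding \<tau> j)"
  by (intro M.finite_measure_mono) (auto simp: sets_M)

end

section \<open>Necessity: the states reached by a winning strategy form a sustained set\<close>

context numbered_game
begin

text \<open>For reachability the nonempty proper prefixes must not have colour 1. The history itself
  may end with colour 1, so the states in which the goal is met are included.\<close>

definition consistent :: "(nat list \<Rightarrow> nat pmf) \<Rightarrow> nat list \<Rightarrow> bool" where
  "consistent \<alpha> \<tau> \<longleftrightarrow> (\<forall>i<length \<tau>. pmf (\<alpha> (take i \<tau>)) (act G (\<tau> ! i)) > 0 \<and>
     (r \<longrightarrow> i > 0 \<longrightarrow> color G (take i \<tau>) \<noteq> 1))"

lemma consistent_Nil [simp]: "consistent \<alpha> []"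
  by (simp add: consistent_def)

lemma consistent_snoc [simp]:
  "consistent \<alpha> (\<tau> @ [c]) \<longleftrightarrow> consistent \<alpha> \<tau> \<and> pmf (\<alpha> \<tau>) (act G c) > 0 \<and> (r \<longrightarrow> \<tau> \<noteq> [] \<longrightarrow> color G \<tau> \<noteq> 1)"
  by (auto simp: consistent_def nth_append less_Suc_eq)

lemma consistent_indist:
  assumes \<alpha>: "player_strategy G \<alpha>"
  shows "(\<tau>, \<tau>') \<in> indist G \<Longrightarrow> consistent \<alpha> \<tau> \<Longrightarrow> consistent \<alpha> \<tau>'"
proof (induction \<tau> arbitrary: \<tau>' rule: rev_induct)
  case Nil
  then show ?case
    using indist_length[of "[]" \<tau>'] by simp
next
  case (snoc c \<tau>)
  then have "\<tau>' \<noteq> []"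
    using indist_length by fastforce
  then obtain c' \<sigma> where \<tau>': "\<tau>' = \<sigma> @ [c']"
    by (cases \<tau>' rule: rev_cases) auto
  then have \<sigma>: "(\<tau>, \<sigma>) \<in> indist G" "act G c = act G c'"
    using snoc.prems indist_snoc by auto
  then have "\<alpha> \<tau> = \<alpha> \<sigma>" "color G \<tau> = color G \<sigma>" "\<tau> = [] \<longleftrightarrow> \<sigma> = []"
    using \<alpha> indist_color indist_length[OF \<sigma>(1)] by (auto simp: player_strategy_def)
  with snoc \<sigma> \<tau>' show ?case
    by auto
qed

text \<open>The empty history is left out because its colour does not count, whereas
  \<open>h []\<close> as a state might be a target.\<close>

definition reached :: "(nat list \<Rightarrow> nat pmf) \<Rightarrow> nat set" where
  "reached \<alpha> = {h \<tau> | \<tau>. \<tau> \<in> histories G \<and> consistent \<alpha> \<tau> \<and> \<tau> \<noteq> []}"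

lemma reachedI: "\<tau> \<in> histories G \<Longrightarrow> consistent \<alpha> \<tau> \<Longrightarrow> \<tau> \<noteq> [] \<Longrightarrow> h \<tau> \<in> reached \<alpha>"
  unfolding reached_def by blast

text \<open>An indistinguishable history is also consistent and gets the same distribution of
  actions, so every edge under \<open>a\<close> from the class of \<open>h \<tau>\<close> extends
  some consistent history.\<close>

lemma consistent_allowed:
  assumes \<alpha>: "player_strategy G \<alpha>"
    and \<tau>: "\<tau> \<in> histories G" "consistent \<alpha> \<tau>" and a: "pmf (\<alpha> \<tau>) a > 0"
  shows "allowed (reached \<alpha>) (h \<tau>) a"
  unfolding allowed_def
proof (intro allI impI)
  fix p' q assume p': "game_eqv (h \<tau>) p'" and q: "game_edge p' a q"
  obtain \<tau>' where \<tau>': "(\<tau>, \<tau>') \<in> indist G" "h \<tau>' = p'"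
    using p' game_eqv_iff[OF \<tau>(1)] by auto
  then have hist: "\<tau>' \<in> histories G" and "\<alpha> \<tau>' = \<alpha> \<tau>"
    using \<alpha> indist_histories by (auto simp: player_strategy_def)
  obtain c where c: "c < g" "act G c = a" "q = succ p' c" and r: "\<not> (r \<and> col p' = 1)"
    using q by (auto simp: game_edge_def)
  have "consistent \<alpha> (\<tau>' @ [c])"
    using consistent_indist[OF \<alpha> \<tau>'(1) \<tau>(2)] \<open>\<alpha> \<tau>' = \<alpha> \<tau>\<close> a c r col[OF hist] \<tau>'(2) by auto
  moreover have "q = h (\<tau>' @ [c])"
    using c \<tau>' succ[OF hist] by simp
  ultimately show "q \<in> reached \<alpha>"
    using reachedI[of "\<tau>' @ [c]"] hist c by simp
qed

lemma possible_action:
  assumes \<alpha>: "player_strategy G \<alpha>" and \<tau>: "\<tau> \<in> histories G"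
  obtains a where "a < k" "pmf (\<alpha> \<tau>) a > 0"
proof -
  obtain a where a: "a \<in> set_pmf (\<alpha> \<tau>)"
    using set_pmf_not_empty by fastforce
  then show thesis
    using \<alpha> \<tau> that[of a] by (auto simp: player_strategy_def actions pmf_positive_iff)
qed

text \<open>Otherwise a deterministic environment steers along \<open>\<tau>0\<close> and then keeps
  the play outside the attractor. Colour 1 is then missed forever with probability at least the
  weight of \<open>\<tau>0\<close>, which is positive.\<close>

lemma reached_attr:
  assumes \<alpha>: "player_strategy G \<alpha>" and win: "almost_sure_winning G objective \<alpha>"
    and \<tau>0: "\<tau>0 \<in> histories G" "consistent \<alpha> \<tau>0" "\<tau>0 \<noteq> []"
  shows "h \<tau>0 \<in> attr (reached \<alpha>)"
proof (rule ccontr)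
  let ?A = "attr (reached \<alpha>)"
  assume out: "h \<tau>0 \<notin> ?A"
  define along where "along \<tau> a \<longleftrightarrow>
    length \<tau> < length \<tau>0 \<and> \<tau> = take (length \<tau>) \<tau>0 \<and> a = act G (\<tau>0 ! length \<tau>)" for \<tau> a
  \<comment> \<open>Along \<open>\<tau>0\<close> its own moves are replayed; later, moves leaving
    the attractor are preferred. The final choice keeps the strategy legal for actions all of whose
    moves enter the attractor.\<close>
  define pick where "pick \<tau> a = (if along \<tau> a then \<tau>0 ! length \<tau> else
    if \<exists>c<g. act G c = a \<and> h (\<tau> @ [c]) \<notin> ?A then SOME c. c < g \<and> act G c = a \<and> h (\<tau> @ [c]) \<notin> ?A
    else SOME c. c < g \<and> act G c = a)" for \<tau> a
  define \<beta> where "\<beta> \<tau> a = return_pmf (pick \<tau> a)" for \<tau> a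
  have pick: "pick \<tau> a < g \<and> act G (pick \<tau> a) = a" if "a < k" for \<tau> a
  proof -
    have "\<exists>c. c < g \<and> act G c = a"
      using that act_image by (metis imageE lessThan_iff)
    then have some: "(SOME c. c < g \<and> act G c = a) < g \<and> act G (SOME c. c < g \<and> act G c = a) = a"
      by (rule someI_ex)
    have "\<tau>0 ! length \<tau> < g" if "length \<tau> < length \<tau>0"
      using \<tau>0(1) that by (auto simp: histories_def moves in_lists_conv_set)
    moreover have "(SOME c. c < g \<and> act G c = a \<and> h (\<tau> @ [c]) \<notin> ?A) < g \<and>
        act G (SOME c. c < g \<and> act G c = a \<and> h (\<tau> @ [c]) \<notin> ?A) = a"
      if "\<exists>c<g. act G c = a \<and> h (\<tau> @ [c]) \<notin> ?A"
      using someI_ex[OF that] by blast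
    ultimately show ?thesis
      using some by (auto simp: pick_def along_def)
  qed
  have env: "environment_strategy G \<beta>"
    using pick by (auto simp: environment_strategy_def \<beta>_def moves actions pmf_return indicator_def)
  interpret strategies G g n k h succ col r \<alpha> \<beta>
    using \<alpha> env by unfold_locales
  have stuck: "h (\<tau> @ [c]) \<notin> ?A \<and> consistent \<alpha> (\<tau> @ [c])"
    if \<tau>: "\<tau> \<in> histories G" "consistent \<alpha> \<tau>" "h \<tau> \<notin> ?A" "length \<tau> \<ge> length \<tau>0"
      and c: "c < g" "pmf (K \<tau>) c > 0" for \<tau> c
  proof -
    define a where "a = act G c"
    have "a < k"
      using c(1) act_image by (auto simp: a_def)
    have "pmf (K \<tau>) c = pmf (\<alpha> \<tau>) a * pmf (\<beta> \<tau> a) c"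
      unfolding a_def by (rule pmf_transition[OF \<alpha> env \<tau>(1)])
    then have "pmf (\<alpha> \<tau>) a * pmf (\<beta> \<tau> a) c > 0"
      using c by simp
    then have a: "pmf (\<alpha> \<tau>) a > 0" and "c = pick \<tau> a"
      using pmf_nonneg[of "\<alpha> \<tau>" a]
      by (auto simp: \<beta>_def pmf_return indicator_def zero_less_mult_iff split: if_splits)
    \<comment> \<open>Actions in the support are allowed; if all edges of \<open>a\<close> entered
      the attractor, \<open>h \<tau>\<close> would belong to it.\<close>
    have "\<not> (\<forall>q. game_edge (h \<tau>) a q \<longrightarrow> q \<in> ?A)"
      using consistent_allowed[OF \<alpha> \<tau>(1,2) a] \<tau>(3) \<open>a < k\<close> attr.step by blast
    then obtain c' where "c' < g" "act G c' = a" "h (\<tau> @ [c']) \<notin> ?A"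
      using succ[OF \<tau>(1)] by (auto simp: game_edge_def)
    then have ex: "\<exists>c<g. act G c = a \<and> h (\<tau> @ [c]) \<notin> ?A"
      by auto
    then have "c = (SOME c. c < g \<and> act G c = a \<and> h (\<tau> @ [c]) \<notin> ?A)"
      using \<open>c = pick \<tau> a\<close> \<tau>(4) by (simp add: pick_def along_def)
    then have "h (\<tau> @ [c]) \<notin> ?A"
      using someI_ex[OF ex] by simp
    moreover have "color G \<tau> \<noteq> 1"
      using \<tau>(3) attr.target[of "h \<tau>"] col[OF \<tau>(1)] by (auto simp: game_target_def)
    ultimately show ?thesis
      using \<tau> a by (auto simp: a_def)
  qed
  have miss: "miss \<tau> j = 1"
    if "\<tau> \<in> histories G" "consistent \<alpha> \<tau>" "h \<tau> \<notin> ?A" "length \<tau> \<ge> length \<tau>0" for \<tau> j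
    using that
  proof (induction j arbitrary: \<tau>)
    case (Suc j)
    have "miss \<tau> (Suc j) = (\<Sum>c<g. pmf (K \<tau>) c)"
      unfolding miss.simps
    proof (rule sum.cong)
      fix c assume "c \<in> {..<g}"
      show "pmf (K \<tau>) c * (if color G (\<tau> @ [c]) = 1 then 0 else miss (\<tau> @ [c]) j) = pmf (K \<tau>) c"
      proof (cases "pmf (K \<tau>) c > 0")
        case True
        then have c: "h (\<tau> @ [c]) \<notin> ?A" "consistent \<alpha> (\<tau> @ [c])"
          using stuck[OF Suc.prems] \<open>c \<in> {..<g}\<close> by auto
        have hist: "\<tau> @ [c] \<in> histories G"
          using Suc.prems \<open>c \<in> {..<g}\<close> by simp
        have "color G (\<tau> @ [c]) \<noteq> 1"
          using c(1) attr.target[of "h (\<tau> @ [c])"] col[OF hist] by (auto simp: game_target_def)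
        then show ?thesis
          using Suc.IH[OF hist c(2,1)] Suc.prems by simp
      next
        case False
        then have "pmf (K \<tau>) c = 0"
          by (simp add: less_le)
        then show ?thesis
          by simp
      qed
    qed simp
    then show ?case
      using sum_K[OF Suc.prems(1)] by simp
  qed simp
  have weight: "weight \<alpha> \<beta> (take i \<tau>0) > 0" if "i \<le> length \<tau>0" for i
    using that
  proof (induction i)
    case (Suc i)
    have hist: "take i \<tau>0 \<in> histories G"
      by (rule take_history[OF \<tau>0(1)])
    have "pmf (K (take i \<tau>0)) (\<tau>0 ! i) > 0"
      using \<tau>0(2) Suc.prems
      by (simp add: pmf_transition[OF \<alpha> env hist] consistent_def \<beta>_def pick_def along_def)
    then show ?case
      using Suc by (simp add: take_Suc_conv_app_nth)
  qed simp
  let ?good = "{\<pi> \<in> streams (moves G). color_sequence G \<pi> \<in> objective}"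
  let ?bad = "\<Inter>j. avoiding \<tau>0 j"
  have "(\<lambda>j. measure M (avoiding \<tau>0 j)) \<longlonglongrightarrow> measure M ?bad"
  proof (rule M.finite_Lim_measure_decseq)
    show "range (avoiding \<tau>0) \<subseteq> sets M"
      by (auto simp: sets_M)
    show "decseq (avoiding \<tau>0)"
      by (auto simp: decseq_def avoiding_def simp del: stake.simps)
  qed
  moreover have "measure M (avoiding \<tau>0 j) = weight \<alpha> \<beta> \<tau>0" for j
    using \<tau>0 out miss by (simp add: measure_avoiding)
  ultimately have bad: "measure M ?bad > 0"
    using weight[of "length \<tau>0"] by (simp add: LIMSEQ_const_iff)
  have "unreached \<tau>0"
    unfolding unreached_def
  proof (intro allI impI)
    fix i assume i: r "0 < i" "i \<le> length \<tau>0"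
    show "color G (take i \<tau>0) \<noteq> 1"
    proof (cases "i = length \<tau>0")
      case True
      then show ?thesis
        using out attr.target[of "h \<tau>0"] col[OF \<tau>0(1)] by (auto simp: game_target_def)
    next
      case False
      then show ?thesis
        using \<tau>0(2) i unfolding consistent_def by auto
    qed
  qed
  then have disj: "?good \<inter> ?bad = {}"
    using avoiding_forever_objective \<tau>0(3) by blast
  have "measure M ?good = 1"
    using win env by (simp only: almost_sure_winning_def)
  \<comment> \<open>Sets that are not measurable have measure 0 by convention, so measure 1 already
    implies measurability.\<close>
  moreover have "?good \<in> sets M"
    using calculation measure_notin_sets by fastforce
  moreover have "?bad \<in> sets M"
    by (auto simp: sets_M)
  ultimately have "measure M (?good \<union> ?bad) = 1 + measure M ?bad"
    using disj by (subst M.finite_measure_Union) auto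
  then show False
    using bad M.prob_le_1[of "?good \<union> ?bad"] by simp
qed

lemma winning_necessary:
  assumes \<alpha>: "player_strategy G \<alpha>" and win: "almost_sure_winning G objective \<alpha>"
  shows "\<exists>a<k. \<forall>c<g. act G c = a \<longrightarrow> succ (h []) c \<in> winning"
proof -
  have "sustained (reached \<alpha>)"
    unfolding sustained_def
  proof (intro conjI ballI allI impI)
    show "reached \<alpha> \<subseteq> {..<n}"
      by (auto simp: reached_def h_less)
  next
    fix p q assume "p \<in> reached \<alpha>" "game_eqv p q"
    then obtain \<tau> where \<tau>: "\<tau> \<in> histories G" "consistent \<alpha> \<tau>" "\<tau> \<noteq> []" "p = h \<tau>"
      by (auto simp: reached_def)
    then obtain \<tau>' where \<tau>': "(\<tau>, \<tau>') \<in> indist G" "h \<tau>' = q"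
      using \<open>game_eqv p q\<close> game_eqv_iff by auto
    then show "q \<in> reached \<alpha>"
      using \<tau> consistent_indist[OF \<alpha> \<tau>'(1) \<tau>(2)] indist_histories indist_length[OF \<tau>'(1)]
      unfolding reached_def by force
  next
    fix p assume "p \<in> reached \<alpha>"
    then obtain \<tau> where \<tau>: "\<tau> \<in> histories G" "consistent \<alpha> \<tau>" "\<tau> \<noteq> []" "p = h \<tau>"
      by (auto simp: reached_def)
    show "p \<in> attr (reached \<alpha>)"
      using reached_attr[OF \<alpha> win \<tau>(1-3)] \<tau>(4) by simp
    obtain a where "a < k" "pmf (\<alpha> \<tau>) a > 0"
      by (rule possible_action[OF \<alpha> \<tau>(1)])
    then show "\<exists>a<k. allowed (reached \<alpha>) p a"
      using consistent_allowed[OF \<alpha> \<tau>(1,2)] \<tau>(4) by blast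
  qed
  then have sub: "reached \<alpha> \<subseteq> winning"
    by (rule sustained_subset_winning)
  obtain a where a: "a < k" "pmf (\<alpha> []) a > 0"
    by (rule possible_action[OF \<alpha> Nil_history])
  have "succ (h []) c \<in> winning" if "c < g" "act G c = a" for c
  proof -
    have "consistent \<alpha> ([] @ [c])"
      unfolding consistent_snoc using a that by simp
    then have "h [c] \<in> reached \<alpha>"
      using that unfolding reached_def by (auto simp: histories_def moves)
    then show ?thesis
      using sub succ[of "[]" c] that by auto
  qed
  then show ?thesis
    using a by blast
qed

text \<open>The first action is the parameter \<open>a0\<close>, since the empty history is not
  governed by \<open>winning\<close>. Action 0 is a legal default because
  \<open>k > 0\<close>.\<close>

definition uniform_strategy :: "nat \<Rightarrow> nat list \<Rightarrow> nat pmf" where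
  "uniform_strategy a0 \<tau> = (if \<tau> = [] then return_pmf a0
     else if h \<tau> \<in> winning then pmf_of_set {a. a < k \<and> allowed winning (h \<tau>) a}
     else return_pmf 0)"

lemma winning_allowed_action: "p \<in> winning \<Longrightarrow> \<exists>a<k. allowed winning p a"
  using sustained_winning by (simp add: sustained_def)

lemma winning_eqv: "p \<in> winning \<Longrightarrow> game_eqv p q \<Longrightarrow> q \<in> winning"
  using sustained_winning unfolding sustained_def by blast

lemma set_uniform:
  assumes "p \<in> winning"
  shows "set_pmf (pmf_of_set {a. a < k \<and> allowed winning p a}) = {a. a < k \<and> allowed winning p a}"
  using winning_allowed_action[OF assms] by (intro set_pmf_of_set) auto

text \<open>Membership in \<open>winning\<close> and the set of allowed actions depend only on the
  class of the state, so the strategy respects indistinguishability.\<close>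

lemma player_uniform_strategy:
  assumes "a0 < k"
  shows "player_strategy G (uniform_strategy a0)"
proof -
  have "uniform_strategy a0 \<tau> = uniform_strategy a0 \<tau>'" if eqv: "(\<tau>, \<tau>') \<in> indist G" for \<tau> \<tau>'
  proof -
    have hist: "\<tau> \<in> histories G" "\<tau>' \<in> histories G"
      using eqv indist_histories by auto
    have "game_eqv (h \<tau>) (h \<tau>')"
      using eqv by (auto simp: game_eqv_def)
    then have "h \<tau> \<in> winning \<longleftrightarrow> h \<tau>' \<in> winning"
      and "allowed winning (h \<tau>) a \<longleftrightarrow> allowed winning (h \<tau>') a" for a
      unfolding allowed_def using winning_eqv game_eqv_sym game_eqv_trans by blast+
    moreover have "\<tau> = [] \<longleftrightarrow> \<tau>' = []"
      using indist_length[OF eqv] by auto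
    ultimately show ?thesis
      by (simp add: uniform_strategy_def)
  qed
  moreover have "set_pmf (uniform_strategy a0 \<tau>) \<subseteq> {..<k}" for \<tau>
    using assms k_pos set_uniform by (auto simp: uniform_strategy_def)
  ultimately show ?thesis
    by (auto simp: player_strategy_def actions)
qed

end

section \<open>Sufficiency: the uniform strategy wins almost surely\<close>

locale uniform_play = strategies +
  fixes a0 :: nat
  assumes uniform: "\<alpha> = uniform_strategy a0"
    and first: "\<And>c. c < g \<Longrightarrow> act G c = a0 \<Longrightarrow> succ (h []) c \<in> winning"
begin

definition live :: "nat list \<Rightarrow> bool" where
  "live \<tau> \<longleftrightarrow> \<tau> \<in> histories G \<and> \<tau> \<noteq> [] \<and> weight \<alpha> \<beta> \<tau> > 0 \<and>
     unreached \<tau>"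

lemma K_pos_iff:
  assumes "\<tau> \<in> histories G"
  shows "pmf (K \<tau>) c > 0 \<longleftrightarrow> pmf (\<alpha> \<tau>) (act G c) > 0 \<and> pmf (\<beta> \<tau> (act G c)) c > 0"
  unfolding pmf_transition[OF player environment assms]
  using pmf_nonneg[of "\<alpha> \<tau>" "act G c"] pmf_nonneg[of "\<beta> \<tau> (act G c)" c]
  by (auto simp: zero_less_mult_iff)

lemma live_snoc:
  assumes "live \<tau>" "c < g" "pmf (K \<tau>) c > 0" "r \<longrightarrow> color G (\<tau> @ [c]) \<noteq> 1"
  shows "live (\<tau> @ [c])"
  using assms unfolding live_def unreached_def by (auto simp: le_Suc_eq)

lemma step_winning:
  assumes \<tau>: "\<tau> \<in> histories G" "\<tau> \<noteq> []" "h \<tau> \<in> winning" "r \<longrightarrow> color G \<tau> \<noteq> 1"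
    and c: "c < g" "pmf (K \<tau>) c > 0"
  shows "allowed winning (h \<tau>) (act G c)" "game_edge (h \<tau>) (act G c) (h (\<tau> @ [c]))"
    "h (\<tau> @ [c]) \<in> winning"
proof -
  have "pmf (\<alpha> \<tau>) (act G c) > 0"
    using c K_pos_iff[OF \<tau>(1)] by simp
  then have "act G c \<in> set_pmf (\<alpha> \<tau>)"
    by (simp add: pmf_positive_iff)
  then show allowed: "allowed winning (h \<tau>) (act G c)"
    using \<tau> set_uniform[OF \<tau>(3)] by (simp add: uniform uniform_strategy_def)
  show edge: "game_edge (h \<tau>) (act G c) (h (\<tau> @ [c]))"
    using \<tau>(4) c(1) succ[OF \<tau>(1) c(1)] col[OF \<tau>(1)] unfolding game_edge_def by auto
  then show "h (\<tau> @ [c]) \<in> winning"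
    using allowed game_eqv_refl[OF \<tau>(1)] unfolding allowed_def by blast
qed

lemma live_winning: "live \<tau> \<Longrightarrow> h \<tau> \<in> winning"
proof (induction \<tau> rule: rev_induct)
  case (snoc c \<tau>)
  then have \<tau>: "\<tau> \<in> histories G" "c < g" and w: "weight \<alpha> \<beta> \<tau> * pmf (K \<tau>) c > 0"
    unfolding live_def by auto
  from w have w: "weight \<alpha> \<beta> \<tau> > 0" "pmf (K \<tau>) c > 0"
    using weight_nonneg[of "\<alpha>" \<beta> \<tau>] pmf_nonneg[of "K \<tau>" c]
    by (auto simp: zero_less_mult_iff)
  show ?case
  proof (cases "\<tau> = []")
    case True
    have "act G c \<in> set_pmf (\<alpha> \<tau>)"
      using w K_pos_iff[OF \<tau>(1)] by (simp add: pmf_positive_iff)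
    then have "act G c = a0"
      using True by (simp add: uniform uniform_strategy_def)
    then show ?thesis
      using first[of c] \<tau> True succ[of "[]" c] by simp
  next
    case False
    have early: "color G (take i \<tau>) \<noteq> 1" if r "0 < i" "i \<le> length \<tau>" for i
      using snoc.prems that unfolding live_def unreached_def by (auto dest!: spec[of _ i])
    then have "live \<tau>"
      using \<tau> w False unfolding live_def unreached_def by auto
    moreover have "r \<longrightarrow> color G \<tau> \<noteq> 1"
      using early[of "length \<tau>"] False by auto
    ultimately show ?thesis
      using step_winning(3) snoc.IH \<tau> w False by blast
  qed
qed (simp add: live_def)

text \<open>Markov property: a live history that survives the first \<open>i\<close> rounds without
  colour 1 is again live, so the next \<open>m\<close> rounds contribute a factor of at most
  \<open>x\<close>.\<close>

lemma miss_shift: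
  assumes bound: "\<And>\<tau>. live \<tau> \<Longrightarrow> miss \<tau> m \<le> x" and "live \<tau>"
  shows "miss \<tau> (i + m) \<le> x * miss \<tau> i"
  using \<open>live \<tau>\<close>
proof (induction i arbitrary: \<tau>)
  case 0
  then show ?case
    using bound by simp
next
  case (Suc i)
  have "miss \<tau> (Suc i + m) \<le>
      (\<Sum>c<g. x * (pmf (K \<tau>) c * (if color G (\<tau> @ [c]) = 1 then 0 else miss (\<tau> @ [c]) i)))"
    unfolding add_Suc miss.simps
  proof (rule sum_mono)
    fix c assume c: "c \<in> {..<g}"
    show "pmf (K \<tau>) c * (if color G (\<tau> @ [c]) = 1 then 0 else miss (\<tau> @ [c]) (i + m))
      \<le> x * (pmf (K \<tau>) c * (if color G (\<tau> @ [c]) = 1 then 0 else miss (\<tau> @ [c]) i))"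
    proof (cases "pmf (K \<tau>) c > 0 \<and> color G (\<tau> @ [c]) \<noteq> 1")
      case True
      then have "live (\<tau> @ [c])"
        using c Suc.prems live_snoc by simp
      from Suc.IH[OF this] show ?thesis
        using True by (simp add: mult.left_commute)
    next
      case False
      then have "pmf (K \<tau>) c = 0 \<or> color G (\<tau> @ [c]) = 1"
        by (auto simp: less_le)
      then show ?thesis
        by auto
    qed
  qed
  then show ?case
    by (simp add: sum_distrib_left)
qed

lemma winning_attr: "p \<in> winning \<Longrightarrow> p \<in> attr winning"
  using sustained_winning by (simp add: sustained_def)

lemma uniform_pmf_ge:
  assumes "\<tau> \<noteq> []" "h \<tau> \<in> winning" "a < k" "allowed winning (h \<tau>) a"
  shows "pmf (\<alpha> \<tau>) a \<ge> 1 / k"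
proof -
  let ?A = "{a. a < k \<and> allowed winning (h \<tau>) a}"
  have "a \<in> ?A" "finite ?A"
    using assms by auto
  moreover have "card ?A \<le> card {..<k}"
    by (rule card_mono) auto
  moreover have "card ?A > 0"
    using \<open>a \<in> ?A\<close> \<open>finite ?A\<close> by (auto simp: card_gt_0_iff)
  ultimately show ?thesis
    using assms by (subst uniform) (auto simp: uniform_strategy_def pmf_of_set card_gt_0_iff intro!: frac_le)
qed

lemma sum_K_action:
  assumes \<tau>: "\<tau> \<in> histories G" and a: "a < k"
  shows "(\<Sum>c\<in>{c. c < g \<and> act G c = a}. pmf (K \<tau>) c) = pmf (\<alpha> \<tau>) a"
proof -
  have sub: "set_pmf (\<beta> \<tau> a) \<subseteq> {c. c < g \<and> act G c = a}"
    using environment \<tau> a by (auto simp: environment_strategy_def moves actions pmf_positive_iff)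
  have "(\<Sum>c\<in>{c. c < g \<and> act G c = a}. pmf (K \<tau>) c) =
      (\<Sum>c\<in>{c. c < g \<and> act G c = a}. pmf (\<alpha> \<tau>) a * pmf (\<beta> \<tau> a) c)"
    by (rule sum.cong) (auto simp: pmf_transition[OF player environment \<tau>])
  also have "\<dots> = pmf (\<alpha> \<tau>) a"
    using sub by (simp add: sum_distrib_left[symmetric] sum_pmf_eq_1)
  finally show ?thesis .
qed

text \<open>The environment chooses among the moves of an action but cannot change the total mass
  \<open>pmf (\<alpha> \<tau>) a\<close> that they carry. On this mass the bound
  \<open>1 - x\<close> applies, on the rest the trivial bound 1.\<close>

lemma miss_drop:
  assumes \<tau>: "\<tau> \<in> histories G" and a: "a < k"
    and x: "\<And>c. c < g \<Longrightarrow> act G c = a \<Longrightarrow> pmf (K \<tau>) c > 0 \<Longrightarrow>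
      (if color G (\<tau> @ [c]) = 1 then 0 else miss (\<tau> @ [c]) i) \<le> 1 - x"
  shows "miss \<tau> (Suc i) \<le> 1 - pmf (\<alpha> \<tau>) a * x"
proof -
  let ?C = "{c. c < g \<and> act G c = a}"
  have "miss \<tau> (Suc i) \<le> (\<Sum>c<g. pmf (K \<tau>) c * (1 - (if act G c = a then x else 0)))"
    unfolding miss.simps
  proof (rule sum_mono)
    fix c assume c: "c \<in> {..<g}"
    then have le1: "miss (\<tau> @ [c]) i \<le> 1"
      using miss_le_1 \<tau> by simp
    show "pmf (K \<tau>) c * (if color G (\<tau> @ [c]) = 1 then 0 else miss (\<tau> @ [c]) i)
        \<le> pmf (K \<tau>) c * (1 - (if act G c = a then x else 0))"
    proof (cases "pmf (K \<tau>) c > 0")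
      case True
      then show ?thesis
        using x[of c] c le1 by (intro mult_left_mono) auto
    next
      case False
      then have "pmf (K \<tau>) c = 0"
        by (simp add: less_le)
      then show ?thesis
        by simp
    qed
  qed
  also have "\<dots> = (\<Sum>c<g. pmf (K \<tau>) c) - (\<Sum>c<g. if act G c = a then pmf (K \<tau>) c * x else 0)"
    unfolding sum_subtractf[symmetric] by (rule sum.cong) (auto simp: algebra_simps)
  also have "(\<Sum>c<g. if act G c = a then pmf (K \<tau>) c * x else 0) = (\<Sum>c\<in>?C. pmf (K \<tau>) c * x)"
    by (intro sum.mono_neutral_cong_right) auto
  also have "\<dots> = pmf (\<alpha> \<tau>) a * x"
    using sum_K_action[OF \<tau> a] by (simp add: sum_distrib_right[symmetric])
  finally show ?thesis
    using sum_K[OF \<tau>] by simp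
qed

text \<open>The helpful action is drawn with probability at least \<open>1 / k\<close>, which costs
  one more factor \<open>1 / k\<close>. Other drawn actions are safe as well, so the play remains in
  \<open>winning\<close>.\<close>

lemma hit_step:
  assumes \<tau>: "live \<tau>" and a: "a < k" "allowed winning (h \<tau>) a"
    and hit: "\<And>\<tau>'. live \<tau>' \<Longrightarrow> game_edge (h \<tau>) a (h \<tau>') \<Longrightarrow> color G \<tau>' \<noteq> 1 \<Longrightarrow> miss \<tau>' i \<le> 1 - (1 / k) ^ i"
  shows "miss \<tau> (Suc i) \<le> 1 - (1 / k) ^ Suc i"
proof -
  have hist: "\<tau> \<in> histories G" "\<tau> \<noteq> []"
    using \<tau> by (auto simp: live_def)
  have win: "h \<tau> \<in> winning"
    by (rule live_winning[OF \<tau>])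
  have color: "r \<longrightarrow> color G \<tau> \<noteq> 1"
    using \<tau> hist(2) unfolding live_def unreached_def by (auto dest!: spec[of _ "length \<tau>"])
  have "miss \<tau> (Suc i) \<le> 1 - pmf (\<alpha> \<tau>) a * (1 / k) ^ i"
  proof (rule miss_drop[OF hist(1) a(1)])
    fix c assume c: "c < g" "act G c = a" "pmf (K \<tau>) c > 0"
    show "(if color G (\<tau> @ [c]) = 1 then 0 else miss (\<tau> @ [c]) i) \<le> 1 - (1 / k) ^ i"
    proof (cases "color G (\<tau> @ [c]) = 1")
      case True
      then show ?thesis
        using k_pos by (simp add: power_le_one)
    next
      case False
      then have "live (\<tau> @ [c])"
        using live_snoc \<tau> c by blast
      moreover have "game_edge (h \<tau>) a (h (\<tau> @ [c]))"
        using step_winning(2)[OF hist win color c(1,3)] c(2) by simp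
      ultimately show ?thesis
        using hit False by simp
    qed
  qed
  also have "\<dots> \<le> 1 - (1 / k) * (1 / k) ^ i"
    using uniform_pmf_ge[OF hist(2) win a] by (intro diff_left_mono mult_right_mono) auto
  finally show ?thesis
    by simp
qed

text \<open>There are finitely many states, so the maximum of their times works for all:
  \<open>miss\<close> decreases with time while the bound \<open>1 - (1 / k) ^ i\<close>
  increases.\<close>

lemma common_hit_time:
  assumes "\<forall>p. \<exists>i. Q p \<longrightarrow> (\<forall>\<tau>. live \<tau> \<longrightarrow> h \<tau> = p \<longrightarrow> color G \<tau> \<noteq> 1 \<longrightarrow> miss \<tau> i \<le> 1 - (1 / k) ^ i)"
  obtains i where "\<And>\<tau>. live \<tau> \<Longrightarrow> Q (h \<tau>) \<Longrightarrow> color G \<tau> \<noteq> 1 \<Longrightarrow> miss \<tau> i \<le> 1 - (1 / k) ^ i"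
proof -
  obtain f where f: "\<And>\<tau>. live \<tau> \<Longrightarrow> Q (h \<tau>) \<Longrightarrow> color G \<tau> \<noteq> 1 \<Longrightarrow>
      miss \<tau> (f (h \<tau>)) \<le> 1 - (1 / k) ^ f (h \<tau>)"
    using assms by metis
  define i where "i = Max (f ` {..<n})"
  have "miss \<tau> i \<le> 1 - (1 / k) ^ i" if \<tau>: "live \<tau>" "Q (h \<tau>)" "color G \<tau> \<noteq> 1" for \<tau>
  proof -
    have hist: "\<tau> \<in> histories G"
      using \<tau> by (simp add: live_def)
    have le: "f (h \<tau>) \<le> i"
      unfolding i_def using hist h_less by (intro Max_ge) auto
    then have "miss \<tau> i \<le> miss \<tau> (f (h \<tau>))"
      by (rule miss_antimono[OF hist])
    also have "\<dots> \<le> 1 - (1 / k) ^ f (h \<tau>)"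
      using f[OF \<tau>] .
    also have "\<dots> \<le> 1 - (1 / k) ^ i"
      using le k_pos by (simp add: power_decreasing)
    finally show ?thesis .
  qed
  then show thesis
    by (rule that)
qed

lemma attr_hits:
  "p \<in> attr winning \<Longrightarrow> \<exists>i. \<forall>\<tau>. live \<tau> \<longrightarrow> h \<tau> = p \<longrightarrow> color G \<tau> \<noteq> 1 \<longrightarrow> miss \<tau> i \<le> 1 - (1 / k) ^ i"
proof (induction rule: attr.induct)
  \<comment> \<open>A history mapped to a target has colour 1 and is excluded by the premise, so the
    claim is vacuous.\<close>
  case (target p)
  then show ?case
    using col unfolding live_def game_target_def by auto
next
  case (step a p)
  obtain i where "\<And>\<tau>. live \<tau> \<Longrightarrow> game_edge p a (h \<tau>) \<Longrightarrow> color G \<tau> \<noteq> 1 \<Longrightarrow> miss \<tau> i \<le> 1 - (1 / k) ^ i"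
    by (rule common_hit_time[of "game_edge p a"]) (use step.IH in blast)+
  then show ?case
    using hit_step step.hyps by blast
qed

text \<open>The current history may itself have colour 1, about which \<open>attr_hits\<close> says
  nothing. One extra round with any allowed action leads either to colour 1 or to a history of
  another colour.\<close>

lemma miss_bound: "\<exists>m x. x < 1 \<and> 0 \<le> x \<and> (\<forall>\<tau>. live \<tau> \<longrightarrow> miss \<tau> m \<le> x)"
proof -
  obtain i where i: "\<And>\<tau>. live \<tau> \<Longrightarrow> h \<tau> \<in> winning \<Longrightarrow> color G \<tau> \<noteq> 1 \<Longrightarrow> miss \<tau> i \<le> 1 - (1 / k) ^ i"
    by (rule common_hit_time[of "\<lambda>p. p \<in> winning"]) (use attr_hits winning_attr in blast)+
  have "miss \<tau> (Suc i) \<le> 1 - (1 / k) ^ Suc i" if "live \<tau>" for \<tau>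
    using hit_step[OF that] i live_winning winning_allowed_action[OF live_winning[OF that]] by blast
  moreover have "1 - (1 / k) ^ Suc i < 1" "0 \<le> 1 - (1 / k) ^ Suc i"
    using k_pos by (simp_all add: power_le_one del: power_Suc)
  ultimately show ?thesis
    by blast
qed

lemma measure_avoiding_forever_live:
  assumes "live \<tau>"
  shows "measure M (\<Inter>j. avoiding \<tau> j) = 0"
proof -
  obtain m x where mx: "x < 1" "0 \<le> x" "\<And>\<tau>. live \<tau> \<Longrightarrow> miss \<tau> m \<le> x"
    using miss_bound by blast
  have hist: "\<tau> \<in> histories G"
    using assms by (simp add: live_def)
  \<comment> \<open>Time is cut into blocks of \<open>m\<close> rounds, each of which is missed with
    probability at most \<open>x < 1\<close>.\<close>
  have "miss \<tau> (j * m) \<le> x ^ j" if "live \<tau>" for j \<tau>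
    using that
  proof (induction j arbitrary: \<tau>)
    case (Suc j)
    have "miss \<tau> (m + j * m) \<le> x ^ j * miss \<tau> m"
      by (rule miss_shift[OF Suc.IH Suc.prems])
    also have "\<dots> \<le> x ^ j * x"
      using mx Suc.prems by (intro mult_left_mono) auto
    finally show ?case
      by (simp add: mult.commute)
  qed simp
  then have "measure M (\<Inter>j. avoiding \<tau> j) \<le> weight \<alpha> \<beta> \<tau> * x ^ j" for j
    using measure_avoiding_forever[of \<tau> "j * m"] assms weight_nonneg[of "\<alpha>" \<beta> \<tau>]
    by (fastforce simp: measure_avoiding[OF hist] intro: order_trans mult_left_mono)
  moreover have "(\<lambda>j. weight \<alpha> \<beta> \<tau> * x ^ j) \<longlonglongrightarrow> weight \<alpha> \<beta> \<tau> * 0"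
    using mx by (intro tendsto_mult_left LIMSEQ_power_zero) auto
  ultimately have "measure M (\<Inter>j. avoiding \<tau> j) \<le> 0"
    using LIMSEQ_le_const by (metis mult_zero_right)
  then show ?thesis
    by (simp add: measure_le_0_iff)
qed

text \<open>A play fails only if colour 1 stops appearing after some finite prefix. There are
  countably many prefixes, and each yields a null event: live ones by the geometric bound, those of
  weight 0 trivially.\<close>

lemma measure_objective:
  "measure M {\<pi> \<in> streams (moves G). color_sequence G \<pi> \<in> objective} = 1"
proof -
  let ?T = "{\<tau> \<in> histories G. \<tau> \<noteq> [] \<and> unreached \<tau>}"
  let ?bad = "\<lambda>\<tau>. \<Inter>j. avoiding \<tau> j"
  have null: "measure M (?bad \<tau>) = 0" if "\<tau> \<in> ?T" for \<tau>
  proof (cases "weight \<alpha> \<beta> \<tau> > 0")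
    case True
    then show ?thesis
      using that by (intro measure_avoiding_forever_live) (auto simp: live_def)
  next
    case False
    then have "weight \<alpha> \<beta> \<tau> = 0"
      using weight_nonneg[of "\<alpha>" \<beta> \<tau>] by simp
    then have "measure M (avoiding \<tau> 0) = 0"
      using that by (simp add: measure_avoiding)
    then show ?thesis
      using measure_avoiding_forever[of \<tau> 0] by (simp add: measure_le_0_iff)
  qed
  have bad_sets: "?bad \<tau> \<in> sets M" for \<tau>
    by (auto simp: sets_M)
  have "\<forall>\<tau>\<in>?T. AE \<pi> in M. \<pi> \<notin> ?bad \<tau>"
    using null bad_sets by (intro ballI AE_not_in) (simp add: null_sets_def M.emeasure_eq_measure)
  then have "AE \<pi> in M. \<forall>\<tau>\<in>?T. \<pi> \<notin> ?bad \<tau>"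
    by (subst AE_ball_countable) auto
  have good: "{\<pi> \<in> streams (moves G). color_sequence G \<pi> \<in> objective} = space M - (\<Union>\<tau>\<in>?T. ?bad \<tau>)"
  proof (intro set_eqI iffI)
    fix \<pi> assume "\<pi> \<in> {\<pi> \<in> streams (moves G). color_sequence G \<pi> \<in> objective}"
    then show "\<pi> \<in> space M - (\<Union>\<tau>\<in>?T. ?bad \<tau>)"
      using avoiding_forever_objective by (auto simp: space_M)
  next
    fix \<pi> assume \<pi>: "\<pi> \<in> space M - (\<Union>\<tau>\<in>?T. ?bad \<tau>)"
    then have str: "\<pi> \<in> streams (moves G)"
      by (simp add: space_M)
    have "(\<exists>i\<ge>m. color G (stake (Suc i) \<pi>) = 1) \<or> (r \<and> (\<exists>i<m. color G (stake (Suc i) \<pi>) = 1))"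
      if "m \<ge> 1" for m
    proof (rule ccontr)
      assume contra: "\<not> ?thesis"
      define \<tau> where "\<tau> = stake m \<pi>"
      have hist: "\<tau> \<in> histories G"
        using str by (auto simp: \<tau>_def histories_def streams_iff_snth in_set_conv_nth)
      have "color G (take i \<tau>) \<noteq> 1" if r "0 < i" "i \<le> length \<tau>" for i
      proof -
        have "take i \<tau> = stake (Suc (i - 1)) \<pi>"
          using that by (simp add: \<tau>_def take_stake min_def del: stake.simps)
        moreover have "i - 1 < m"
          using that by (simp add: \<tau>_def)
        ultimately show ?thesis
          using contra \<open>r\<close> by simp
      qed
      then have "\<tau> \<in> ?T"
        using hist \<open>m \<ge> 1\<close> unfolding \<tau>_def unreached_def by (auto simp flip: length_greater_0_conv)
      moreover have "\<pi> \<in> avoiding \<tau> j" for j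
        using contra str by (auto simp: avoiding_def \<tau>_def simp del: stake.simps)
      ultimately show False
        using \<pi> by blast
    qed
    then show "\<pi> \<in> {\<pi> \<in> streams (moves G). color_sequence G \<pi> \<in> objective}"
      using str objective_iff by blast
  qed
  have "AE \<pi> in M. \<pi> \<in> space M - (\<Union>\<tau>\<in>?T. ?bad \<tau>)"
    using \<open>AE \<pi> in M. \<forall>\<tau>\<in>?T. \<pi> \<notin> ?bad \<tau>\<close> AE_space by eventually_elim blast
  moreover have "space M - (\<Union>\<tau>\<in>?T. ?bad \<tau>) \<in> sets M"
    using bad_sets by (intro sets.Diff sets.top sets.countable_UN') auto
  ultimately show ?thesis
    unfolding good using M.prob_eq_1 by blast
qed

end

context numbered_game
begin

theorem almost_sure_winning_iff:
  "(\<exists>\<alpha>. player_strategy G \<alpha> \<and> almost_sure_winning G objective \<alpha>) \<longleftrightarrow>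
     (\<exists>a<k. \<forall>c<g. act G c = a \<longrightarrow> succ (h []) c \<in> winning)"
proof
  assume "\<exists>a<k. \<forall>c<g. act G c = a \<longrightarrow> succ (h []) c \<in> winning"
  then obtain a0 where a0: "a0 < k" "\<And>c. c < g \<Longrightarrow> act G c = a0 \<Longrightarrow> succ (h []) c \<in> winning"
    by blast
  have player: "player_strategy G (uniform_strategy a0)"
    by (rule player_uniform_strategy[OF a0(1)])
  have "measure (play_measure G (uniform_strategy a0) \<beta>)
      {\<pi> \<in> streams (moves G). color_sequence G \<pi> \<in> objective} = 1"
    if "environment_strategy G \<beta>" for \<beta>
  proof -
    interpret uniform_play G g n k h succ col r "uniform_strategy a0" \<beta> a0
      using player that a0(2) by unfold_locales auto
    show ?thesis
      by (rule measure_objective)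
  qed
  then show "\<exists>\<alpha>. player_strategy G \<alpha> \<and> almost_sure_winning G objective \<alpha>"
    using player unfolding almost_sure_winning_def by blast
qed (use winning_necessary in blast)

end

section \<open>Reasoning about programs\<close>

text \<open>Total correctness with time: an execution must exist, and the postcondition sees its
  step count. Continuations accumulate time in the argument of \<open>Q\<close>.\<close>

definition run :: "com \<Rightarrow> state \<Rightarrow> (nat \<Rightarrow> state \<Rightarrow> bool) \<Rightarrow> bool" where
  "run p s Q \<longleftrightarrow> (\<exists>t s'. exec p s t s' \<and> Q t s')"

lemma run_Skip [simp]: "run Skip s Q \<longleftrightarrow> Q 1 s"
  unfolding run_def by (blast intro: exec.Skip elim: exec.cases)

lemma run_Store [simp]:
  "run (Store x e1 e2) s Q \<longleftrightarrow> Q (1 + acost e1 + acost e2) (s(x := (s x)(aval e1 s := aval e2 s)))"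
  unfolding run_def by (blast elim: exec.cases intro: exec.Store)

lemma run_Seq [simp]: "run (Seq p q) s Q \<longleftrightarrow> run p s (\<lambda>t s1. run q s1 (\<lambda>u. Q (t + u)))"
  unfolding run_def by (blast elim: exec.cases intro: exec.Seq)

lemma run_If [simp]:
  "run (If b p q) s Q \<longleftrightarrow>
     (if bval b s then run p s (\<lambda>t. Q (1 + bcost b + t)) else run q s (\<lambda>t. Q (1 + bcost b + t)))"
proof (cases "bval b s")
  case True
  then show ?thesis
    unfolding run_def by (simp only: if_True) (blast elim: exec.cases intro: exec.IfTrue)
next
  case False
  then show ?thesis
    unfolding run_def by (simp only: if_False) (blast elim: exec.cases intro: exec.IfFalse)
qed

lemma run_mono: "run p s Q \<Longrightarrow> (\<And>t s'. Q t s' \<Longrightarrow> R t s') \<Longrightarrow> run p s R"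
  by (auto simp: run_def)

fun writes :: "com \<Rightarrow> vname list" where
  "writes Skip = []"
| "writes (Store x e1 e2) = [x]"
| "writes (Seq p q) = writes p @ writes q"
| "writes (If b p q) = writes p @ writes q"
| "writes (While b p) = writes p"

definition frame :: "vname list \<Rightarrow> state \<Rightarrow> state \<Rightarrow> bool" where
  "frame W s s' \<longleftrightarrow> (\<forall>x. x \<notin> set W \<longrightarrow> s' x = s x)"

lemma frame_refl [simp]: "frame W s s"
  by (simp add: frame_def)

lemma frame_upd [simp]: "x \<in> set W \<Longrightarrow> frame W s (s'(x := f)) \<longleftrightarrow> frame W s s'"
  by (auto simp: frame_def)

lemma frame_trans: "frame W s s' \<Longrightarrow> frame W' s' s'' \<Longrightarrow> set W \<union> set W' \<subseteq> set W'' \<Longrightarrow> frame W'' s s''"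
  unfolding frame_def by (metis Un_iff subsetD)

lemma frameD: "frame W s s' \<Longrightarrow> x \<notin> set W \<Longrightarrow> s' x = s x"
  by (simp add: frame_def)

lemma exec_frame: "exec p s t s' \<Longrightarrow> frame (writes p) s s'"
  by (induction rule: exec.induct) (auto simp: frame_def)

lemma run_frame: "run p s Q \<Longrightarrow> run p s (\<lambda>t s'. Q t s' \<and> frame (writes p) s s')"
  unfolding run_def using exec_frame by blast

text \<open>Each iteration must lower the potential by its full cost, which is positive. Hence the
  potential yields termination as well as the amortised time bound.\<close>

lemma run_While:
  assumes "I s"
    and step: "\<And>s'. I s' \<Longrightarrow> bval b s' \<Longrightarrow> frame (writes p) s s' \<Longrightarrow>
      run p s' (\<lambda>t s''. I s'' \<and> 1 + bcost b + t + \<Phi> s'' \<le> \<Phi> s')"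
  shows "run (While b p) s (\<lambda>t s'. I s' \<and> \<not> bval b s' \<and> frame (writes p) s s' \<and>
    t + \<Phi> s' \<le> 1 + bcost b + \<Phi> s)"
proof -
  have "\<exists>t s''. exec (While b p) s' t s'' \<and> I s'' \<and> \<not> bval b s'' \<and> t + \<Phi> s'' \<le> 1 + bcost b + \<Phi> s'"
    if "I s'" "frame (writes p) s s'" for s'
    using that
  proof (induction "\<Phi> s'" arbitrary: s' rule: less_induct)
    case less
    show ?case
    proof (cases "bval b s'")
      case True
      obtain t s'' where t: "exec p s' t s''" "I s''" "1 + bcost b + t + \<Phi> s'' \<le> \<Phi> s'"
        using step[OF less.prems(1) True less.prems(2)] by (auto simp: run_def)
      moreover have "frame (writes p) s s''"
        using frame_trans[OF less.prems(2) exec_frame[OF t(1)]] by simp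
      ultimately obtain t' s3 where "exec (While b p) s'' t' s3" "I s3" "\<not> bval b s3"
          "t' + \<Phi> s3 \<le> 1 + bcost b + \<Phi> s''"
        using less.hyps[of s''] by auto
      moreover from this t have "exec (While b p) s' (1 + bcost b + t + t') s3"
        using True by (intro exec.WhileTrue)
      ultimately show ?thesis
        using t(3) by (intro exI[of _ "1 + bcost b + t + t'"] exI[of _ s3]) auto
    next
      case False
      then have "exec (While b p) s' (1 + bcost b) s'"
        by (rule exec.WhileFalse)
      then show ?thesis
        using False less.prems by blast
    qed
  qed
  from this[OF assms(1)] show ?thesis
    unfolding run_def using exec_frame by fastforce
qed

fun avars :: "aexp \<Rightarrow> vname list" where
  "avars (Const m) = []"
| "avars (Load x e) = x # avars e"
| "avars (Plus e1 e2) = avars e1 @ avars e2"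
| "avars (Minus e1 e2) = avars e1 @ avars e2"

lemma aval_frame: "frame W s s' \<Longrightarrow> set (avars e) \<inter> set W = {} \<Longrightarrow> aval e s' = aval e s"
  by (induction e) (auto simp: frame_def Int_Un_distrib2)

abbreviation (input) V :: "vname \<Rightarrow> aexp" where
  "V x \<equiv> Load x (Const 0)"

abbreviation (input) Set :: "vname \<Rightarrow> aexp \<Rightarrow> com" where
  "Set x e \<equiv> Store x (Const 0) e"

definition For :: "vname \<Rightarrow> aexp \<Rightarrow> com \<Rightarrow> com" where
  "For x b p = Seq (Set x (Const 0)) (While (Less (V x) b) (Seq p (Set x (Plus (V x) (Const 1)))))"

lemma writes_For [simp]: "writes (For x b p) = x # writes p @ [x]"
  by (simp add: For_def)

text \<open>Besides \<open>acost b\<close>, an iteration costs 4 for the test and 6 for the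
  increment, which gives 10; the 7 consists of 3 for the initialisation and 4 for the failing test.
  The potential must ignore the loop variable because the increment changes it.\<close>

lemma run_For:
  assumes init: "I 0 (s(x := (s x)(0 := 0)))"
    and b: "aval b s = m" "set (avars b) \<inter> set (x # writes p) = {}"
    and \<Phi>: "\<And>s' f. \<Phi> (s'(x := f)) = \<Phi> s'"
    and step: "\<And>i s'. i < m \<Longrightarrow> I i s' \<Longrightarrow> s' x 0 = i \<Longrightarrow> frame (x # writes p) s s' \<Longrightarrow>
      run p s' (\<lambda>t s''. s'' x 0 = i \<and> I (Suc i) (s''(x := (s'' x)(0 := Suc i))) \<and> t + \<Phi> s'' \<le> C + \<Phi> s')"
  shows "run (For x b p) s (\<lambda>t s'. I m s' \<and> s' x 0 = m \<and> frame (x # writes p) s s' \<and>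
    t + \<Phi> s' \<le> m * (C + acost b + 10) + acost b + 7 + \<Phi> s)"
proof -
  have bound: "aval b s' = m" if "frame (x # writes p) s s'" for s'
    using aval_frame[OF that] b by blast
  let ?s = "s(x := (s x)(0 := 0))"
  let ?J = "\<lambda>s'. s' x 0 \<le> m \<and> I (s' x 0) s' \<and> frame (x # writes p) s s'"
  let ?\<Psi> = "\<lambda>s'. (m - s' x 0) * (C + acost b + 10) + \<Phi> s'"
  let ?body = "Seq p (Set x (Plus (V x) (Const 1)))"
  have "run (While (Less (V x) b) ?body) ?s (\<lambda>t s'. ?J s' \<and> \<not> bval (Less (V x) b) s' \<and>
      frame (writes ?body) ?s s' \<and> t + ?\<Psi> s' \<le> 1 + bcost (Less (V x) b) + ?\<Psi> ?s)"
  proof (rule run_While)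
    show "?J ?s"
      using init by simp
  next
    fix s' assume J: "?J s'" and less: "bval (Less (V x) b) s'"
    then have less: "s' x 0 < m"
      using bound by simp
    have "run p s' (\<lambda>t s''. s'' x 0 = s' x 0 \<and> I (Suc (s' x 0)) (s''(x := (s'' x)(0 := Suc (s' x 0)))) \<and>
        t + \<Phi> s'' \<le> C + \<Phi> s')"
      using J less by (intro step) auto
    from run_frame[OF this] show "run ?body s' (\<lambda>t s''. ?J s'' \<and>
        1 + bcost (Less (V x) b) + t + ?\<Psi> s'' \<le> ?\<Psi> s')"
      unfolding run_Seq
    proof (rule run_mono)
      fix t s''
      assume *: "(s'' x 0 = s' x 0 \<and> I (Suc (s' x 0)) (s''(x := (s'' x)(0 := Suc (s' x 0)))) \<and>
        t + \<Phi> s'' \<le> C + \<Phi> s') \<and> frame (writes p) s' s''"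
      have fr: "frame (x # writes p) s s''"
        using J * by (auto intro: frame_trans)
      have "m - s' x 0 = Suc (m - Suc (s' x 0))"
        using less by simp
      then show "run (Set x (Plus (V x) (Const 1))) s'' (\<lambda>u s''. ?J s'' \<and>
          1 + bcost (Less (V x) b) + (t + u) + ?\<Psi> s'' \<le> ?\<Psi> s')"
        using * less fr by (simp add: \<Phi>)
    qed
  qed
  then have "run (While (Less (V x) b) ?body) ?s (\<lambda>t s'. I m s' \<and> s' x 0 = m \<and>
      frame (x # writes p) s s' \<and> 3 + t + \<Phi> s' \<le> m * (C + acost b + 10) + acost b + 7 + \<Phi> s)"
  proof (rule run_mono)
    fix t s'
    assume post: "?J s' \<and> \<not> bval (Less (V x) b) s' \<and> frame (writes ?body) ?s s' \<and>
      t + ?\<Psi> s' \<le> 1 + bcost (Less (V x) b) + ?\<Psi> ?s"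
    then have "s' x 0 = m" "I (s' x 0) s'" "frame (x # writes p) s s'"
      using bound[of s'] by auto
    then show "I m s' \<and> s' x 0 = m \<and> frame (x # writes p) s s' \<and>
        3 + t + \<Phi> s' \<le> m * (C + acost b + 10) + acost b + 7 + \<Phi> s"
      using post by (simp add: \<Phi>)
  qed
  then show ?thesis
    by (simp add: For_def)
qed

lemmas run_For0 = run_For[where \<Phi> = "\<lambda>_. 0", simplified]

section \<open>Computing the greatest sustained set by removing traps\<close>

locale class_arena = arena +
  fixes rep :: "nat \<Rightarrow> nat"
  assumes edge_bound: "p < n \<Longrightarrow> edge p a q \<Longrightarrow> a < k \<and> q < n"
    and eqv_iff: "eqv p q \<longleftrightarrow> p < n \<and> q < n \<and> rep p = rep q"
    and rep_bound: "p < n \<Longrightarrow> rep p < n"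
    and k_pos: "0 < k"
begin

text \<open>The pair of a state \<open>p\<close> and an action \<open>a\<close> is numbered \<open>p * k + a\<close>; the liveness of an
  action is recorded at the representative of the class of \<open>p\<close>.\<close>

definition N :: nat where "N = n * k"

definition cls :: "nat \<Rightarrow> nat" where
  "cls e = rep (e div k) * k + e mod k"

definition in_edge :: "nat \<Rightarrow> nat \<Rightarrow> bool" where
  "in_edge e v \<longleftrightarrow> edge (e div k) (e mod k) v"

lemma pair_less: "p < n \<Longrightarrow> a < k \<Longrightarrow> p * k + a < N"
proof -
  assume "p < n" "a < k"
  then have "p * k + a < Suc p * k" "Suc p * k \<le> n * k"
    by (simp, intro mult_le_mono1, simp)
  then show ?thesis
    by (simp add: N_def)
qed

lemma pair_div_less: "e < N \<Longrightarrow> e div k < n"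
  by (simp add: N_def less_mult_imp_div_less)

lemma pair_mod_less: "e mod k < k"
  using k_pos by simp

lemma pair_div [simp]: "a < k \<Longrightarrow> (p * k + a) div k = p"
  by simp

lemma cls_pair [simp]: "a < k \<Longrightarrow> cls (p * k + a) = rep p * k + a"
  by (simp add: cls_def)

lemma cls_less: "e < N \<Longrightarrow> cls e < N"
  unfolding cls_def by (intro pair_less rep_bound pair_div_less pair_mod_less)

definition alive_states :: "(nat \<Rightarrow> nat) \<Rightarrow> nat set" where
  "alive_states st = {p. p < n \<and> 0 < st (rep p)}"

text \<open>The first two clauses say that nothing needed by \<open>winning\<close> has been
  removed, the third that the remaining actions are safe for the remaining states.\<close>

definition invariant :: "(nat \<Rightarrow> nat) \<Rightarrow> (nat \<Rightarrow> nat) \<Rightarrow> bool" where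
  "invariant st al \<longleftrightarrow> winning \<subseteq> alive_states st \<and>
     (\<forall>p\<in>winning. \<forall>a<k. allowed winning p a \<longrightarrow> 0 < al (rep p * k + a)) \<and>
     (\<forall>e<N. \<forall>v. in_edge e v \<longrightarrow> 0 < al (cls e) \<longrightarrow> v \<in> alive_states st)"

text \<open>A target without live action cannot belong to a sustained set; with this definition it
  forms a singleton trap, so trap removal also takes care of it.\<close>

definition is_target :: "(nat \<Rightarrow> nat) \<Rightarrow> nat \<Rightarrow> bool" where
  "is_target al p \<longleftrightarrow> target p \<and> (\<exists>a<k. 0 < al (rep p * k + a))"

definition trap :: "(nat \<Rightarrow> nat) \<Rightarrow> (nat \<Rightarrow> nat) \<Rightarrow> nat set \<Rightarrow> bool" where
  "trap st al T \<longleftrightarrow> T \<subseteq> alive_states st \<and>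
     (\<forall>p\<in>T. \<not> is_target al p \<and>
       (\<forall>a<k. 0 < al (rep p * k + a) \<longrightarrow> (\<exists>q\<in>T. edge p a q)))"

definition indeg :: "(nat \<Rightarrow> nat) \<Rightarrow> nat \<Rightarrow> nat" where
  "indeg al v = card {e. e < N \<and> in_edge e v \<and> 0 < al (cls e)}"

definition alive_count :: "(nat \<Rightarrow> nat) \<Rightarrow> (nat \<Rightarrow> nat) \<Rightarrow> nat" where
  "alive_count st al = card {e. e < N \<and> 0 < al (cls e)} + card (alive_states st)"

definition closed :: "(nat \<Rightarrow> nat) \<Rightarrow> nat set \<Rightarrow> bool" where
  "closed al Y \<longleftrightarrow> (\<forall>p<n. is_target al p \<longrightarrow> p \<in> Y) \<and>
     (\<forall>e<N. 0 < al (cls e) \<longrightarrow> (\<forall>v<n. in_edge e v \<longrightarrow> v \<in> Y) \<longrightarrow> e div k \<in> Y)"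

text \<open>The third clause asks for a reason for each killed action, an edge from a member of its
  class to a dead state. This protects the actions that \<open>winning\<close> relies on.\<close>

definition killed :: "(nat \<Rightarrow> nat) \<Rightarrow> (nat \<Rightarrow> nat) \<Rightarrow> nat set \<Rightarrow> (nat \<Rightarrow> nat) \<Rightarrow> (nat \<Rightarrow> nat) \<Rightarrow> bool" where
  "killed st al Y st' al' \<longleftrightarrow>
     (\<forall>p<n. 0 < st' (rep p) \<longleftrightarrow> 0 < st (rep p) \<and> (\<forall>q<n. rep q = rep p \<longrightarrow> q \<in> Y)) \<and>
     (\<forall>x<N. 0 < al' x \<longrightarrow> 0 < al x) \<and>
     (\<forall>x<N. 0 < al x \<longrightarrow> al' x = 0 \<longrightarrow>
        (\<exists>e<N. \<exists>v<n. cls e = x \<and> in_edge e v \<and> v \<notin> alive_states st')) \<and>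
     (\<forall>e<N. \<forall>v<n. in_edge e v \<longrightarrow> 0 < al' (cls e) \<longrightarrow> v \<in> alive_states st')"

lemma winning_less: "p \<in> winning \<Longrightarrow> p < n"
  using sustained_winning unfolding sustained_def by blast

lemma winning_class: "p \<in> winning \<Longrightarrow> q < n \<Longrightarrow> rep q = rep p \<Longrightarrow> q \<in> winning"
  using sustained_winning winning_less eqv_iff[of p q] unfolding sustained_def by auto

text \<open>Induction along \<open>attr winning\<close>: a target in \<open>winning\<close> keeps a
  live action, and an allowed action is live and stays in \<open>winning\<close>, so each step of
  \<open>attr\<close> is one under which \<open>Y\<close> is closed.\<close>

lemma winning_subset_closed:
  assumes inv: "invariant st al" and closed: "closed al Y"
  shows "winning \<subseteq> Y"
proof
  fix p assume "p \<in> winning"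
  moreover from this have "p \<in> attr winning"
    using sustained_winning by (simp add: sustained_def)
  moreover have "p \<in> Y" if "p \<in> attr winning" "p \<in> winning" for p
    using that
  proof (induction rule: attr.induct)
    case (target p)
    then have "\<exists>a<k. allowed winning p a"
      using sustained_winning by (simp add: sustained_def)
    then have "is_target al p"
      using target inv unfolding is_target_def invariant_def by blast
    then show ?case
      using closed target winning_less unfolding closed_def by blast
  next
    case (step a p)
    have p: "p < n" "p * k + a < N"
      using step winning_less pair_less by auto
    have "0 < al (cls (p * k + a))"
      using step inv unfolding invariant_def by simp
    moreover have "v \<in> Y" if "v < n" "in_edge (p * k + a) v" for v
    proof -
      have e: "edge p a v"
        using that step.hyps by (simp add: in_edge_def)
      then have "v \<in> winning"
        using step.hyps(2) p eqv_iff[of p p] unfolding allowed_def by blast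
      then show ?thesis
        using step.IH e by blast
    qed
    ultimately show ?case
      using closed p step.hyps(1) unfolding closed_def by fastforce
  qed
  ultimately show "p \<in> Y"
    by blast
qed

text \<open>An allowed action of a winning state leads from its whole class back into
  \<open>winning\<close>, which survives; so no edge to a dead state can have killed it.\<close>

lemma killed_invariant:
  assumes inv: "invariant st al" and closed: "closed al Y" and killed: "killed st al Y st' al'"
  shows "invariant st' al'"
  unfolding invariant_def
proof (intro conjI ballI allI impI)
  note sub = winning_subset_closed[OF inv closed]
  show win: "winning \<subseteq> alive_states st'"
  proof
    fix p assume p: "p \<in> winning"
    then have "0 < st (rep p)" "p < n"
      using inv unfolding invariant_def alive_states_def by auto
    then show "p \<in> alive_states st'"
      using killed winning_class[OF p] sub unfolding killed_def alive_states_def by auto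
  qed
  show "0 < al' (rep p * k + a)" if p: "p \<in> winning" and a: "a < k" "allowed winning p a" for p a
  proof (rule ccontr)
    assume "\<not> ?thesis"
    moreover have "0 < al (rep p * k + a)" "rep p * k + a < N"
      using inv that winning_less rep_bound pair_less unfolding invariant_def by auto
    ultimately obtain e v where e: "e < N" "v < n" "cls e = rep p * k + a" "in_edge e v" "v \<notin> alive_states st'"
      using killed unfolding killed_def by auto
    have "cls e div k = rep (e div k)" "cls e mod k = e mod k"
      using k_pos by (auto simp: cls_def)
    then have "rep (e div k) = rep p" "e mod k = a"
      using e(3) a by auto
    then have "eqv p (e div k)" "edge (e div k) a v"
      using e pair_div_less[OF e(1)] winning_less[OF p] by (auto simp: eqv_iff in_edge_def)
    then have "v \<in> winning"
      using a unfolding allowed_def by blast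
    then show False
      using win e by blast
  qed
  show "v \<in> alive_states st'" if "e < N" "in_edge e v" "0 < al' (cls e)" for e v
  proof -
    have "v < n"
      using that edge_bound pair_div_less unfolding in_edge_def by blast
    then show ?thesis
      using killed that unfolding killed_def by blast
  qed
qed

lemma complement_trap:
  assumes inv: "invariant st al" and closed: "closed al Y"
  shows "trap st al (alive_states st - Y)"
  unfolding trap_def
proof (intro conjI ballI allI impI)
  fix p assume p: "p \<in> alive_states st - Y"
  then have "p < n"
    by (simp add: alive_states_def)
  then show "\<not> is_target al p"
    using p closed unfolding closed_def by blast
  fix a assume a: "a < k" "0 < al (rep p * k + a)"
  have e: "p * k + a < N"
    using \<open>p < n\<close> a by (simp add: pair_less)
  then obtain v where v: "v < n" "in_edge (p * k + a) v" "v \<notin> Y"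
    using closed p a unfolding closed_def by force
  then have "v \<in> alive_states st"
    using inv e a unfolding invariant_def by auto
  then show "\<exists>q\<in>alive_states st - Y. edge p a q"
    using v a by (auto simp: in_edge_def)
qed blast

text \<open>When \<open>v\<close> dies, all live pairs entering it die too. They account for
  \<open>indeg al v\<close>, and \<open>v\<close> itself for the additional 1.\<close>

lemma killed_count:
  assumes killed: "killed st al Y st' al'" and v: "v \<in> alive_states st" "v \<notin> Y"
  shows "alive_count st' al' + indeg al v + 1 \<le> alive_count st al"
proof -
  let ?A = "\<lambda>al. {e. e < N \<and> 0 < al (cls e)}"
  let ?I = "{e. e < N \<and> in_edge e v \<and> 0 < al (cls e)}"
  have vn: "v < n" and dead: "v \<notin> alive_states st'"
    using killed v unfolding killed_def alive_states_def by auto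
  have "?A al' \<subseteq> ?A al"
    using killed cls_less unfolding killed_def by auto
  moreover have "?A al' \<inter> ?I = {}"
    using killed dead vn unfolding killed_def by blast
  ultimately have "card (?A al' \<union> ?I) \<le> card (?A al)" "card (?A al' \<union> ?I) = card (?A al') + card ?I"
    by (auto intro!: card_mono card_Un_disjoint)
  moreover have "alive_states st' \<subseteq> alive_states st"
    using killed unfolding killed_def alive_states_def by auto
  then have "alive_states st' \<subset> alive_states st"
    using dead v by blast
  then have "card (alive_states st') < card (alive_states st)"
    by (intro psubset_card_mono) (auto simp: alive_states_def)
  ultimately show ?thesis
    by (simp add: alive_count_def indeg_def)
qed

lemma alive_count_le: "alive_count st al \<le> N + n"
proof -
  have "card {e. e < N \<and> 0 < al (cls e)} \<le> card {..<N}"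
    by (intro card_mono) auto
  moreover have "card (alive_states st) \<le> card {..<n}"
    unfolding alive_states_def by (intro card_mono) auto
  ultimately show ?thesis
    by (simp add: alive_count_def)
qed

lemma indeg_le: "indeg al v \<le> N"
proof -
  have "indeg al v \<le> card {..<N}"
    unfolding indeg_def by (intro card_mono) auto
  then show ?thesis
    by simp
qed

text \<open>Without traps the alive states form a sustained set: a state without live action would
  be a singleton trap, and the alive states outside their own attractor form a trap.\<close>

lemma no_trap_winning:
  assumes inv: "invariant st al" and no_trap: "\<And>T. trap st al T \<Longrightarrow> T = {}"
  shows "winning = alive_states st"
proof
  show "winning \<subseteq> alive_states st"
    using inv by (simp add: invariant_def)
  let ?X = "alive_states st"
  have allowed: "allowed ?X p a" if p: "p < n" "a < k" "0 < al (rep p * k + a)" for p a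
    unfolding allowed_def
  proof (intro allI impI)
    fix p' q assume "eqv p p'" "edge p' a q"
    then have "p' * k + a < N" "in_edge (p' * k + a) q" "cls (p' * k + a) = rep p * k + a"
      using p by (auto simp: eqv_iff in_edge_def pair_less)
    then show "q \<in> ?X"
      using inv p unfolding invariant_def by metis
  qed
  have live: "\<exists>a<k. 0 < al (rep p * k + a)" if "p \<in> ?X" for p
  proof (rule ccontr)
    assume "\<not> ?thesis"
    then have "trap st al {p}"
      using that unfolding trap_def is_target_def by auto
    then show False
      using no_trap by blast
  qed
  have "trap st al (?X - attr ?X)"
    unfolding trap_def
  proof (intro conjI ballI allI impI)
    fix p assume p: "p \<in> ?X - attr ?X"
    then show "\<not> is_target al p"
      using attr.target unfolding is_target_def by blast
    fix a assume a: "a < k" "0 < al (rep p * k + a)"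
    have "p < n"
      using p by (simp add: alive_states_def)
    have all: "allowed ?X p a"
      using allowed[OF \<open>p < n\<close> a] .
    then obtain q where q: "edge p a q" "q \<notin> attr ?X"
      using p a attr.step by blast
    moreover have "q \<in> ?X"
      using all q \<open>p < n\<close> eqv_iff[of p p] unfolding allowed_def by blast
    ultimately show "\<exists>q\<in>?X - attr ?X. edge p a q"
      by blast
  qed blast
  then have "?X \<subseteq> attr ?X"
    using no_trap by blast
  moreover have "?X \<subseteq> {..<n}" "\<forall>p\<in>?X. \<forall>q. eqv p q \<longrightarrow> q \<in> ?X"
    by (auto simp: alive_states_def eqv_iff)
  moreover have "\<forall>p\<in>?X. \<exists>a<k. allowed ?X p a"
    using live allowed by (fastforce simp: alive_states_def)
  ultimately show "?X \<subseteq> winning"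
    by (intro sustained_subset_winning) (auto simp: sustained_def)
qed

end

text \<open>Constant-time deletion: the last entry overwrites the deleted one. Entries before
  position \<open>j\<close> stay put, so what a scan has established about them remains
  valid.\<close>

lemma swap_remove:
  assumes "distinct xs" "j < length xs"
  defines "ys \<equiv> butlast (xs[j := last xs])"
  shows "distinct ys" "set ys = set xs - {xs ! j}" "length ys = length xs - 1"
    "\<And>i. i < j \<Longrightarrow> ys ! i = xs ! i"
proof -
  obtain zs x where xs: "xs = zs @ [x]"
    using assms(2) by (cases xs rule: rev_cases) auto
  have ys: "ys = (if j = length zs then zs else zs[j := x])"
    using assms(2) by (auto simp: ys_def xs list_update_append butlast_append)
  show "distinct ys" "set ys = set xs - {xs ! j}"
  proof -
    show "distinct ys"
      using assms(1,2) by (auto simp: ys xs distinct_list_update)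
    show "set ys = set xs - {xs ! j}"
    proof (cases "j = length zs")
      case True
      then show ?thesis
        using assms(1) by (auto simp: ys xs)
    next
      case False
      then have "j < length zs"
        using assms(2) by (simp add: xs)
      then show ?thesis
        using assms(1) set_update_distinct[of zs j x] by (auto simp: ys xs nth_append)
    qed
  qed
  show "length ys = length xs - 1"
    by (simp add: ys_def)
  show "ys ! i = xs ! i" if "i < j" for i
    using that assms(2) by (auto simp: ys xs nth_append)
qed

section \<open>The decision program\<close>

lemma pair_eq_iff:
  fixes N :: nat
  assumes "e < N" "e' < N"
  shows "v * N + e = v' * N + e' \<longleftrightarrow> v = v' \<and> e = e'"
proof
  assume eq: "v * N + e = v' * N + e'"
  have "(v * N + e) div N = v" "(v * N + e) mod N = e" "(v' * N + e') div N = v'" "(v' * N + e') mod N = e'"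
    using assms by auto
  then show "v = v' \<and> e = e'"
    using eq by metis
qed simp

section \<open>Adjacency rows in a single array, and the tables prepared in advance\<close>

definition rowlist :: "nat \<Rightarrow> (nat \<Rightarrow> nat) \<Rightarrow> (nat \<Rightarrow> nat) \<Rightarrow> nat \<Rightarrow> nat list" where
  "rowlist N inl len v = map (\<lambda>j. inl (v * N + j)) [0..<len v]"

lemma length_rowlist [simp]: "length (rowlist N inl len v) = len v"
  by (simp add: rowlist_def)

lemma nth_rowlist: "j < len v \<Longrightarrow> rowlist N inl len v ! j = inl (v * N + j)"
  by (simp add: rowlist_def)

lemma rowlist_upd_len [simp]: "v \<noteq> v' \<Longrightarrow> rowlist N inl (len(v := l)) v' = rowlist N inl len v'"
  by (simp add: rowlist_def)

lemma rowlist_upd_other: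
  assumes "v \<noteq> v'" "j < N" "len v' \<le> N"
  shows "rowlist N (inl(v * N + j := x)) len v' = rowlist N inl len v'"
proof -
  have "v' * N + i \<noteq> v * N + j" if "i < len v'" for i
    using that assms pair_eq_iff[of i N j v' v] by auto
  then show ?thesis
    by (simp add: rowlist_def)
qed

lemma rowlist_append:
  "rowlist N (inl(v * N + len v := x)) (len(v := Suc (len v))) v = rowlist N inl len v @ [x]"
  by (simp add: rowlist_def)

lemma rowlist_remove:
  assumes "j < len v"
  shows "rowlist N (inl(v * N + j := inl (v * N + (len v - 1)))) (len(v := len v - 1)) v =
    butlast ((rowlist N inl len v)[j := last (rowlist N inl len v)])"
  using assms
  by (intro nth_equalityI) (auto simp: rowlist_def nth_butlast nth_list_update last_map)

text \<open>The machine lacks multiplication and division; the multiples \<open>p * k\<close> and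
  the quotients \<open>e div k\<close> are tabulated by counting.\<close>

definition rows_code :: com where
  "rows_code = Seq (Set ''N'' (Const 0))
     (For ''p'' (V ''states'')
       (Seq (Store ''rk'' (V ''p'') (V ''N''))
         (For ''a'' (V ''actions'')
           (Seq (Store ''src'' (V ''N'') (V ''p''))
             (Seq (Store ''al'' (V ''N'') (Const 1))
               (Set ''N'' (Plus (V ''N'') (Const 1))))))))"

lemma run_rows:
  assumes "s ''states'' 0 = n" "s ''actions'' 0 = k"
  shows "run rows_code s (\<lambda>t s'. s' ''N'' 0 = n * k \<and> (\<forall>p<n. s' ''rk'' p = p * k) \<and>
     (\<forall>e<n * k. s' ''src'' e = e div k \<and> s' ''al'' e = 1) \<and> t \<le> n * (k * 100 + 100) + 100)"
  unfolding rows_code_def run_Seq run_Store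
proof (rule run_mono, rule run_For0[where m = n and C = "k * 100 + 50" and I =
      "\<lambda>i s'. s' ''N'' 0 = i * k \<and> (\<forall>p<i. s' ''rk'' p = p * k) \<and>
     (\<forall>e<i * k. s' ''src'' e = e div k \<and> s' ''al'' e = 1)"], goal_cases)
  case (4 i s1)
  note fr = frameD[OF 4(4), simplified]
  show ?case
    unfolding run_Seq run_Store
  proof (rule run_mono, rule run_For0[where m = k and C = 50 and I =
      "\<lambda>j s'. s' ''N'' 0 = i * k + j \<and>
     (\<forall>e<i * k + j. s' ''src'' e = e div k \<and> s' ''al'' e = 1)"], goal_cases)
    case (4 j s2)
    note fr2 = frameD[OF 4(4), simplified]
    show ?case using 4 \<open>s1 ''p'' 0 = i\<close> fr2 by (auto simp: less_Suc_eq)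
  next
    case (5 t s2)
    then have "frame [''a'', ''src'', ''al'', ''N''] (s1(''rk'' := (s1 ''rk'')(aval (V ''p'') s1 := aval (V ''N'') s1))) s2"
      by (simp add: frame_def)
    note fr2 = frameD[OF this, simplified]
    show ?case using 4 5 by (auto simp: fr fr2 less_Suc_eq add.commute)
  qed (use 4 assms in \<open>simp_all add: fr\<close>)
qed (use assms in \<open>auto simp: algebra_simps\<close>)

definition table_code :: com where
  "table_code = Seq (Set ''x'' (Const 0))
     (For ''v'' (V ''states'')
       (Seq (Store ''rN'' (V ''v'') (V ''x''))
         (Seq (Store ''len'' (V ''v'') (Const 0))
           (Seq (Store ''st'' (V ''v'') (Const 1))
             (For ''e'' (V ''N'')
               (Seq (Store ''m'' (V ''x'') (Const 0))
                 (Set ''x'' (Plus (V ''x'') (Const 1)))))))))"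

lemma run_table:
  assumes "s ''states'' 0 = n" "s ''N'' 0 = N"
  shows "run table_code s (\<lambda>t s'. (\<forall>v<n. s' ''rN'' v = v * N \<and> s' ''len'' v = 0 \<and> s' ''st'' v = 1) \<and>
     (\<forall>y<n * N. s' ''m'' y = 0) \<and> t \<le> n * (N * 100 + 100) + 100)"
  unfolding table_code_def run_Seq run_Store
proof (rule run_mono, rule run_For0[where m = n and C = "N * 100 + 50" and I =
      "\<lambda>i s'. s' ''x'' 0 = i * N \<and> (\<forall>v<i. s' ''rN'' v = v * N \<and> s' ''len'' v = 0 \<and> s' ''st'' v = 1) \<and>
     (\<forall>y<i * N. s' ''m'' y = 0)"], goal_cases)
  case (4 i s1)
  note fr = frameD[OF 4(4), simplified]
  let ?s = "s1(''rN'' := (s1 ''rN'')(aval (V ''v'') s1 := aval (V ''x'') s1))"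
  let ?s = "?s(''len'' := (?s ''len'')(aval (V ''v'') ?s := aval (Const 0) ?s))"
  let ?s = "?s(''st'' := (?s ''st'')(aval (V ''v'') ?s := aval (Const 1) ?s))"
  show ?case
    unfolding run_Seq run_Store
  proof (rule run_mono, rule run_For0[where m = N and C = 50 and I =
      "\<lambda>j s'. s' ''x'' 0 = i * N + j \<and> (\<forall>y<i * N + j. s' ''m'' y = 0)"], goal_cases)
    case (4 j s2)
    note fr2 = frameD[OF 4(4), simplified]
    show ?case using 4 fr2 by (auto simp: less_Suc_eq)
  next
    case (5 t s2)
    then have "frame [''e'', ''m'', ''x''] ?s s2"
      by (simp add: frame_def)
    note fr2 = frameD[OF this, simplified]
    show ?case using 4 5 by (auto simp: fr fr2 less_Suc_eq add.commute)
  qed (use 4 assms in \<open>simp_all add: fr\<close>)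
qed (use assms in \<open>auto simp: algebra_simps\<close>)

text \<open>Different moves with the same action may lead to the same state. Marking pairs in a
  table before building the rows keeps the rows free of repetitions. The choice by \<open>r\<close>
  is made when the program is built, not at run time.\<close>

definition edges_code :: "bool \<Rightarrow> com" where
  "edges_code r = Seq (Set ''x'' (Const 0))
     (For ''p'' (V ''states'')
       (For ''c'' (V ''moves'')
         (Seq
           (If (Less (Const 0) (if r then Load ''color'' (V ''p'') else Const 0)) Skip
             (Store ''m'' (Plus (Load ''rN'' (Load ''delta'' (V ''x'')))
               (Plus (Load ''rk'' (V ''p'')) (Load ''act'' (V ''c'')))) (Const 1)))
           (Set ''x'' (Plus (V ''x'') (Const 1))))))"

lemma run_edges:
  assumes "s ''states'' 0 = n" "s ''moves'' 0 = g" "N = n * k"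
    and rN: "\<forall>v<n. s ''rN'' v = v * N" and rk: "\<forall>p<n. s ''rk'' p = p * k"
    and delta: "\<forall>p<n. \<forall>c<g. s ''delta'' (p * g + c) < n" and act: "\<forall>c<g. s ''act'' c < k"
    and m: "\<forall>y<n * N. s ''m'' y = 0"
  shows "run (edges_code r) s (\<lambda>t s'. (\<forall>v<n. \<forall>e<N. 0 < s' ''m'' (v * N + e) \<longleftrightarrow>
       (\<exists>p c. p < n \<and> c < g \<and> \<not> (r \<and> 0 < s ''color'' p) \<and> s ''delta'' (p * g + c) = v \<and>
         p * k + s ''act'' c = e)) \<and> t \<le> n * (g * 100 + 100) + 100)"
proof -
  \<comment> \<open>The edges found by the two nested loops before reaching position
    \<open>(i, j)\<close> in lexicographic order.\<close>
  define hit where "hit i j v e \<longleftrightarrow> (\<exists>p c. (p < i \<or> p = i \<and> c < j) \<and> c < g \<and> \<not> (r \<and> 0 < s ''color'' p) \<and>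
    s ''delta'' (p * g + c) = v \<and> p * k + s ''act'' c = e)" for i j v e
  have hit_Suc: "hit i (Suc j) v e \<longleftrightarrow> hit i j v e \<or> (\<not> (r \<and> 0 < s ''color'' i) \<and>
      v = s ''delta'' (i * g + j) \<and> e = i * k + s ''act'' j)" if "j < g" for i j v e
    unfolding hit_def using that less_Suc_eq by blast
  have hit_row: "hit i g v e \<longleftrightarrow> hit (Suc i) 0 v e" for i v e
    unfolding hit_def using less_Suc_eq by blast
  have hit_0: "\<not> hit 0 0 v e" for v e
    by (simp add: hit_def)
  have hit_n: "hit n 0 v e \<longleftrightarrow> (\<exists>p c. p < n \<and> c < g \<and> \<not> (r \<and> 0 < s ''color'' p) \<and> s ''delta'' (p * g + c) = v \<and>
         p * k + s ''act'' c = e)" for v e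
    unfolding hit_def by simp
  show ?thesis
    unfolding edges_code_def run_Seq run_Store hit_n[symmetric]
  proof (rule run_mono, rule run_For0[where m = n and C = "g * 100 + 50" and I =
        "\<lambda>i s'. s' ''x'' 0 = i * g \<and> (\<forall>v<n. \<forall>e<N. 0 < s' ''m'' (v * N + e) \<longleftrightarrow> hit i 0 v e)"], goal_cases)
    case 1
    have "v * N + e < n * N" if "v < n" "e < N" for v e
    proof -
      have "v * N + e < Suc v * N"
        using that by simp
      also have "\<dots> \<le> n * N"
        using that by (intro mult_le_mono1) simp
      finally show ?thesis .
    qed
    then show ?case
      using m hit_0 by simp
  next
    case (4 i s1)
    note fr = frameD[OF 4(4), simplified]
    show ?case
    proof (rule run_mono, rule run_For0[where m = g and C = 80 and I =
        "\<lambda>j s'. s' ''x'' 0 = i * g + j \<and> (\<forall>v<n. \<forall>e<N. 0 < s' ''m'' (v * N + e) \<longleftrightarrow> hit i j v e)"], goal_cases)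
      case (4 j s2)
      note fr2 = frameD[OF 4(4), simplified]
      have less: "i * k + s ''act'' j < N"
      proof -
        have "i * k + s ''act'' j < Suc i * k"
          using 4 act by simp
        also have "\<dots> \<le> N"
          unfolding \<open>N = n * k\<close> using \<open>i < n\<close> by (intro mult_le_mono1) simp
        finally show ?thesis .
      qed
      have upd: "v * N + e = s ''delta'' (i * g + j) * N + (i * k + s ''act'' j) \<longleftrightarrow>
          v = s ''delta'' (i * g + j) \<and> e = i * k + s ''act'' j" if "e < N" for v e
        by (rule pair_eq_iff[OF that less])
      have eqs: "s2 ''x'' 0 = i * g + j" "s2 ''c'' 0 = j" "s2 ''p'' 0 = i" "s2 ''delta'' = s ''delta''" "s2 ''act'' = s ''act''"
        "s2 ''color'' = s ''color''" "s2 ''rN'' (s ''delta'' (i * g + j)) = s ''delta'' (i * g + j) * N" "s2 ''rk'' i = i * k"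
        using 4 \<open>i < n\<close> \<open>s1 ''p'' 0 = i\<close> fr fr2 delta rN rk by auto
      show ?case
        using 4(2) by (auto simp: eqs upd hit_Suc[OF \<open>j < g\<close>])
    next
      case (5 t s2)
      then have "frame [''c'', ''m'', ''x''] s1 s2"
        by (simp add: frame_def)
      note fr2 = frameD[OF this, simplified]
      show ?case using 4 5 by (simp add: fr fr2 add.commute hit_row)
    qed (use 4 assms in \<open>simp_all add: fr\<close>)
  next
    case (5 t s1)
    then have "t \<le> n * (g * 100 + 62) + 9"
      by (simp add: add.commute)
    also have "\<dots> \<le> n * (g * 100 + 100) + 97"
      by (intro add_mono mult_le_mono2) auto
    finally show ?case
      using 5 by simp
  qed (use assms in simp_all)
qed

definition lists_code :: com where
  "lists_code = For ''v'' (V ''states'') (For ''e'' (V ''N'')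
     (If (Less (Const 0) (Load ''m'' (Plus (Load ''rN'' (V ''v'')) (V ''e''))))
       (Seq (Store ''inl'' (Plus (Load ''rN'' (V ''v'')) (Load ''len'' (V ''v''))) (V ''e''))
         (Store ''len'' (V ''v'') (Plus (Load ''len'' (V ''v'')) (Const 1))))
       Skip))"

lemma run_lists:
  assumes "s ''states'' 0 = n" "s ''N'' 0 = N"
    and rN: "\<forall>v<n. s ''rN'' v = v * N" and len: "\<forall>v<n. s ''len'' v = 0"
  shows "run lists_code s (\<lambda>t s'. (\<forall>v<n. rowlist N (s' ''inl'') (s' ''len'') v =
      filter (\<lambda>e. 0 < s ''m'' (v * N + e)) [0..<N]) \<and> t \<le> n * (N * 100 + 100) + 100)"
  unfolding lists_code_def
proof (rule run_mono, rule run_For0[where m = n and C = "N * 100 + 50" and I =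
      "\<lambda>i s'. (\<forall>v<i. rowlist N (s' ''inl'') (s' ''len'') v = filter (\<lambda>e. 0 < s ''m'' (v * N + e)) [0..<N]) \<and>
       (\<forall>v. i \<le> v \<longrightarrow> v < n \<longrightarrow> s' ''len'' v = 0)"], goal_cases)
  case (4 i s1)
  note fr = frameD[OF 4(4), simplified]
  show ?case
  proof (rule run_mono, rule run_For0[where m = N and C = 80 and I =
      "\<lambda>j s'. (\<forall>v<i. rowlist N (s' ''inl'') (s' ''len'') v = filter (\<lambda>e. 0 < s ''m'' (v * N + e)) [0..<N]) \<and>
       rowlist N (s' ''inl'') (s' ''len'') i = filter (\<lambda>e. 0 < s ''m'' (i * N + e)) [0..<j] \<and>
       (\<forall>v. i < v \<longrightarrow> v < n \<longrightarrow> s' ''len'' v = 0)"], goal_cases)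
    case 1
    then show ?case
      using 4 by (simp add: rowlist_def)
  next
    case (4 j s2)
    note fr2 = frameD[OF 4(4), simplified]
    have eqs: "s2 ''e'' 0 = j" "s2 ''v'' 0 = i" "s2 ''m'' = s ''m''" "s2 ''rN'' i = i * N"
      using 4 \<open>i < n\<close> \<open>s1 ''v'' 0 = i\<close> fr fr2 rN by auto
    have le: "s2 ''len'' v \<le> N" if "v < i" for v
    proof -
      have "rowlist N (s2 ''inl'') (s2 ''len'') v = filter (\<lambda>e. 0 < s ''m'' (v * N + e)) [0..<N]"
        using 4(2) that by blast
      then have "length (rowlist N (s2 ''inl'') (s2 ''len'') v) \<le> length [0..<N]"
        by (metis length_filter_le)
      then show ?thesis
        by simp
    qed
    have "length (rowlist N (s2 ''inl'') (s2 ''len'') i) \<le> length [0..<j]"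
      unfolding 4(2)[THEN conjunct2, THEN conjunct1] by (rule length_filter_le)
    then have "s2 ''len'' i < N"
      using \<open>j < N\<close> by simp
    then show ?case
      using 4(2) le by (simp add: eqs rowlist_append rowlist_upd_other)
  next
    case (5 t s2)
    then have "frame [''e'', ''inl'', ''len''] s1 s2"
      by (simp add: frame_def)
    note fr2 = frameD[OF this, simplified]
    show ?case using 4 5 by (simp add: fr fr2 less_Suc_eq)
  qed (use 4 assms in \<open>simp_all add: fr\<close>)
next
  case (5 t s1)
  then have "t \<le> n * (N * 100 + 62) + 9"
    by (simp add: add.commute)
  also have "\<dots> \<le> n * (N * 100 + 100) + 97"
    by (intro add_mono mult_le_mono2) auto
  finally show ?case
    using 5 by simp
qed (use assms in simp_all)

text \<open>Later states overwrite earlier ones, so \<open>rep\<close> ends with the greatest member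
  of each class.\<close>

definition rep_code :: com where
  "rep_code = Seq (Set ''x'' (Const 0))
     (For ''p'' (V ''states'') (For ''q'' (V ''states'')
       (Seq (If (Less (Const 0) (Load ''info'' (V ''x''))) (Store ''rep'' (V ''q'') (V ''p'')) Skip)
         (Set ''x'' (Plus (V ''x'') (Const 1))))))"

lemma run_rep:
  assumes "s ''states'' 0 = n"
    and info: "\<forall>p<n. \<forall>q<n. 0 < s ''info'' (p * n + q) \<longleftrightarrow> E p q"
    and refl: "\<And>p. p < n \<Longrightarrow> E p p" and sym: "\<And>p q. E p q \<Longrightarrow> E q p"
    and trans: "\<And>p q u. E p q \<Longrightarrow> E q u \<Longrightarrow> E p u" and bound: "\<And>p q. E p q \<Longrightarrow> p < n"
  shows "run rep_code s (\<lambda>t s'. (\<forall>p<n. s' ''rep'' p < n) \<and>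
    (\<forall>p q. E p q \<longleftrightarrow> p < n \<and> q < n \<and> s' ''rep'' p = s' ''rep'' q) \<and> t \<le> n * (n * 100 + 100) + 100)"
  unfolding rep_code_def run_Seq run_Store
proof (rule run_mono, rule run_For0[where m = n and C = "n * 100 + 50" and I =
      "\<lambda>i s'. s' ''x'' 0 = i * n \<and> (\<forall>q<n. \<forall>p<i. E p q \<longrightarrow> p \<le> s' ''rep'' q \<and> s' ''rep'' q < i \<and> E (s' ''rep'' q) q)"], goal_cases)
  case (4 i s1)
  note fr = frameD[OF 4(4), simplified]
  show ?case
  proof (rule run_mono, rule run_For0[where m = n and C = 80 and I =
      "\<lambda>j s'. s' ''x'' 0 = i * n + j \<and>
       (\<forall>q<j. \<forall>p<Suc i. E p q \<longrightarrow> p \<le> s' ''rep'' q \<and> s' ''rep'' q < Suc i \<and> E (s' ''rep'' q) q) \<and>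
       (\<forall>q. j \<le> q \<longrightarrow> q < n \<longrightarrow> (\<forall>p<i. E p q \<longrightarrow> p \<le> s' ''rep'' q \<and> s' ''rep'' q < i \<and> E (s' ''rep'' q) q))"], goal_cases)
    case (4 j s2)
    note fr2 = frameD[OF 4(4), simplified]
    have eqs: "s2 ''x'' 0 = i * n + j" "s2 ''q'' 0 = j" "s2 ''p'' 0 = i"
      "0 < s2 ''info'' (i * n + j) \<longleftrightarrow> E i j"
      using 4 \<open>i < n\<close> \<open>s1 ''p'' 0 = i\<close> fr fr2 info by auto
    show ?case
    proof (cases "E i j")
      case True
      then show ?thesis
        using 4(2) eqs by (auto simp: less_Suc_eq)
    next
      case False
      then have "\<not> 0 < s2 ''info'' (i * n + j)"
        using eqs by simp
      moreover have "p \<le> s2 ''rep'' j \<and> s2 ''rep'' j < Suc i \<and> E (s2 ''rep'' j) j" if "p < Suc i" "E p j" for p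
      proof -
        have "p < i"
          using that False by (cases "p = i") auto
        then show ?thesis
          using 4(2) \<open>j < n\<close> that by (meson less_SucI order_refl)
      qed
      ultimately show ?thesis
        using 4(2) eqs(1-3) by (simp add: less_Suc_eq_le[of _ j] le_less[of _ j] all_conj_distrib imp_disjL conj_disj_distribR)
    qed
  next
    case (5 t s2)
    then have "frame [''q'', ''rep'', ''x''] s1 s2"
      by (simp add: frame_def)
    note fr2 = frameD[OF this, simplified]
    show ?case using 4 5 by (simp add: fr fr2 add.commute)
  qed (use 4 assms(1) in \<open>simp_all add: fr\<close>)
next
  case (5 t s1)
  then have "t \<le> n * (n * 100 + 62) + 9"
    by (simp add: add.commute)
  also have "\<dots> \<le> n * (n * 100 + 100) + 97"
    by (intro add_mono mult_le_mono2) auto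
  finally have t: "t \<le> n * (n * 100 + 100) + 97" .
  let ?r = "s1 ''rep''"
  \<comment> \<open>The representative is the maximum of its class, so equality of representatives
    of equivalent states follows by antisymmetry.\<close>
  have max: "p \<le> ?r q" and rn: "?r q < n" and E: "E (?r q) q" if "E p q" for p q
    using 5 that bound sym by blast+
  have "?r p = ?r q" if "E p q" for p q
  proof -
    have "E (?r p) q" "E (?r q) p"
      using that E[of p q] E[of q p] sym trans by blast+
    then show ?thesis
      using max by (simp add: order_antisym)
  qed
  moreover have "E p q" if "p < n" "q < n" "?r p = ?r q" for p q
  proof -
    have "E p (?r p)" "E (?r p) q"
      using E[OF refl[OF that(1)]] E[OF refl[OF that(2)]] that(3) sym by simp_all
    then show ?thesis
      by (rule trans)
  qed
  ultimately have "E p q \<longleftrightarrow> p < n \<and> q < n \<and> ?r p = ?r q" for p q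
    using bound sym by blast
  then show ?case
    using t rn[OF refl] by simp
qed (use assms(1) in simp_all)

text \<open>Subtracting the row offset of the source state from \<open>e\<close> yields
  \<open>e mod k\<close> without division.\<close>

definition cls_code :: com where
  "cls_code = For ''e'' (V ''N'') (Store ''cle'' (V ''e'')
     (Plus (Load ''rk'' (Load ''rep'' (Load ''src'' (V ''e''))))
       (Minus (V ''e'') (Load ''rk'' (Load ''src'' (V ''e''))))))"

lemma run_cls:
  assumes "s ''N'' 0 = n * k" and rk: "\<forall>p<n. s ''rk'' p = p * k" and src: "\<forall>e<n * k. s ''src'' e = e div k"
    and rep: "\<forall>p<n. s ''rep'' p < n"
  shows "run cls_code s (\<lambda>t s'. (\<forall>e<n * k. s' ''cle'' e = s ''rep'' (e div k) * k + e mod k) \<and>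
    t \<le> n * k * 100 + 100)"
  unfolding cls_code_def
proof (rule run_mono, rule run_For0[where m = "n * k" and C = 50 and I =
      "\<lambda>i s'. \<forall>e<i. s' ''cle'' e = s ''rep'' (e div k) * k + e mod k"], goal_cases)
  case (4 i s1)
  note fr = frameD[OF 4(4), simplified]
  have "i div k < n"
    using \<open>i < n * k\<close> by (simp add: less_mult_imp_div_less)
  then show ?case
    using 4 rk src rep by (auto simp: fr less_Suc_eq minus_div_mult_eq_mod)
qed (use assms in auto)

text \<open>The first \<open>len[v]\<close> cells of row \<open>v\<close> of the array \<open>inl\<close> list the pairs with an edge to \<open>v\<close>; dead
  pairs are dropped only when a scan meets them. \<open>y\<close> marks the attractor and \<open>qu\<close> is its work list;
  \<open>cnt[e]\<close> counts the occurrences of the pair \<open>e\<close> in the rows of low states not yet processed.\<close>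

definition push_code :: com where
  "push_code = If (Less (Load ''y'' (V ''u'')) (Const 1))
     (Seq (Store ''y'' (V ''u'') (Const 1))
       (Seq (Store ''qu'' (V ''tl'') (V ''u'')) (Set ''tl'' (Plus (V ''tl'') (Const 1)))))
     Skip"

text \<open>The scan may stop after \<open>d + 1\<close> live entries, since these already certify a
  high in-degree; any further work is deletion. The length is decreased first, so that it then
  indexes the entry copied into the gap.\<close>

definition compact_row_code :: com where
  "compact_row_code =
     While (And (Less (V ''j'') (Load ''len'' (V ''v''))) (Less (V ''j'') (Plus (V ''d'') (Const 1))))
       (If (Less (Const 0) (Load ''al'' (Load ''cle'' (Load ''inl'' (Plus (Load ''rN'' (V ''v'')) (V ''j''))))))
         (Set ''j'' (Plus (V ''j'') (Const 1)))
         (Seq (Store ''len'' (V ''v'') (Minus (Load ''len'' (V ''v'')) (Const 1)))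
           (Store ''inl'' (Plus (Load ''rN'' (V ''v'')) (V ''j''))
             (Load ''inl'' (Plus (Load ''rN'' (V ''v'')) (Load ''len'' (V ''v'')))))))"

lemma writes_compact_row [simp]: "writes compact_row_code = [''j'', ''len'', ''inl'']"
  by (simp add: compact_row_code_def)

definition compact_code :: com where
  "compact_code = For ''v'' (V ''states'')
     (Seq (Store ''y'' (V ''v'') (Const 0))
       (Seq (Set ''j'' (Const 0))
         compact_row_code))"

definition count_code :: com where
  "count_code = Seq (For ''e'' (V ''N'') (Store ''cnt'' (V ''e'') (Const 0)))
     (For ''v'' (V ''states'') (If (Less (V ''d'') (Load ''len'' (V ''v''))) Skip
       (For ''j'' (Load ''len'' (V ''v''))
         (Store ''cnt'' (Load ''inl'' (Plus (Load ''rN'' (V ''v'')) (V ''j'')))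
           (Plus (Load ''cnt'' (Load ''inl'' (Plus (Load ''rN'' (V ''v'')) (V ''j'')))) (Const 1))))))"

text \<open>A live pair with count 0 has only high successors, and these are marked already. The
  negated conjunction expresses that the count is 0 or the source has colour 1.\<close>

definition seed_code :: com where
  "seed_code = Seq (Set ''tl'' (Const 0))
     (Seq (For ''v'' (V ''states'')
         (If (Less (V ''d'') (Load ''len'' (V ''v''))) (Seq (Set ''u'' (V ''v'')) push_code) Skip))
       (For ''e'' (V ''N'')
         (If (And (Less (Const 0) (Load ''al'' (Load ''cle'' (V ''e''))))
               (Not (And (Less (Const 0) (Load ''cnt'' (V ''e'')))
                 (Less (Load ''color'' (Load ''src'' (V ''e''))) (Const 1)))))
           (Seq (Set ''u'' (Load ''src'' (V ''e''))) push_code) Skip)))"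

definition spread_row_code :: com where
  "spread_row_code = For ''j'' (Load ''len'' (V ''v''))
     (Seq (Set ''e'' (Load ''inl'' (Plus (Load ''rN'' (V ''v'')) (V ''j''))))
       (Seq (Store ''cnt'' (V ''e'') (Minus (Load ''cnt'' (V ''e'')) (Const 1)))
         (If (Less (Load ''cnt'' (V ''e'')) (Const 1))
           (Seq (Set ''u'' (Load ''src'' (V ''e''))) push_code) Skip)))"

lemma writes_spread_row [simp]:
  "writes spread_row_code = [''j'', ''e'', ''cnt'', ''u'', ''y'', ''qu'', ''tl'', ''j'']"
  by (simp add: spread_row_code_def push_code_def)

definition spread_code :: com where
  "spread_code = Seq (Set ''hd'' (Const 0))
     (While (Less (V ''hd'') (V ''tl''))
       (Seq (Set ''v'' (Load ''qu'' (V ''hd'')))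
         (Seq (Set ''hd'' (Plus (V ''hd'') (Const 1)))
           (If (Less (V ''d'') (Load ''len'' (V ''v''))) Skip
             spread_row_code))))"

definition queue :: "nat \<Rightarrow> (nat \<Rightarrow> nat) \<Rightarrow> (nat \<Rightarrow> nat) \<Rightarrow> nat \<Rightarrow> bool" where
  "queue n y qu m \<longleftrightarrow> (\<forall>v<n. y v \<le> 1) \<and> qu ` {..<m} = {v. v < n \<and> y v = 1} \<and> inj_on qu {..<m}"

lemma queue_push:
  assumes "queue n y qu m" "u < n" "y u = 0"
  shows "queue n (y(u := Suc 0)) (qu(m := u)) (Suc m)"
proof -
  have u: "u \<notin> qu ` {..<m}"
    using assms unfolding queue_def by simp
  have "(qu(m := u)) ` {..<Suc m} = insert u (qu ` {..<m})"
    by (auto simp: lessThan_Suc)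
  also have "\<dots> = {v. v < n \<and> (y(u := Suc 0)) v = 1}"
    using assms by (auto simp: queue_def)
  finally have "(qu(m := u)) ` {..<Suc m} = {v. v < n \<and> (y(u := Suc 0)) v = 1}" .
  moreover have "inj_on (qu(m := u)) {..<Suc m}"
    using assms(1) u by (simp add: queue_def lessThan_Suc inj_on_fun_updI)
  ultimately show ?thesis
    using assms(1) by (simp add: queue_def)
qed

lemma queue_le:
  assumes "queue n y qu m"
  shows "m \<le> n"
proof -
  have "m = card (qu ` {..<m})"
    using assms unfolding queue_def by (metis card_image card_lessThan)
  also have "\<dots> \<le> card {..<n}"
    using assms by (intro card_mono) (auto simp: queue_def)
  finally show ?thesis
    by simp
qed

lemma run_push:
  assumes "queue n (s ''y'') (s ''qu'') (s ''tl'' 0)" "s ''u'' 0 = u" "u < n"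
  shows "run push_code s (\<lambda>t s'. t \<le> 30 \<and> queue n (s' ''y'') (s' ''qu'') (s' ''tl'' 0) \<and>
    s' ''y'' = (s ''y'')(u := 1) \<and> (\<forall>i<s ''tl'' 0. s' ''qu'' i = s ''qu'' i) \<and> s ''tl'' 0 \<le> s' ''tl'' 0 \<and>
    frame [''y'', ''qu'', ''tl''] s s')"
proof (cases "s ''y'' u = 0")
  case True
  then show ?thesis
    using assms queue_push[OF assms(1,3) True] by (auto simp: push_code_def)
next
  case False
  then have "s ''y'' u = 1"
    using assms unfolding queue_def by (metis One_nat_def le_SucE le_zero_eq)
  then have "(s ''y'')(u := 1) = s ''y''"
    by auto
  then show ?thesis
    using False assms by (auto simp: push_code_def)
qed

text \<open>\<open>R\<close> stands for the cells (row, offset) not yet consumed; the count of a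
  pair is the number of its successors whose consumption is still awaited.\<close>

definition tokens :: "nat \<Rightarrow> (nat \<Rightarrow> nat) \<Rightarrow> (nat \<times> nat) set \<Rightarrow> nat \<Rightarrow> nat" where
  "tokens N inl R e = card {(v, j). (v, j) \<in> R \<and> inl (v * N + j) = e}"

lemma tokens_empty [simp]: "tokens N inl {} e = 0"
  by (simp add: tokens_def)

lemma tokens_insert:
  assumes "finite R" "(v, j) \<notin> R"
  shows "tokens N inl (insert (v, j) R) e = tokens N inl R e + (if inl (v * N + j) = e then 1 else 0)"
proof -
  have "finite {(v, j). (v, j) \<in> R \<and> inl (v * N + j) = e}"
    using assms(1) by (rule finite_subset[rotated]) auto
  moreover have "{(v', j'). (v', j') \<in> insert (v, j) R \<and> inl (v' * N + j') = e} =
      (if inl (v * N + j) = e then insert (v, j) else id) {(v, j). (v, j) \<in> R \<and> inl (v * N + j) = e}"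
    by auto
  ultimately show ?thesis
    using assms(2) by (simp add: tokens_def)
qed

lemma tokens_pos: "finite R \<Longrightarrow> (v, j) \<in> R \<Longrightarrow> inl (v * N + j) = e \<Longrightarrow> 0 < tokens N inl R e"
  unfolding tokens_def
  by (subst card_gt_0_iff) (auto intro: finite_subset[of _ R])

lemma tokens_zero: "(\<And>v j. (v, j) \<in> R \<Longrightarrow> inl (v * N + j) \<noteq> e) \<Longrightarrow> tokens N inl R e = 0"
  unfolding tokens_def by (auto simp: card_eq_0_iff)

section \<open>Correctness and cost of the phases of one round\<close>

context class_arena
begin

definition static :: "state \<Rightarrow> bool" where
  "static s \<longleftrightarrow> s ''states'' 0 = n \<and> s ''N'' 0 = N \<and> (\<forall>v<n. s ''rN'' v = v * N) \<and>
     (\<forall>e<N. s ''src'' e = e div k \<and> s ''cle'' e = cls e) \<and>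
     (\<forall>p<n. s ''rep'' p = rep p \<and> (0 < s ''color'' p \<longleftrightarrow> target p))"

lemma static_frame:
  "static s \<Longrightarrow> frame W s s' \<Longrightarrow>
    set W \<inter> {''states'', ''N'', ''rN'', ''src'', ''cle'', ''rep'', ''color''} = {} \<Longrightarrow> static s'"
  by (auto simp: static_def frame_def)

definition row_ok :: "(nat \<Rightarrow> nat) \<Rightarrow> nat \<Rightarrow> nat list \<Rightarrow> bool" where
  "row_ok al v xs \<longleftrightarrow> distinct xs \<and> set xs \<subseteq> {e. e < N \<and> in_edge e v} \<and>
     {e. e < N \<and> in_edge e v \<and> 0 < al (cls e)} \<subseteq> set xs"

lemma row_ok_length: "row_ok al v xs \<Longrightarrow> length xs \<le> N"
proof -
  assume "row_ok al v xs"
  then have "length xs = card (set xs)" "set xs \<subseteq> {..<N}"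
    by (auto simp: row_ok_def distinct_card)
  then show ?thesis
    by (metis card_lessThan card_mono finite_lessThan)
qed

definition lists_ok :: "(nat \<Rightarrow> nat) \<Rightarrow> (nat \<Rightarrow> nat) \<Rightarrow> (nat \<Rightarrow> nat) \<Rightarrow> bool" where
  "lists_ok al inl len \<longleftrightarrow> (\<forall>v<n. row_ok al v (rowlist N inl len v))"

lemma lists_ok_len: "lists_ok al inl len \<Longrightarrow> v < n \<Longrightarrow> len v \<le> N"
  using row_ok_length unfolding lists_ok_def by (metis length_rowlist)

lemma lists_ok_entry:
  assumes "lists_ok al inl len" "v < n" "j < len v"
  shows "inl (v * N + j) < N" "in_edge (inl (v * N + j)) v"
proof -
  have "rowlist N inl len v ! j \<in> set (rowlist N inl len v)"
    using assms by (intro nth_mem) simp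
  then have "inl (v * N + j) \<in> set (rowlist N inl len v)"
    using assms by (simp add: nth_rowlist)
  then show "inl (v * N + j) < N" "in_edge (inl (v * N + j)) v"
    using assms(1,2) unfolding lists_ok_def row_ok_def by auto
qed

text \<open>The dichotomy after compaction: a long row certifies more than \<open>d\<close> live
  incoming pairs although its unscanned part may contain dead ones, while a short row has no dead
  entries.\<close>

definition row_done :: "(nat \<Rightarrow> nat) \<Rightarrow> nat \<Rightarrow> nat \<Rightarrow> nat list \<Rightarrow> bool" where
  "row_done al d v xs \<longleftrightarrow> (if d < length xs then d < indeg al v else \<forall>e\<in>set xs. 0 < al (cls e))"

lemma row_doneI:
  assumes ok: "row_ok al v xs" and alive: "\<And>i. i < j \<Longrightarrow> 0 < al (cls (xs ! i))"
    and j: "j \<le> length xs" "j = length xs \<or> j = Suc d"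
  shows "row_done al d v xs"
proof (cases "d < length xs")
  case True
  then have "j > d"
    using j by auto
  let ?A = "{e. e < N \<and> in_edge e v \<and> 0 < al (cls e)}"
  have "set (take (Suc d) xs) \<subseteq> ?A"
  proof
    fix e assume "e \<in> set (take (Suc d) xs)"
    then obtain i where i: "i < Suc d" "i < length xs" "e = xs ! i"
      by (auto simp: in_set_conv_nth)
    then have "e \<in> set xs"
      by simp
    then have "e < N \<and> in_edge e v"
      using ok by (auto simp: row_ok_def)
    moreover have "0 < al (cls e)"
      using alive[of i] i \<open>j > d\<close> by simp
    ultimately show "e \<in> ?A"
      by simp
  qed
  moreover have "card (set (take (Suc d) xs)) = Suc d"
    using ok True by (simp add: row_ok_def distinct_card)
  ultimately have "Suc d \<le> card ?A"
    using card_mono[of ?A "set (take (Suc d) xs)"] by simp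
  then show ?thesis
    using True by (simp add: row_done_def indeg_def)
next
  case False
  then have "j = length xs"
    using j by auto
  then show ?thesis
    using False alive by (auto simp: row_done_def in_set_conv_nth)
qed

definition len_sum :: "(nat \<Rightarrow> nat) \<Rightarrow> nat" where
  "len_sum len = (\<Sum>v<n. len v)"

lemma sum_upd:
  fixes f :: "nat \<Rightarrow> nat"
  assumes "i < m"
  shows "(\<Sum>v<m. (f(i := x)) v) + f i = (\<Sum>v<m. f v) + x"
proof -
  have "(\<Sum>v<m. (f(i := x)) v) = x + (\<Sum>v\<in>{..<m} - {i}. (f(i := x)) v)"
    using assms by (subst sum.remove[of _ i]) auto
  also have "(\<Sum>v\<in>{..<m} - {i}. (f(i := x)) v) = (\<Sum>v\<in>{..<m} - {i}. f v)"
    by (intro sum.cong) auto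
  finally show ?thesis
    using assms by (subst sum.remove[of _ i f]) auto
qed

lemma len_sum_upd: "i < n \<Longrightarrow> len_sum (len(i := x)) + len i = len_sum len + x"
  unfolding len_sum_def by (rule sum_upd)

text \<open>Replacing a dead entry by the last one loses no live pair and leaves the other rows and
  the scanned part of this row intact.\<close>

lemma lists_ok_remove:
  assumes ok: "lists_ok al inl len" and i: "i < n" and j: "j < len i"
    and dead: "al (cls (inl (i * N + j))) = 0"
  defines "inl' \<equiv> inl(i * N + j := inl (i * N + (len i - 1)))" and "len' \<equiv> len(i := len i - 1)"
  shows "lists_ok al inl' len'"
    "\<And>v. v < n \<Longrightarrow> v \<noteq> i \<Longrightarrow> rowlist N inl' len' v = rowlist N inl len v"
    "\<And>i'. i' < j \<Longrightarrow> rowlist N inl' len' i ! i' = rowlist N inl len i ! i'"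
proof -
  have "j < N"
    using j lists_ok_len[OF ok i] by simp
  then show other: "rowlist N inl' len' v = rowlist N inl len v" if "v < n" "v \<noteq> i" for v
    using that lists_ok_len[OF ok] by (simp add: inl'_def len'_def rowlist_upd_other)
  have row_i: "rowlist N inl' len' i = butlast ((rowlist N inl len i)[j := last (rowlist N inl len i)])"
    unfolding inl'_def len'_def using j by (rule rowlist_remove)
  have ok_i: "row_ok al i (rowlist N inl len i)" and ji: "j < length (rowlist N inl len i)"
    using ok i j by (simp_all add: lists_ok_def)
  then have "distinct (rowlist N inl len i)"
    by (simp add: row_ok_def)
  note sr = swap_remove[OF this ji, folded row_i]
  show "rowlist N inl' len' i ! i' = rowlist N inl len i ! i'" if "i' < j" for i'
    using sr(4)[OF that] .
  have "row_ok al i (rowlist N inl' len' i)"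
    using ok_i dead j sr(1) unfolding row_ok_def sr(2) by (auto simp: nth_rowlist)
  then have "row_ok al v (rowlist N inl' len' v)" if "v < n" for v
    using other[OF that] ok that by (cases "v = i") (auto simp: lists_ok_def)
  then show "lists_ok al inl' len'"
    by (simp add: lists_ok_def)
qed

lemma run_compact:
  assumes static: "static s" and ok: "lists_ok (s ''al'') (s ''inl'') (s ''len'')" and d: "s ''d'' 0 = d"
  shows "run compact_code s (\<lambda>t s'. lists_ok (s ''al'') (s' ''inl'') (s' ''len'') \<and>
     (\<forall>v<n. s' ''y'' v = 0 \<and> row_done (s ''al'') d v (rowlist N (s' ''inl'') (s' ''len'') v)) \<and>
     t + 200 * len_sum (s' ''len'') \<le> 200 * len_sum (s ''len'') + n * (200 * d + 500) + 100)"
  unfolding compact_code_def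
proof (rule run_mono, rule run_For[where m = n and C = "200 * d + 400" and
      \<Phi> = "\<lambda>s. 200 * len_sum (s ''len'')" and I =
      "\<lambda>i s'. lists_ok (s ''al'') (s' ''inl'') (s' ''len'') \<and>
        (\<forall>v<i. s' ''y'' v = 0 \<and> row_done (s ''al'') d v (rowlist N (s' ''inl'') (s' ''len'') v))"], goal_cases)
  case (5 i s1)
  note fr = frameD[OF 5(4), simplified]
  let ?al = "s ''al''"
  have i: "i < n" "s1 ''v'' 0 = i"
    using 5 by auto
  have stat: "static s1"
    using static 5(4) by (rule static_frame) simp
  let ?s = "s1(''y'' := (s1 ''y'')(i := 0), ''j'' := (s1 ''j'')(0 := 0))"
  have "run compact_row_code ?s
     (\<lambda>t s'. lists_ok ?al (s' ''inl'') (s' ''len'') \<and> s' ''v'' 0 = i \<and>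
       (\<forall>v<Suc i. s' ''y'' v = 0 \<and> row_done ?al d v (rowlist N (s' ''inl'') (s' ''len'') v)) \<and>
       t + 200 * len_sum (s' ''len'') \<le> 200 * len_sum (s1 ''len'') + 200 * d + 300)"
  unfolding compact_row_code_def
  \<comment> \<open>Each iteration either advances \<open>j\<close>, which happens at most
    \<open>d + 1\<close> times, or shortens the row; the potential charges 200 for either.\<close>
  proof (rule run_mono, rule run_While[where I = "\<lambda>s'. lists_ok ?al (s' ''inl'') (s' ''len'') \<and>
        s' ''j'' 0 \<le> Suc d \<and> s' ''j'' 0 \<le> s' ''len'' i \<and>
        (\<forall>i'<s' ''j'' 0. 0 < ?al (cls (rowlist N (s' ''inl'') (s' ''len'') i ! i'))) \<and>
        (\<forall>v<i. row_done ?al d v (rowlist N (s' ''inl'') (s' ''len'') v))" and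
        \<Phi> = "\<lambda>s. 200 * len_sum (s ''len'') + (Suc d - s ''j'' 0) * 200"], goal_cases)
    case 1
    then show ?case
      using 5 by simp
  next
    case (2 s2)
    note fr2 = frameD[OF 2(3), simplified]
    let ?j = "s2 ''j'' 0" and ?len = "s2 ''len''" and ?inl = "s2 ''inl''"
    have ok2: "lists_ok ?al ?inl ?len"
      using 2 by simp
    have eqs: "s2 ''v'' 0 = i" "s2 ''d'' 0 = d" "s2 ''al'' = ?al" "s2 ''rN'' i = i * N"
      using i stat d by (simp_all add: fr fr2 static_def)
    have j: "?j < ?len i" "?j \<le> d"
      using 2(2) by (simp_all add: eqs)
    have cle: "s2 ''cle'' (?inl (i * N + ?j)) = cls (?inl (i * N + ?j))"
      using stat lists_ok_entry[OF ok2 i(1) j(1)] by (simp add: fr2 static_def)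
    have dj: "Suc d - ?j = Suc (d - ?j)"
      using j by simp
    show ?case
    proof (cases "0 < ?al (cls (?inl (i * N + ?j)))")
      case True
      then show ?thesis
        using 2(1) j by (auto simp: eqs cle dj less_Suc_eq nth_rowlist)
    next
      case False
      then have dead: "?al (cls (?inl (i * N + ?j))) = 0"
        by simp
      note rem = lists_ok_remove[OF ok2 i(1) j(1) dead]
      have "len_sum (?len(i := ?len i - 1)) + 1 = len_sum ?len"
        using len_sum_upd[OF i(1), of ?len "?len i - 1"] j by simp
      moreover have "\<forall>i'<?j. 0 < ?al (cls (rowlist N ?inl ?len i ! i'))"
        "\<forall>v<i. row_done ?al d v (rowlist N ?inl ?len v)" "?j \<le> Suc d"
        using 2(1) by auto
      ultimately show ?thesis
        using dead rem i j by (simp add: eqs cle)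
    qed
  next
    case (3 t s2)
    then have "frame [''j'', ''len'', ''inl''] ?s s2"
      by (simp add: frame_def)
    note fr2 = frameD[OF this, simplified]
    have eqs: "s2 ''v'' 0 = i" "s2 ''d'' 0 = d" "s2 ''al'' = ?al" "s2 ''y'' = (s1 ''y'')(i := 0)"
      using i d by (simp_all add: fr fr2)
    have "row_done ?al d i (rowlist N (s2 ''inl'') (s2 ''len'') i)"
    proof (rule row_doneI)
      show "row_ok ?al i (rowlist N (s2 ''inl'') (s2 ''len'') i)"
        using 3 i by (simp add: lists_ok_def)
      show "s2 ''j'' 0 = length (rowlist N (s2 ''inl'') (s2 ''len'') i) \<or> s2 ''j'' 0 = Suc d"
        using 3 by (auto simp: eqs)
    qed (use 3 in auto)
    then show ?case
      using 3 5(2) eqs by (auto simp: less_Suc_eq)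
  qed
  then show ?case
    unfolding run_Seq run_Store using i
    by (simp, elim run_mono) auto
next
  case (6 t s')
  then show ?case
    by (simp add: algebra_simps)
qed (use assms in \<open>simp_all add: static_def\<close>)

end

context class_arena
begin

definition low_tokens :: "(nat \<Rightarrow> nat) \<Rightarrow> nat \<Rightarrow> (nat \<times> nat) set" where
  "low_tokens len d = {(v, j). v < n \<and> len v \<le> d \<and> j < len v}"

lemma finite_low_tokens: "finite (low_tokens len d)"
proof (rule finite_subset)
  show "low_tokens len d \<subseteq> {..<n} \<times> {..<d}"
    by (auto simp: low_tokens_def)
qed simp

lemma run_count:
  assumes static: "static s" and ok: "lists_ok al (s ''inl'') (s ''len'')" and d: "s ''d'' 0 = d"
  shows "run count_code s (\<lambda>t s'.
     (\<forall>e<N. s' ''cnt'' e = tokens N (s ''inl'') (low_tokens (s ''len'') d) e) \<and>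
     t \<le> N * 100 + n * (100 * d + 100) + 100)"
proof -
  let ?len = "s ''len''" and ?inl = "s ''inl''"
  define R where "R i = {(v, j). v < i \<and> ?len v \<le> d \<and> j < ?len v}" for i
  have fin: "finite (R i)" for i
    by (rule finite_subset[of _ "{..<i} \<times> {..<d}"]) (auto simp: R_def)
  have Rn: "R n = low_tokens ?len d"
    by (simp add: R_def low_tokens_def)
  show ?thesis
    unfolding count_code_def run_Seq Rn[symmetric]
  proof (rule run_mono, rule run_For0[where m = N and C = 10 and I = "\<lambda>i s'. \<forall>e<i. s' ''cnt'' e = 0"], goal_cases)
    case (5 t0 s0)
    then have "frame [''e'', ''cnt''] s s0"
      by (simp add: frame_def)
    note fr0 = frameD[OF this, simplified]
    show ?case
    proof (rule run_mono, rule run_For0[where m = n and C = "d * 100 + 50" and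
          I = "\<lambda>i s'. \<forall>e<N. s' ''cnt'' e = tokens N ?inl (R i) e"], goal_cases)
      case 1
      then show ?case
        using 5 by (simp add: R_def)
    next
      case (4 i s1)
      note fr = frameD[OF 4(4), simplified]
      have i: "s1 ''d'' 0 = d" "s1 ''v'' 0 = i" "s1 ''len'' = ?len" "s1 ''inl'' = ?inl" "s1 ''rN'' = s ''rN''"
        using 4 d by (simp_all add: fr fr0)
      show ?case
      proof (cases "d < ?len i")
        case True
        then have "R (Suc i) = R i"
          by (auto simp: R_def less_Suc_eq)
        then show ?thesis
          using True 4(2) by (simp add: i)
      next
        case False
        let ?S = "\<lambda>j. R i \<union> {(i, j') | j'. j' < j}"
        have body: "run (For ''j'' (Load ''len'' (V ''v''))
         (Store ''cnt'' (Load ''inl'' (Plus (Load ''rN'' (V ''v'')) (V ''j'')))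
           (Plus (Load ''cnt'' (Load ''inl'' (Plus (Load ''rN'' (V ''v'')) (V ''j'')))) (Const 1)))) s1
           (\<lambda>t s'. (\<forall>e<N. s' ''cnt'' e = tokens N ?inl (R (Suc i)) e) \<and> s' ''v'' 0 = i \<and> t \<le> d * 100 + 30)"
        proof (rule run_mono, rule run_For0[where m = "?len i" and C = 50 and
            I = "\<lambda>j s'. \<forall>e<N. s' ''cnt'' e = tokens N ?inl (?S j) e"], goal_cases)
          case (4 j s2)
          note fr2 = frameD[OF 4(4), simplified]
          have eqs: "s2 ''v'' 0 = i" "s2 ''rN'' i = i * N" "s2 ''inl'' = ?inl"
            using i static \<open>i < n\<close> by (simp_all add: fr2 static_def)
          have S: "?S (Suc j) = insert (i, j) (?S j)" "(i, j) \<notin> ?S j"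
            by (auto simp: R_def)
          have "finite (?S j)"
            using fin by simp
          note ins = tokens_insert[OF this S(2)]
          have "?inl (i * N + j) < N"
            using lists_ok_entry[OF ok \<open>i < n\<close> \<open>j < ?len i\<close>] by simp
          then show ?case
            using 4(2,3) by (simp add: eqs S(1) ins)
        next
          case (5 t s2)
          then have "frame [''j'', ''cnt''] s1 s2"
            by (simp add: frame_def)
          note fr2 = frameD[OF this, simplified]
          have "?S (?len i) = R (Suc i)"
            using False by (auto simp: R_def less_Suc_eq)
          moreover have "?len i * 62 \<le> d * 62"
            using False by simp
          ultimately show ?case
            using 5 i by (simp add: fr2)
        qed (use 4 i in simp_all)
        then show ?thesis
          using False by (simp add: i, elim run_mono) auto
      qed
    next
      case (5 t s1)
      then show ?case
        using \<open>(\<forall>e<N. s0 ''cnt'' e = 0) \<and> _\<close> by (simp add: algebra_simps)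
    qed (use static fr0 in \<open>simp_all add: static_def\<close>)
  qed (use static in \<open>simp_all add: static_def less_Suc_eq\<close>)
qed

text \<open>The clause giving a reason for each mark is what later shows that no state of a low trap
  has been marked.\<close>

lemma run_seed:
  assumes static: "static s" and d: "s ''d'' 0 = d" and y: "\<forall>v<n. s ''y'' v = 0"
  shows "run seed_code s (\<lambda>t s'. queue n (s' ''y'') (s' ''qu'') (s' ''tl'' 0) \<and>
     (\<forall>v<n. d < s ''len'' v \<longrightarrow> s' ''y'' v = 1) \<and>
     (\<forall>e<N. 0 < s ''al'' (cls e) \<longrightarrow> s ''cnt'' e = 0 \<or> target (e div k) \<longrightarrow> s' ''y'' (e div k) = 1) \<and>
     (\<forall>v<n. s' ''y'' v = 1 \<longrightarrow> d < s ''len'' v \<or>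
       (\<exists>e<N. e div k = v \<and> 0 < s ''al'' (cls e) \<and> (s ''cnt'' e = 0 \<or> target v))) \<and>
     t \<le> N * 150 + n * 150 + 100)"
  unfolding seed_code_def run_Seq run_Store
proof (rule run_mono, rule run_For0[where m = n and C = 100 and I =
      "\<lambda>i s'. queue n (s' ''y'') (s' ''qu'') (s' ''tl'' 0) \<and> (\<forall>v<n. s' ''y'' v = 1 \<longleftrightarrow> v < i \<and> d < s ''len'' v)"], goal_cases)
  case 1
  then show ?case
    using y by (simp add: queue_def)
next
  case (4 i s1)
  note fr = frameD[OF 4(4), simplified writes.simps push_code_def, simplified]
  have i: "s1 ''d'' 0 = d" "s1 ''v'' 0 = i" "s1 ''len'' = s ''len''"
    using 4 d by (simp_all add: fr)
  show ?case
  proof (cases "d < s ''len'' i")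
    case True
    have "run push_code (s1(''u'' := (s1 ''u'')(0 := i))) (\<lambda>t s'. t \<le> 30 \<and> queue n (s' ''y'') (s' ''qu'') (s' ''tl'' 0) \<and>
      (\<forall>v<n. s' ''y'' v = 1 \<longleftrightarrow> v < Suc i \<and> d < s ''len'' v) \<and> s' ''v'' 0 = i)"
    proof (rule run_mono, rule run_push[where n = n and u = i], goal_cases)
      case (4 t s')
      then have "s' ''v'' = s1 ''v''" "s' ''y'' = (s1 ''y'')(i := 1)"
        by (auto dest!: frameD[where x = "''v''"])
      then show ?case
        using 4 \<open>i < n\<close> True i \<open>_ \<and> (\<forall>v<n. s1 ''y'' v = 1 \<longleftrightarrow> _ v)\<close> by (simp add: less_Suc_eq) metis
    qed (use 4 in simp_all)
    then show ?thesis
      using True by (simp add: i, elim run_mono) simp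
  next
    case False
    then show ?thesis
      using 4 by (auto simp: i less_Suc_eq)
  qed
next
  case (5 t0 s0)
  let ?W = "[''v'', ''u'', ''y'', ''qu'', ''tl'']"
  from 5 have t0: "t0 \<le> n * 112 + 9"
    by simp
  from 5 have "frame ?W s s0"
    by (simp add: frame_def push_code_def)
  note fr0 = frameD[OF this, simplified]
  have static0: "static s0"
    using static \<open>frame ?W s s0\<close> by (rule static_frame) simp
  show ?case
  proof (rule run_mono, rule run_For0[where m = N and C = 120 and I =
      "\<lambda>i s'. queue n (s' ''y'') (s' ''qu'') (s' ''tl'' 0) \<and>
       (\<forall>v<n. d < s ''len'' v \<longrightarrow> s' ''y'' v = 1) \<and>
       (\<forall>e<i. 0 < s ''al'' (cls e) \<longrightarrow> s ''cnt'' e = 0 \<or> target (e div k) \<longrightarrow> s' ''y'' (e div k) = 1) \<and>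
       (\<forall>v<n. s' ''y'' v = 1 \<longrightarrow> d < s ''len'' v \<or>
         (\<exists>e<N. e div k = v \<and> 0 < s ''al'' (cls e) \<and> (s ''cnt'' e = 0 \<or> target v)))"], goal_cases)
    case 1
    then show ?case
      using 5 by auto
  next
    case (4 i s1)
    note fr = frameD[OF 4(4), simplified writes.simps push_code_def, simplified]
    let ?p = "i div k"
    have p: "?p < n"
      using 4(1) by (rule pair_div_less)
    have eqs: "s1 ''e'' 0 = i" "s1 ''cle'' i = cls i" "s1 ''src'' i = ?p" "s1 ''al'' = s ''al''"
      "s1 ''cnt'' = s ''cnt''" "0 < s1 ''color'' ?p \<longleftrightarrow> target ?p"
      using 4 static p by (simp_all add: fr fr0 static_def)
    let ?c = "0 < s ''al'' (cls i) \<and> (s ''cnt'' i = 0 \<or> target ?p)"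
    have col: "s1 ''color'' ?p = 0 \<longleftrightarrow> \<not> target ?p"
      using eqs(6) by auto
    show ?case
    proof (cases ?c)
      case True
      have "run push_code (s1(''u'' := (s1 ''u'')(0 := ?p))) (\<lambda>t s'. t \<le> 30 \<and> queue n (s' ''y'') (s' ''qu'') (s' ''tl'' 0) \<and>
        s' ''y'' = (s1 ''y'')(?p := 1) \<and> s' ''e'' 0 = i)"
      proof (rule run_mono, rule run_push[where n = n and u = ?p], goal_cases)
        case (4 t s')
        then have "s' ''e'' = s1 ''e''"
          by (auto dest!: frameD[where x = "''e''"])
        then show ?case
          using 4 eqs(1) by auto
      qed (use 4 p in simp_all)
      moreover have "\<exists>e<N. e div k = ?p \<and> 0 < s ''al'' (cls e) \<and> (s ''cnt'' e = 0 \<or> target ?p)"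
        using True 4(1) by blast
      ultimately show ?thesis
        using True 4(2) by (simp add: eqs(1-5) col, elim run_mono) (auto simp: less_Suc_eq)
    next
      case False
      then show ?thesis
        using 4(2) by (auto simp: eqs(1-5) col less_Suc_eq)
    qed
  next
    case (5 t s1)
    then show ?case
      using t0 by (simp add: algebra_simps)
  qed (use static0 in \<open>simp_all add: static_def push_code_def\<close>)
qed (use static in \<open>simp_all add: static_def push_code_def\<close>)

text \<open>The last clause is the completeness of the search at level \<open>d\<close>: traps
  consisting of low states are never touched.\<close>

definition spread_ok :: "(nat \<Rightarrow> nat) \<Rightarrow> (nat \<Rightarrow> nat) \<Rightarrow> (nat \<Rightarrow> nat) \<Rightarrow> (nat \<Rightarrow> nat) \<Rightarrow> nat \<Rightarrow>
    (nat \<times> nat) set \<Rightarrow> state \<Rightarrow> bool" where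
  "spread_ok st al inl len d R s \<longleftrightarrow> queue n (s ''y'') (s ''qu'') (s ''tl'' 0) \<and>
     (\<forall>e<N. s ''cnt'' e = tokens N inl R e) \<and>
     (\<forall>e<N. 0 < al (cls e) \<longrightarrow> s ''cnt'' e = 0 \<longrightarrow> s ''y'' (e div k) = 1) \<and>
     (\<forall>v<n. d < len v \<or> is_target al v \<longrightarrow> s ''y'' v = 1) \<and>
     (\<forall>T. trap st al T \<longrightarrow> (\<forall>v\<in>T. len v \<le> d) \<longrightarrow> (\<forall>v\<in>T. s ''y'' v \<noteq> 1))"

text \<open>A state of a low trap \<open>T\<close> cannot lose its last token: each of its live actions leads to a
  state of \<open>T\<close>, whose tokens have not been consumed yet.\<close>

lemma trap_token:
  assumes ok: "lists_ok al inl len" and T: "trap st al T" "\<forall>v\<in>T. len v \<le> d" "\<forall>v\<in>T. y v \<noteq> 1"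
    and e: "e < N" "0 < al (cls e)" "e div k \<in> T"
    and R: "finite R" "\<And>v j. v < n \<Longrightarrow> len v \<le> d \<Longrightarrow> j < len v \<Longrightarrow> y v \<noteq> 1 \<Longrightarrow> (v, j) \<in> R"
  shows "0 < tokens N inl R e"
proof -
  have "0 < al (rep (e div k) * k + e mod k)" "e mod k < k"
    using e(2) pair_mod_less by (simp_all add: cls_def)
  then obtain q where q: "q \<in> T" "edge (e div k) (e mod k) q"
    using T(1) e(3) unfolding trap_def by blast
  then have "q < n"
    using T(1) unfolding trap_def alive_states_def by blast
  have "e \<in> set (rowlist N inl len q)"
  proof -
    have "e \<in> {e. e < N \<and> in_edge e q \<and> 0 < al (cls e)}"
      using q e by (simp add: in_edge_def)
    then show ?thesis
      using ok \<open>q < n\<close> unfolding lists_ok_def row_ok_def by blast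
  qed
  then obtain j where "j < len q" "inl (q * N + j) = e"
    by (auto simp: in_set_conv_nth nth_rowlist)
  then show ?thesis
    using tokens_pos[OF R(1) R(2)[OF \<open>q < n\<close>]] q T by blast
qed

lemma run_spread:
  assumes static: "static s" and ok: "lists_ok al (s ''inl'') (s ''len'')" and d: "s ''d'' 0 = d"
    and rows: "\<forall>v<n. row_done al d v (rowlist N (s ''inl'') (s ''len'') v)"
    and init: "spread_ok st al (s ''inl'') (s ''len'') d (low_tokens (s ''len'') d) s"
  shows "run spread_code s (\<lambda>t s'. (\<forall>v<n. s' ''y'' v \<le> 1) \<and> closed al {v. v < n \<and> s' ''y'' v = 1} \<and>
     (\<forall>T. trap st al T \<longrightarrow> (\<forall>v\<in>T. s ''len'' v \<le> d) \<longrightarrow> (\<forall>v\<in>T. s' ''y'' v \<noteq> 1)) \<and>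
     t \<le> n * (d * 200 + 200) + 100)"
proof -
  let ?len = "s ''len''" and ?inl = "s ''inl''"
  \<comment> \<open>The cells still to be consumed: rows in \<open>D\<close> are finished, and of
    row \<open>i\<close> the first \<open>j\<close> cells are done. With \<open>j = 0\<close> row
    \<open>i\<close> is still complete.\<close>
  define R where "R D i j = {(v', j'). (v', j') \<in> low_tokens ?len d \<and> v' \<notin> D \<and> (v' = i \<longrightarrow> j \<le> j')}" for D i j
  have fin: "finite (R D i j)" for D i j
    by (rule finite_subset[OF _ finite_low_tokens[of ?len d]]) (auto simp: R_def)
  let ?inv = "\<lambda>R. spread_ok st al ?inl ?len d R"
  have entry: "?inl (v * N + j) < N" "0 < al (cls (?inl (v * N + j)))"
    if "v < n" "?len v \<le> d" "j < ?len v" for v j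
  proof -
    show "?inl (v * N + j) < N"
      using lists_ok_entry[OF ok that(1,3)] by simp
    have "?inl (v * N + j) \<in> set (rowlist N ?inl ?len v)"
      using that nth_mem[of j "rowlist N ?inl ?len v"] by (simp add: nth_rowlist)
    then show "0 < al (cls (?inl (v * N + j)))"
      using rows that unfolding row_done_def by auto
  qed
  show ?thesis
    unfolding spread_code_def run_Seq run_Store
  \<comment> \<open>A state enters the queue at most once, so at most \<open>n\<close> removals
    occur, each scanning at most \<open>d\<close> cells.\<close>
  proof (rule run_mono, rule run_While[where I = "\<lambda>s'. s' ''hd'' 0 \<le> s' ''tl'' 0 \<and>
        ?inv (R (s' ''qu'' ` {..<s' ''hd'' 0}) 0 0) s'" and \<Phi> = "\<lambda>s'. (n - s' ''hd'' 0) * (d * 200 + 200)"], goal_cases)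
    case 1
    have "R {} 0 0 = low_tokens ?len d"
      by (auto simp: R_def)
    then show ?case
      using init by (simp add: spread_ok_def)
  next
    case (2 s1)
    note fr = frameD[OF 2(3), simplified push_code_def, simplified]
    let ?hd = "s1 ''hd'' 0" and ?v = "s1 ''qu'' (s1 ''hd'' 0)"
    let ?D = "s1 ''qu'' ` {..<?hd}"
    have hd: "?hd < s1 ''tl'' 0"
      using 2(2) by simp
    have inv: "?inv (R ?D 0 0) s1"
      using 2(1) by simp
    then have queue: "queue n (s1 ''y'') (s1 ''qu'') (s1 ''tl'' 0)"
      by (simp add: spread_ok_def)
    then have v: "?v < n" "s1 ''y'' ?v = 1"
      using hd unfolding queue_def by auto
    have tln: "s1 ''tl'' 0 \<le> n"
      using queue_le[OF queue] .
    have notin: "?v \<notin> ?D"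
    proof
      assume "?v \<in> ?D"
      then obtain i where i: "i < ?hd" "s1 ''qu'' i = ?v"
        by auto
      have "inj_on (s1 ''qu'') {..<s1 ''tl'' 0}"
        using queue by (simp add: queue_def)
      from inj_onD[OF this i(2)] show False
        using i(1) hd by simp
    qed
    have D_Suc: "s1 ''qu'' ` {..<Suc ?hd} = insert ?v ?D"
      by (auto simp: lessThan_Suc)
    let ?s = "s1(''v'' := (s1 ''v'')(0 := ?v), ''hd'' := (s1 ''hd'')(0 := Suc ?hd))"
    have eqs: "s1 ''len'' = ?len" "s1 ''inl'' = ?inl" "s1 ''d'' 0 = d" "\<And>w. w < n \<Longrightarrow> s1 ''rN'' w = w * N"
      "\<And>e. e < N \<Longrightarrow> s1 ''src'' e = e div k"
      using static d by (simp_all add: fr static_def)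
    have time: "n - ?hd = Suc (n - Suc ?hd)"
      using hd tln by simp
    show ?case
    proof (cases "d < ?len ?v")
      case True
      then have "R (insert ?v ?D) 0 0 = R ?D 0 0"
        by (auto simp: R_def low_tokens_def)
      then show ?thesis
        using True inv hd by (simp add: eqs D_Suc time spread_ok_def)
    next
      case False
      have inv0: "?inv (R ?D ?v 0) s1"
      proof -
        have "R ?D ?v 0 = R ?D 0 0"
          by (auto simp: R_def)
        then show ?thesis
          using inv by simp
      qed
      have body: "run spread_row_code ?s
         (\<lambda>t s'. s' ''hd'' 0 = Suc ?hd \<and> Suc ?hd \<le> s' ''tl'' 0 \<and>
            ?inv (R (s' ''qu'' ` {..<Suc ?hd}) 0 0) s' \<and> t \<le> d * 200 + 50)"
      unfolding spread_row_code_def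
      proof (rule run_mono, rule run_For0[where m = "?len ?v" and C = 150 and I =
            "\<lambda>j s'. s' ''y'' ?v = 1 \<and> Suc ?hd \<le> s' ''tl'' 0 \<and> s' ''qu'' ` {..<Suc ?hd} = insert ?v ?D \<and>
              ?inv (R ?D ?v j) s'"], goal_cases)
        case 1
        then show ?case
          using inv0 v hd D_Suc by (simp add: spread_ok_def)
      next
        case (4 j s2)
        note fr2 = frameD[OF 4(4), simplified push_code_def, simplified]
        let ?e = "?inl (?v * N + j)"
        have jd: "?v < n" "?len ?v \<le> d" "j < ?len ?v"
          using False 4(1) v by auto
        have e: "?e < N" "0 < al (cls ?e)"
          using entry[OF jd] by auto
        have p: "?e div k < n"
          using e(1) by (rule pair_div_less)
        have inv2: "?inv (R ?D ?v j) s2"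
          using 4(2) by simp
        have R: "R ?D ?v j = insert (?v, j) (R ?D ?v (Suc j))" "(?v, j) \<notin> R ?D ?v (Suc j)"
          using jd notin by (auto simp: R_def low_tokens_def)
        note tok = tokens_insert[OF fin R(2), folded R(1)]
        have eqs2: "s2 ''v'' 0 = ?v" "s2 ''j'' 0 = j" "s2 ''inl'' = ?inl" "s2 ''rN'' ?v = ?v * N"
          "s2 ''src'' ?e = ?e div k"
          using 4(3) v e eqs by (simp_all add: fr2)
        have cnt: "s2 ''cnt'' e' = tokens N ?inl (R ?D ?v j) e'" if "e' < N" for e'
          using inv2 that by (simp add: spread_ok_def)
        define cnt1 where "cnt1 = (s2 ''cnt'')(?e := s2 ''cnt'' ?e - 1)"
        have cnt': "\<forall>e<N. cnt1 e = tokens N ?inl (R ?D ?v (Suc j)) e"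
          by (auto simp: cnt1_def cnt tok)
        have closed1: "\<forall>e<N. 0 < al (cls e) \<longrightarrow> cnt1 e = 0 \<longrightarrow> e \<noteq> ?e \<longrightarrow> s2 ''y'' (e div k) = 1"
          using inv2 by (simp add: cnt1_def spread_ok_def)
        have inv2': "queue n (s2 ''y'') (s2 ''qu'') (s2 ''tl'' 0)"
          "\<forall>v<n. d < ?len v \<or> is_target al v \<longrightarrow> s2 ''y'' v = 1"
          "\<forall>T. trap st al T \<longrightarrow> (\<forall>v\<in>T. ?len v \<le> d) \<longrightarrow> (\<forall>v\<in>T. s2 ''y'' v \<noteq> 1)"
          using inv2 unfolding spread_ok_def by blast+
        show ?case
        proof (cases "cnt1 ?e = 0")
          case False
          have "?inv (R ?D ?v (Suc j)) (s2(''e'' := (s2 ''e'')(0 := ?e), ''cnt'' := cnt1))"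
          proof -
            have "s2 ''y'' (e div k) = 1" if "e < N" "0 < al (cls e)" "cnt1 e = 0" for e
              using closed1 that False by (cases "e = ?e") auto
            then show ?thesis
              unfolding spread_ok_def using inv2' cnt' by simp
          qed
          then show ?thesis
            using False 4(2,3) by (simp add: eqs2 spread_ok_def cnt1_def)
        next
          case True
          let ?s2 = "s2(''e'' := (s2 ''e'')(0 := ?e), ''cnt'' := cnt1, ''u'' := (s2 ''u'')(0 := ?e div k))"
          have "run push_code ?s2 (\<lambda>t s'. t \<le> 30 \<and> s' ''j'' 0 = j \<and> s' ''y'' ?v = 1 \<and> Suc ?hd \<le> s' ''tl'' 0 \<and>
            s' ''qu'' ` {..<Suc ?hd} = insert ?v ?D \<and> ?inv (R ?D ?v (Suc j)) s')"
          proof (rule run_mono, rule run_push[where n = n and u = "?e div k"], goal_cases)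
            case 1
            then show ?case
              using inv2 by (simp add: spread_ok_def)
          next
            case (4 t s3)
            then have y: "s3 ''y'' = (s2 ''y'')(?e div k := 1)" and qu: "\<forall>i<s2 ''tl'' 0. s3 ''qu'' i = s2 ''qu'' i"
              and tl: "s2 ''tl'' 0 \<le> s3 ''tl'' 0" and queue3: "queue n (s3 ''y'') (s3 ''qu'') (s3 ''tl'' 0)"
              and t: "t \<le> 30"
              by auto
            have "frame [''y'', ''qu'', ''tl''] ?s2 s3"
              using 4 by blast
            note fr3 = frameD[OF this, simplified]
            have eqs3: "s3 ''j'' = s2 ''j''" "s3 ''cnt'' = cnt1"
              by (simp_all add: fr3)
            have s2: "s2 ''y'' ?v = 1" "Suc ?hd \<le> s2 ''tl'' 0" "s2 ''qu'' ` {..<Suc ?hd} = insert ?v ?D"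
              using \<open>s2 ''y'' ?v = 1 \<and> _\<close> by auto
            have "s3 ''qu'' ` {..<Suc ?hd} = s2 ''qu'' ` {..<Suc ?hd}"
              using qu s2(2) by (intro image_cong) auto
            moreover have "\<forall>v\<in>T. s3 ''y'' v \<noteq> 1" if T: "trap st al T" "\<forall>v\<in>T. ?len v \<le> d" for T
            proof -
              have y2: "\<forall>v\<in>T. s2 ''y'' v \<noteq> 1"
                using inv2 T by (simp add: spread_ok_def)
              have "?e div k \<notin> T"
              proof
                assume "?e div k \<in> T"
                have sub: "s2 ''y'' w = 1" if "w \<in> insert ?v ?D" for w
                proof -
                  have "w \<in> s2 ''qu'' ` {..<Suc ?hd}"
                    using that s2(3) by blast
                  then have "w \<in> s2 ''qu'' ` {..<s2 ''tl'' 0}"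
                    using s2(2) by auto
                  then show ?thesis
                    using inv2 unfolding spread_ok_def queue_def by auto
                qed
                have "0 < tokens N ?inl (R ?D ?v (Suc j)) ?e"
                proof (rule trap_token[OF ok T y2 e \<open>?e div k \<in> T\<close> fin])
                  fix w i assume "w < n" "?len w \<le> d" "i < ?len w" "s2 ''y'' w \<noteq> 1"
                  moreover from this have "w \<notin> insert ?v ?D"
                    using sub by blast
                  ultimately show "(w, i) \<in> R ?D ?v (Suc j)"
                    by (simp add: R_def low_tokens_def)
                qed
                then show False
                  using cnt' e(1) True by simp
              qed
              then show ?thesis
                using y2 by (auto simp: y)
            qed
            moreover have "\<forall>e<N. 0 < al (cls e) \<longrightarrow> cnt1 e = 0 \<longrightarrow> s3 ''y'' (e div k) = 1"
              using closed1 unfolding y by (metis fun_upd_apply)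
            moreover have "\<forall>v<n. d < ?len v \<or> is_target al v \<longrightarrow> s3 ''y'' v = 1"
              using inv2'(2) by (simp add: y)
            ultimately have "?inv (R ?D ?v (Suc j)) s3"
              using queue3 cnt' unfolding spread_ok_def eqs3 by blast
            moreover have "s3 ''qu'' ` {..<Suc ?hd} = insert ?v ?D"
              using \<open>s3 ''qu'' ` _ = s2 ''qu'' ` _\<close> s2(3) by simp
            ultimately show ?case
              using t tl s2(1,2) eqs3(1) eqs2(2) by (simp add: y)
          qed (use p in simp_all)
          note pushed = this[unfolded cnt1_def]
          have "s2 ''cnt'' ?e \<le> 1"
            using True by (simp add: cnt1_def)
          then show ?thesis
            using pushed by (simp add: eqs2, elim run_mono) (auto simp: spread_ok_def)
        qed
      next
        case (5 t s2)
        then have "frame [''j'', ''e'', ''cnt'', ''u'', ''y'', ''qu'', ''tl''] ?s s2"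
          by (simp add: frame_def push_code_def)
        note fr2 = frameD[OF this, simplified]
        have "R ?D ?v (?len ?v) = R (insert ?v ?D) 0 0"
          by (auto simp: R_def low_tokens_def)
        moreover have "?len ?v * 162 \<le> d * 162"
          using False by simp
        ultimately show ?case
          using 5 by (simp add: fr2)
      qed (simp_all add: eqs push_code_def)
      then show ?thesis
        using False by (simp add: eqs, elim run_mono) (auto simp: time)
    qed
  next
    case (3 t s1)
    note fr = frameD[of _ _ s1, OF 3[THEN conjunct2, THEN conjunct2, THEN conjunct1], simplified push_code_def, simplified]
    have inv: "?inv (R (s1 ''qu'' ` {..<s1 ''tl'' 0}) 0 0) s1"
      using 3 by auto
    then have queue: "queue n (s1 ''y'') (s1 ''qu'') (s1 ''tl'' 0)"
      by (simp add: spread_ok_def)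
    then have D: "s1 ''qu'' ` {..<s1 ''tl'' 0} = {v. v < n \<and> s1 ''y'' v = 1}"
      by (simp add: queue_def)
    \<comment> \<open>The queue is exhausted: a live pair all of whose successors are marked has no
      cell left, so its count is 0 and its source is marked.\<close>
    have "closed al {v. v < n \<and> s1 ''y'' v = 1}"
      unfolding closed_def
    proof (intro conjI allI impI)
      fix e assume e: "e < N" "0 < al (cls e)" "\<forall>v<n. in_edge e v \<longrightarrow> v \<in> {v. v < n \<and> s1 ''y'' v = 1}"
      have "tokens N ?inl (R (s1 ''qu'' ` {..<s1 ''tl'' 0}) 0 0) e = 0"
      proof (rule tokens_zero)
        fix v j assume "(v, j) \<in> R (s1 ''qu'' ` {..<s1 ''tl'' 0}) 0 0"
        then have "v < n" "j < ?len v" "s1 ''y'' v \<noteq> 1"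
          unfolding D by (auto simp: R_def low_tokens_def)
        then show "?inl (v * N + j) \<noteq> e"
          using lists_ok_entry(2)[OF ok, of v j] e(3) by auto
      qed
      then have "s1 ''y'' (e div k) = 1"
        using inv e by (simp add: spread_ok_def)
      then show "e div k \<in> {v. v < n \<and> s1 ''y'' v = 1}"
        using pair_div_less[OF e(1)] by simp
    qed (use inv in \<open>auto simp: spread_ok_def\<close>)
    moreover have "n * (d * 200 + 200) \<ge> (n - (0::nat)) * (d * 200 + 200)"
      by simp
    ultimately show ?case
      using 3 inv unfolding spread_ok_def queue_def by simp
  qed
qed

end

definition pop_row_code :: com where
  "pop_row_code =
     While (Less (Const 0) (Load ''len'' (V ''v'')))
       (Seq (Store ''len'' (V ''v'') (Minus (Load ''len'' (V ''v'')) (Const 1)))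
         (Store ''al'' (Load ''cle'' (Load ''inl'' (Plus (Load ''rN'' (V ''v'')) (Load ''len'' (V ''v''))))) (Const 0)))"

lemma writes_pop_row [simp]: "writes pop_row_code = [''len'', ''al'']"
  by (simp add: pop_row_code_def)

text \<open>Every pair entering a dead state is killed together with its action on the whole class.
  The shrinking of the rows pays for the pops.\<close>

definition pop_code :: com where
  "pop_code = For ''v'' (V ''states'') (If (Less (Load ''st'' (Load ''rep'' (V ''v''))) (Const 1))
     pop_row_code
     Skip)"

text \<open>One unmarked member suffices to kill its class. After a removal the level returns to 1,
  since new traps with small in-degrees may have appeared.\<close>

definition kill_code :: com where
  "kill_code = Seq (Set ''ch'' (Const 0))
     (Seq (For ''v'' (V ''states'')
         (If (And (Less (Load ''y'' (V ''v'')) (Const 1)) (Less (Const 0) (Load ''st'' (Load ''rep'' (V ''v'')))))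
           (Seq (Store ''st'' (Load ''rep'' (V ''v'')) (Const 0)) (Set ''ch'' (Const 1))) Skip))
       (If (Less (Const 0) (V ''ch'')) (Seq pop_code (Set ''d'' (Const 1)))
         (Set ''d'' (Plus (V ''d'') (V ''d'')))))"

text \<open>The offset of the initial row is obtained by adding the number of moves
  \<open>init\<close> times. An action is bad if one of its first moves leads to a dead
  state.\<close>

definition final_code :: com where
  "final_code = Seq (Set ''x'' (Const 0))
     (Seq (For ''p'' (V ''init'') (Set ''x'' (Plus (V ''x'') (V ''moves''))))
       (Seq (For ''a'' (V ''actions'') (Store ''bad'' (V ''a'') (Const 0)))
         (Seq (For ''c'' (V ''moves'')
             (If (Less (Load ''st'' (Load ''rep'' (Load ''delta'' (Plus (V ''x'') (V ''c''))))) (Const 1))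
               (Store ''bad'' (Load ''act'' (V ''c'')) (Const 1)) Skip))
           (Seq (Set ''out'' (Const 0))
             (For ''a'' (V ''actions'') (If (Less (Load ''bad'' (V ''a'')) (Const 1)) (Set ''out'' (Const 1)) Skip))))))"

section \<open>Removing dead classes and reading off the answer\<close>

context class_arena
begin

lemma lists_ok_pop:
  assumes ok: "lists_ok al inl len" and i: "i < n" "len i = Suc l"
  defines "e \<equiv> inl (i * N + l)"
  shows "lists_ok (al(cls e := 0)) inl (len(i := l))"
  unfolding lists_ok_def
proof (intro allI impI)
  fix v assume v: "v < n"
  have ok_v: "row_ok al v (rowlist N inl len v)"
    using ok v by (simp add: lists_ok_def)
  show "row_ok (al(cls e := 0)) v (rowlist N inl (len(i := l)) v)"
  proof (cases "v = i")
    case True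
    have "rowlist N inl len i = rowlist N inl (len(i := l)) i @ [e]"
      by (simp add: rowlist_def i(2) e_def)
    then have "distinct (rowlist N inl (len(i := l)) i)"
      and set: "set (rowlist N inl len i) = insert e (set (rowlist N inl (len(i := l)) i))"
      using ok_v True by (simp_all add: row_ok_def)
    moreover have "x \<in> set (rowlist N inl (len(i := l)) i)"
      if x: "x < N" "in_edge x i" "0 < (al(cls e := 0)) (cls x)" for x
    proof -
      have "x \<noteq> e" "0 < al (cls x)"
        using x(3) by (auto split: if_splits)
      then have "x \<in> set (rowlist N inl len i)"
        using ok_v True x unfolding row_ok_def by blast
      then show ?thesis
        using set \<open>x \<noteq> e\<close> by blast
    qed
    ultimately show ?thesis
      using ok_v unfolding True row_ok_def set by blast
  next
    case False
    then have "rowlist N inl (len(i := l)) v = rowlist N inl len v"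
      by simp
    moreover have "{x. x < N \<and> in_edge x v \<and> 0 < (al(cls e := 0)) (cls x)} \<subseteq>
        {x. x < N \<and> in_edge x v \<and> 0 < al (cls x)}"
      by auto
    ultimately show ?thesis
      using ok_v unfolding row_ok_def by (metis (no_types, lifting) subset_trans)
  qed
qed

lemma run_pop:
  assumes static: "static s" and ok: "lists_ok al (s ''inl'') (s ''len'')" and al: "s ''al'' = al"
  shows "run pop_code s (\<lambda>t s'. lists_ok (s' ''al'') (s ''inl'') (s' ''len'') \<and> (\<forall>x. 0 < s' ''al'' x \<longrightarrow> 0 < al x) \<and>
     (\<forall>x<N. 0 < al x \<longrightarrow> s' ''al'' x = 0 \<longrightarrow> (\<exists>e<N. \<exists>v<n. cls e = x \<and> in_edge e v \<and> s ''st'' (rep v) = 0)) \<and>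
     (\<forall>v<n. s ''st'' (rep v) = 0 \<longrightarrow> s' ''len'' v = 0) \<and>
     t + 200 * len_sum (s' ''len'') \<le> 200 * len_sum (s ''len'') + n * 100 + 100)"
proof -
  let ?inl = "s ''inl''" and ?st = "s ''st''"
  let ?inv = "\<lambda>i s'. lists_ok (s' ''al'') ?inl (s' ''len'') \<and> (\<forall>x. 0 < s' ''al'' x \<longrightarrow> 0 < al x) \<and>
     (\<forall>x<N. 0 < al x \<longrightarrow> s' ''al'' x = 0 \<longrightarrow> (\<exists>e<N. \<exists>v<n. cls e = x \<and> in_edge e v \<and> ?st (rep v) = 0)) \<and>
     (\<forall>v<i. ?st (rep v) = 0 \<longrightarrow> s' ''len'' v = 0)"
  show ?thesis
    unfolding pop_code_def
  proof (rule run_mono, rule run_For[where m = n and C = 50 and \<Phi> = "\<lambda>s. 200 * len_sum (s ''len'')" and I = ?inv], goal_cases)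
    case (5 i s1)
    note fr = frameD[OF 5(4), simplified]
    have i: "i < n" "s1 ''v'' 0 = i" "s1 ''st'' = ?st" "s1 ''rep'' i = rep i" "s1 ''inl'' = ?inl" "s1 ''rN'' i = i * N"
      using 5 static by (simp_all add: fr static_def)
    have cle: "s1 ''cle'' e = cls e" if "e < N" for e
      using that static by (simp add: fr static_def)
    show ?case
    proof (cases "?st (rep i) = 0")
      case True
      have "run pop_row_code s1
        (\<lambda>t s'. ?inv (Suc i) s' \<and> s' ''v'' 0 = i \<and> t + 200 * len_sum (s' ''len'') \<le> 10 + 200 * len_sum (s1 ''len''))"
      unfolding pop_row_code_def
      proof (rule run_mono, rule run_While[where I = "?inv i" and \<Phi> = "\<lambda>s. 200 * len_sum (s ''len'')"], goal_cases)
        case 1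
        then show ?case
          using 5(2) .
      next
        case (2 s2)
        note fr2 = frameD[OF 2(3), simplified]
        have eqs: "s2 ''v'' 0 = i" "s2 ''inl'' = ?inl" "s2 ''rN'' i = i * N"
          using i by (simp_all add: fr2)
        obtain l where l: "s2 ''len'' i = Suc l"
          using 2(2) by (cases "s2 ''len'' i") (auto simp: eqs)
        let ?e = "?inl (i * N + l)" and ?al = "s2 ''al''"
        have ok2: "lists_ok ?al ?inl (s2 ''len'')"
          using 2(1) by blast
        have e: "?e < N" "in_edge ?e i"
          using lists_ok_entry[OF ok2 i(1), of l] l by auto
        have cle2: "s2 ''cle'' ?e = cls ?e"
          using cle[OF e(1)] by (simp add: fr2)
        have "\<forall>x<N. 0 < al x \<longrightarrow> (?al(cls ?e := 0)) x = 0 \<longrightarrow> (\<exists>e<N. \<exists>v<n. cls e = x \<and> in_edge e v \<and> ?st (rep v) = 0)"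
        proof (intro allI impI)
          fix x assume x: "x < N" "0 < al x" "(?al(cls ?e := 0)) x = 0"
          show "\<exists>e<N. \<exists>v<n. cls e = x \<and> in_edge e v \<and> ?st (rep v) = 0"
          proof (cases "x = cls ?e")
            case True
            then show ?thesis
              using e i(1) \<open>?st (rep i) = 0\<close> by blast
          next
            case False
            then show ?thesis
              using x 2(1) by simp
          qed
        qed
        moreover have "lists_ok (?al(cls ?e := 0)) ?inl ((s2 ''len'')(i := l))"
          by (rule lists_ok_pop[OF ok2 i(1) l])
        moreover have "len_sum ((s2 ''len'')(i := l)) + 1 = len_sum (s2 ''len'')"
          using len_sum_upd[OF i(1), of "s2 ''len''" l] l by simp
        moreover have "\<forall>x. 0 < (?al(cls ?e := 0)) x \<longrightarrow> 0 < al x" "\<forall>v<i. ?st (rep v) = 0 \<longrightarrow> ((s2 ''len'')(i := l)) v = 0"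
          using 2(1) by auto
        ultimately show ?case
          by (simp add: eqs l cle2)
      next
        case (3 t s2)
        then have "frame [''len'', ''al''] s1 s2"
          by simp
        note fr2 = frameD[OF this, simplified]
        show ?case
          using 3 i(2) by (auto simp: fr2 less_Suc_eq)
      qed
      then show ?thesis
        using True by (simp add: i, elim run_mono) auto
    next
      case False
      then show ?thesis
        using 5(2) by (auto simp: i less_Suc_eq)
    qed
  qed (use assms in \<open>auto simp: static_def\<close>)
qed

lemma run_kill:
  assumes static: "static s" and ok: "lists_ok al (s ''inl'') (s ''len'')" and al: "s ''al'' = al" and st: "s ''st'' = st"
    and y: "\<forall>v<n. s ''y'' v \<le> 1"
  defines "Y \<equiv> {v. v < n \<and> s ''y'' v = 1}"
  shows "run kill_code s (\<lambda>t s'. lists_ok (s' ''al'') (s ''inl'') (s' ''len'') \<and>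
     (if alive_states st \<subseteq> Y then s' ''st'' = st \<and> s' ''al'' = al \<and> s' ''d'' 0 = 2 * s ''d'' 0
      else killed st al Y (s' ''st'') (s' ''al'') \<and> s' ''d'' 0 = 1) \<and>
     t + 200 * len_sum (s' ''len'') \<le> 200 * len_sum (s ''len'') + n * 200 + 200)"
  unfolding kill_code_def run_Seq run_Store
proof (rule run_mono, rule run_For0[where m = n and C = 50 and I =
      "\<lambda>i s'. (\<forall>x. 0 < s' ''st'' x \<longleftrightarrow> 0 < st x \<and> \<not> (\<exists>q<i. rep q = x \<and> s ''y'' q = 0)) \<and>
        (s' ''ch'' 0 = 0 \<longrightarrow> s' ''st'' = st) \<and>
        (0 < s' ''ch'' 0 \<longleftrightarrow> (\<exists>q<i. s ''y'' q = 0 \<and> 0 < st (rep q)))"], goal_cases)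
  case (4 i s1)
  note fr = frameD[OF 4(4), simplified]
  have eqs: "s1 ''v'' 0 = i" "s1 ''y'' = s ''y''" "s1 ''rep'' i = rep i"
    using 4 static by (simp_all add: fr static_def)
  have st1: "0 < s1 ''st'' x \<longleftrightarrow> 0 < st x \<and> \<not> (\<exists>q<i. rep q = x \<and> s ''y'' q = 0)" for x
    using 4(2) by blast
  show ?case
  proof (cases "s ''y'' i = 0 \<and> 0 < s1 ''st'' (rep i)")
    case True
    then have "0 < st (rep i)"
      using st1 by blast
    then have "\<exists>q<Suc i. s ''y'' q = 0 \<and> 0 < st (rep q)"
      using True by blast
    moreover have "0 < (if x = rep i then 0 else s1 ''st'' x) \<longleftrightarrow> 0 < st x \<and> \<not> (\<exists>q<Suc i. rep q = x \<and> s ''y'' q = 0)" for x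
      using True st1[of x] by (auto simp: less_Suc_eq)
    ultimately show ?thesis
      using True by (simp add: eqs)
  next
    case False
    have "(\<exists>q<Suc i. s ''y'' q = 0 \<and> 0 < st (rep q)) \<longleftrightarrow> (\<exists>q<i. s ''y'' q = 0 \<and> 0 < st (rep q))"
      using False st1[of "rep i"] by (metis less_Suc_eq)
    moreover have "0 < st x \<and> \<not> (\<exists>q<Suc i. rep q = x \<and> s ''y'' q = 0) \<longleftrightarrow>
        0 < st x \<and> \<not> (\<exists>q<i. rep q = x \<and> s ''y'' q = 0)" for x
      using False st1[of x] by (metis less_Suc_eq)
    ultimately show ?thesis
      using False 4(2) by (simp add: eqs)
  qed
next
  case (5 t0 s1)
  then have fr0: "frame [''v'', ''st'', ''ch''] s s1"
    by (simp add: frame_def)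
  note fr = frameD[OF fr0, simplified]
  have Y: "q \<in> Y \<longleftrightarrow> s ''y'' q \<noteq> 0" if "q < n" for q
  proof -
    have "s ''y'' q \<le> 1"
      using y that by simp
    then show ?thesis
      using that by (cases "s ''y'' q") (auto simp: Y_def)
  qed
  have ch: "0 < s1 ''ch'' 0 \<longleftrightarrow> \<not> alive_states st \<subseteq> Y"
    using 5 Y by (auto simp: alive_states_def)
  have t0: "t0 \<le> n * 62 + 9"
    using 5 by simp
  have static1: "static s1"
    using static fr0 by (rule static_frame) simp
  show ?case
  proof (cases "alive_states st \<subseteq> Y")
    case True
    then show ?thesis
      using 5 ch ok t0 by (simp add: fr al)
  next
    case False
    have "run pop_code s1 (\<lambda>t s'. lists_ok (s' ''al'') (s ''inl'') (s' ''len'') \<and>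
      killed st al Y (s' ''st'') (s' ''al'') \<and>
      t + 200 * len_sum (s' ''len'') \<le> 200 * len_sum (s ''len'') + n * 100 + 100)"
    proof (rule run_mono, rule run_frame, rule run_pop[OF static1, of al], goal_cases)
      case (3 t s2)
      then have "frame [''v'', ''len'', ''al''] s1 s2"
        by (simp add: frame_def pop_code_def)
      note fr2 = frameD[OF this, simplified]
      note post = 3
      have st2: "0 < s1 ''st'' (rep p) \<longleftrightarrow> 0 < st (rep p) \<and> (\<forall>q<n. rep q = rep p \<longrightarrow> q \<in> Y)" for p
        using 5 Y by auto
      have dead: "v \<notin> alive_states (s1 ''st'') \<longleftrightarrow> s1 ''st'' (rep v) = 0" if "v < n" for v
        using that by (simp add: alive_states_def)
      \<comment> \<open>The row of a dead state is now empty, yet it must contain all live pairs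
        entering that state; so there are none.\<close>
      have "v \<in> alive_states (s1 ''st'')" if e: "e < N" "v < n" "in_edge e v" "0 < s2 ''al'' (cls e)" for e v
      proof (rule ccontr)
        assume "\<not> ?thesis"
        then have "s2 ''len'' v = 0"
          using dead post e by blast
        then have "rowlist N (s ''inl'') (s2 ''len'') v = []"
          by (simp add: rowlist_def)
        moreover have "row_ok (s2 ''al'') v (rowlist N (s ''inl'') (s2 ''len'') v)"
          using post e by (simp add: lists_ok_def fr)
        ultimately show False
          using e unfolding row_ok_def by auto
      qed
      moreover have "\<forall>x<N. 0 < al x \<longrightarrow> s2 ''al'' x = 0 \<longrightarrow>
          (\<exists>e<N. \<exists>v<n. cls e = x \<and> in_edge e v \<and> v \<notin> alive_states (s1 ''st''))"
        using post dead by blast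
      ultimately have "killed st al Y (s1 ''st'') (s2 ''al'')"
        unfolding killed_def using st2 post by blast
      then show ?case
        using post by (simp add: fr fr2)
    qed (use ok al in \<open>simp_all add: fr\<close>)
    then show ?thesis
      using False ch t0 by (simp, elim run_mono) auto
  qed
qed (use static st in \<open>simp_all add: static_def\<close>)

lemma run_final:
  assumes "s ''init'' 0 = p0" "s ''moves'' 0 = g" "s ''actions'' 0 = k" "p0 < n"
    and act: "\<forall>c<g. s ''act'' c < k" and rep: "\<forall>p<n. s ''rep'' p = rep p"
    and delta: "\<forall>c<g. s ''delta'' (p0 * g + c) < n" and st: "s ''st'' = st"
  shows "run final_code s (\<lambda>t s'. s' ''out'' 0 =
      (if \<exists>a<k. \<forall>c<g. s ''act'' c = a \<longrightarrow> s ''delta'' (p0 * g + c) \<in> alive_states st then 1 else 0) \<and>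
      t \<le> n * 100 + g * 100 + k * 100 + 100)"
  unfolding final_code_def run_Seq run_Store
proof (rule run_mono, rule run_For0[where m = p0 and C = 10 and I = "\<lambda>i s'. s' ''x'' 0 = i * g"], goal_cases)
  case (4 i s1)
  note fr = frameD[OF 4(4), simplified]
  show ?case
    using 4 assms by (simp add: fr)
next
  case (5 t1 s1)
  then have "frame [''p'', ''x''] s s1"
    by (simp add: frame_def)
  note fr1 = frameD[OF this, simplified]
  note post1 = 5
  show ?case
  proof (rule run_mono, rule run_For0[where m = k and C = 10 and I = "\<lambda>i s'. \<forall>a<i. s' ''bad'' a = 0"], goal_cases)
    case (4 i s2)
    then show ?case
      by (simp add: less_Suc_eq)
  next
    case (5 t2 s2)
    then have "frame [''a'', ''bad''] s1 s2"
      by (simp add: frame_def)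
    note fr2 = frameD[OF this, simplified]
    note post2 = 5
    let ?B = "\<lambda>i a. \<exists>c<i. s ''act'' c = a \<and> s ''delta'' (p0 * g + c) \<notin> alive_states st"
    show ?case
    proof (rule run_mono, rule run_For0[where m = g and C = 50 and I = "\<lambda>i s'. \<forall>a<k. 0 < s' ''bad'' a \<longleftrightarrow> ?B i a"], goal_cases)
      case (4 i s3)
      note fr3 = frameD[OF 4(4), simplified]
      have eqs: "s3 ''x'' 0 = p0 * g" "s3 ''c'' 0 = i" "s3 ''delta'' = s ''delta''" "s3 ''act'' = s ''act''"
        "s3 ''rep'' = s ''rep''" "s3 ''st'' = st"
        using 4 post1 st by (simp_all add: fr1 fr2 fr3)
      have d: "s ''delta'' (p0 * g + i) < n"
        using delta 4 by simp
      then have "s ''rep'' (s ''delta'' (p0 * g + i)) = rep (s ''delta'' (p0 * g + i))"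
        using rep by simp
      moreover have "s ''delta'' (p0 * g + i) \<in> alive_states st \<longleftrightarrow> st (rep (s ''delta'' (p0 * g + i))) \<noteq> 0"
        using d by (simp add: alive_states_def)
      ultimately show ?case
        using 4(2) by (auto simp: eqs less_Suc_eq)
    next
      case (5 t3 s3)
      then have "frame [''c'', ''bad''] s2 s3"
        by (simp add: frame_def)
      note fr3 = frameD[OF this, simplified]
      note post3 = 5
      show ?case
        unfolding run_Seq run_Store
      proof (rule run_mono, rule run_For0[where m = k and C = 20 and I = "\<lambda>i s'. s' ''out'' 0 = (if \<exists>a<i. \<not> ?B g a then 1 else 0)"], goal_cases)
        case (4 i s4)
        note fr4 = frameD[OF 4(4), simplified]
        have eqs: "s4 ''a'' 0 = i" "0 < s4 ''bad'' i \<longleftrightarrow> ?B g i"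
          using 4 post3 by (simp_all add: fr4)
        show ?case
        proof (cases "?B g i")
          case True
          then have "(\<exists>a<Suc i. \<not> ?B g a) \<longleftrightarrow> (\<exists>a<i. \<not> ?B g a)"
            by (metis less_Suc_eq)
          moreover have "s4 ''bad'' i \<noteq> 0"
            using True eqs by simp
          ultimately show ?thesis
            using 4(2) by (simp add: eqs(1))
        next
          case False
          then have "\<exists>a<Suc i. \<not> ?B g a"
            by blast
          moreover have "s4 ''bad'' i = 0"
            using False eqs(2) by (metis gr0I)
          ultimately show ?thesis
            by (simp add: eqs(1))
        qed
      next
        case (5 t4 s4)
        have "(\<exists>a<k. \<not> ?B g a) \<longleftrightarrow> (\<exists>a<k. \<forall>c<g. s ''act'' c = a \<longrightarrow> s ''delta'' (p0 * g + c) \<in> alive_states st)"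
          by blast
        moreover have "p0 * 22 \<le> n * 22"
          using \<open>p0 < n\<close> by simp
        ultimately show ?case
          using 5 post1 post2 post3 by simp
      qed (use assms in \<open>simp_all add: fr1 fr2 fr3\<close>)
    qed (use assms post2 in \<open>simp_all add: fr1 fr2\<close>)
  qed (use assms in \<open>simp_all add: fr1\<close>)
qed (use assms in simp_all)

end

section \<open>Amortised analysis of the rounds and the complete program\<close>

definition round_code :: com where
  "round_code = Seq compact_code (Seq count_code (Seq seed_code (Seq spread_code kill_code)))"

definition solve_code :: "bool \<Rightarrow> com" where
  "solve_code r = Seq rows_code (Seq table_code (Seq (edges_code r) (Seq lists_code (Seq rep_code (Seq cls_code
     (Seq (Set ''d'' (Const 1)) (Seq (Set ''lim'' (Plus (Plus (V ''N'') (V ''N'')) (Const 2)))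
       (Seq (While (Less (V ''d'') (V ''lim'')) round_code) final_code))))))))"

text \<open>The factor 4 comes from \<open>2 * d < 4 * (i + 1)\<close>: the deaths pay
  \<open>d\<close> for the successful round and \<open>d - 1\<close> for resetting the level to
  1.\<close>

lemma potential_drop:
  fixes a a' d i l :: nat
  assumes "a' + i + 1 \<le> a" "d < 2 * (i + 1)" "1 \<le> d" "d \<le> l"
  shows "4 * a' + (l - 1) + d \<le> 4 * a + (l - d)"
proof -
  obtain d' m where "d = Suc d'" "l = d + m"
    using assms(3,4) by (metis Suc_le_D One_nat_def le_iff_add)
  then show ?thesis
    using assms(1,2) by simp
qed

lemmas phase_defs = compact_code_def count_code_def seed_code_def spread_code_def kill_code_def pop_code_def push_code_def

context class_arena
begin

text \<open>A state of a low trap is neither high nor a live target, and each of its live pairs has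
  a low successor in the trap and hence a token. So none of the reasons for seeding applies.\<close>

lemma seed_spread_ok:
  assumes ok: "lists_ok al inl len" and queue: "queue n (s ''y'') (s ''qu'') (s ''tl'' 0)"
    and cnt: "\<forall>e<N. s ''cnt'' e = tokens N inl (low_tokens len d) e"
    and high: "\<forall>v<n. d < len v \<longrightarrow> s ''y'' v = 1"
    and pushed: "\<forall>e<N. 0 < al (cls e) \<longrightarrow> s ''cnt'' e = 0 \<or> target (e div k) \<longrightarrow> s ''y'' (e div k) = 1"
    and reason: "\<forall>v<n. s ''y'' v = 1 \<longrightarrow> d < len v \<or>
       (\<exists>e<N. e div k = v \<and> 0 < al (cls e) \<and> (s ''cnt'' e = 0 \<or> target v))"
  shows "spread_ok st al inl len d (low_tokens len d) s"
  unfolding spread_ok_def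
proof (intro conjI allI impI ballI queue)
  show "s ''cnt'' e = tokens N inl (low_tokens len d) e" if "e < N" for e
    using cnt that by blast
  show "s ''y'' (e div k) = 1" if "e < N" "0 < al (cls e)" "s ''cnt'' e = 0" for e
    using pushed that by blast
  show "s ''y'' v = 1" if v: "v < n" "d < len v \<or> is_target al v" for v
    using v(2)
  proof
    assume "is_target al v"
    then obtain a where "target v" "a < k" "0 < al (rep v * k + a)"
      by (auto simp: is_target_def)
    then show ?thesis
      using pushed pair_less[OF v(1), of a] by (metis cls_pair pair_div)
  qed (use high v in blast)
  show "s ''y'' v \<noteq> 1" if T: "trap st al T" "\<forall>v\<in>T. len v \<le> d" "v \<in> T" for T v
  proof
    assume "s ''y'' v = 1"
    moreover have "v < n" "\<not> d < len v" "\<not> is_target al v"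
      using T unfolding trap_def alive_states_def by auto
    ultimately obtain e where e: "e < N" "e div k = v" "0 < al (cls e)" "s ''cnt'' e = 0 \<or> target v"
      using reason by blast
    have "0 < al (rep v * k + e mod k)"
      using e by (simp add: cls_def)
    then have "\<not> target v"
      using \<open>\<not> is_target al v\<close> pair_mod_less unfolding is_target_def by blast
    moreover have "0 < tokens N inl (low_tokens len d) e"
      by (rule trap_token[OF ok T(1,2), of "\<lambda>_. 0"])
        (use e T(3) finite_low_tokens in \<open>auto simp: low_tokens_def\<close>)
    ultimately show False
      using e cnt by simp
  qed
qed

text \<open>In-degrees are at most \<open>N\<close>, so at a level of at least
  \<open>2 * N + 2\<close> the clause on traps in \<open>main_inv\<close> leaves no trap at
  all.\<close>

definition lim :: nat where "lim = N + N + 2"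

text \<open>The clause on traps records that half the level has failed; the added 1 makes it
  automatic at level 1. Levels may reach twice the limit because the last doubling starts below
  it.\<close>

definition main_inv :: "state \<Rightarrow> bool" where
  "main_inv s \<longleftrightarrow> static s \<and> s ''lim'' 0 = lim \<and> lists_ok (s ''al'') (s ''inl'') (s ''len'') \<and>
     invariant (s ''st'') (s ''al'') \<and> 1 \<le> s ''d'' 0 \<and> s ''d'' 0 \<le> 2 * lim \<and>
     (\<forall>T. trap (s ''st'') (s ''al'') T \<longrightarrow> T \<noteq> {} \<longrightarrow>
        (\<exists>v\<in>T. s ''d'' 0 < 2 * (indeg (s ''al'') v + 1)))"

text \<open>A round at level \<open>d\<close> costs \<open>O(N * d)\<close>. If it fails, \<open>d\<close> doubles; if it succeeds, more than
  \<open>d / 2\<close> state-action pairs and states die, since the previous level had failed.\<close>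

definition potential :: "state \<Rightarrow> nat" where
  "potential s = 3000 * N * (4 * alive_count (s ''st'') (s ''al'') + (2 * lim - s ''d'' 0)) +
     200 * len_sum (s ''len'')"

lemma run_round:
  assumes inv: "main_inv s" and less: "s ''d'' 0 < lim" and n: "0 < n"
  shows "run round_code s (\<lambda>t s'. main_inv s' \<and> 10 + t + potential s' \<le> potential s)"
proof -
  define d where "d = s ''d'' 0"
  let ?al = "s ''al''" and ?st = "s ''st''"
  have static: "static s" and ok: "lists_ok ?al (s ''inl'') (s ''len'')" and d: "s ''d'' 0 = d"
    and d1: "1 \<le> d" "d < lim" "s ''lim'' 0 = lim" and ainv: "invariant ?st ?al"
    and traps: "\<And>T. trap ?st ?al T \<Longrightarrow> T \<noteq> {} \<Longrightarrow> \<exists>v\<in>T. d < 2 * (indeg ?al v + 1)"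
    using inv less unfolding main_inv_def d_def by auto
  \<comment> \<open>The coefficients collect the bounds of the five phases. With
    \<open>1 \<le> n\<close>, \<open>n \<le> N\<close> and \<open>1 \<le> d\<close> every term is at
    most a multiple of \<open>N * d\<close>, and the coefficients add up to 2950.\<close>
  have cost: "n * (500 * d) + n * 1500 + N * 250 + 700 \<le> 3000 * N * d"
  proof -
    have "n * 1 \<le> n * k"
      using k_pos by (intro mult_le_mono2) simp
    then have "n \<le> N"
      by (simp add: N_def)
    moreover have "N \<le> N * d"
      using d1 by simp
    moreover have "n * d \<le> N * d"
      using \<open>n \<le> N\<close> by simp
    moreover have "n * (500 * d) = 500 * (n * d)" "3000 * N * d = 3000 * (N * d)"
      by simp_all
    ultimately show ?thesis
      using n by linarith
  qed
  show ?thesis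
    unfolding round_code_def run_Seq
  proof (rule run_mono, rule run_frame, rule run_compact[OF static ok d], goal_cases)
    case (1 t1 s1)
    then have "frame [''v'', ''y'', ''j'', ''len'', ''inl''] s s1"
      by (simp add: frame_def phase_defs)
    note static1 = static_frame[OF static this, simplified] and fr1 = frameD[OF this, simplified]
    let ?len = "s1 ''len''" and ?inl = "s1 ''inl''"
    have ok1: "lists_ok ?al ?inl ?len" and y1: "\<forall>v<n. s1 ''y'' v = 0"
      and rows: "\<forall>v<n. row_done ?al d v (rowlist N ?inl ?len v)"
      and t1: "t1 + 200 * len_sum ?len \<le> 200 * len_sum (s ''len'') + n * (200 * d + 500) + 100"
      using 1 by auto
    have d_1: "s1 ''d'' 0 = d"
      by (simp add: fr1 d)
    show ?case
    proof (rule run_mono, rule run_frame, rule run_count[OF static1 ok1 d_1], goal_cases)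
      case (1 t2 s2)
      then have "frame [''e'', ''cnt'', ''v'', ''j''] s1 s2"
        by (simp add: frame_def phase_defs)
      note static2 = static_frame[OF static1 this, simplified] and fr2 = frameD[OF this, simplified]
      have cnt: "\<forall>e<N. s2 ''cnt'' e = tokens N ?inl (low_tokens ?len d) e"
        and t2: "t2 \<le> N * 100 + n * (100 * d + 100) + 100"
        using 1 by auto
      have d_2: "s2 ''d'' 0 = d" and y2: "\<forall>v<n. s2 ''y'' v = 0"
        using d_1 y1 by (simp_all add: fr2)
      show ?case
      proof (rule run_mono, rule run_frame, rule run_seed[OF static2 d_2 y2], goal_cases)
        case (1 t3 s3)
        then have "frame [''tl'', ''v'', ''u'', ''y'', ''qu'', ''e''] s2 s3"
          by (simp add: frame_def phase_defs)
        note static3 = static_frame[OF static2 this, simplified] and fr3 = frameD[OF this, simplified]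
        have eqs3: "s3 ''cnt'' = s2 ''cnt''" "s2 ''len'' = ?len" "s2 ''inl'' = ?inl" "s2 ''al'' = ?al"
          "s3 ''len'' = ?len" "s3 ''inl'' = ?inl" "s3 ''d'' 0 = d"
          using d_2 by (simp_all add: fr1 fr2 fr3)
        have t3: "t3 \<le> N * 150 + n * 150 + 100"
          using 1 by auto
        have "spread_ok ?st ?al ?inl ?len d (low_tokens ?len d) s3"
          by (rule seed_spread_ok[OF ok1]) (use 1 cnt in \<open>simp_all add: eqs3\<close>)
        then have sp: "spread_ok ?st ?al (s3 ''inl'') (s3 ''len'') d (low_tokens (s3 ''len'') d) s3"
          by (simp add: eqs3)
        have ok3: "lists_ok ?al (s3 ''inl'') (s3 ''len'')"
          and rows3: "\<forall>v<n. row_done ?al d v (rowlist N (s3 ''inl'') (s3 ''len'') v)"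
          using ok1 rows by (simp_all add: eqs3)
        show ?case
        proof (rule run_mono, rule run_frame, rule run_spread[OF static3 ok3 eqs3(7) rows3 sp], goal_cases)
          case (1 t4 s4)
          then have "frame [''hd'', ''v'', ''j'', ''e'', ''cnt'', ''u'', ''y'', ''qu'', ''tl''] s3 s4"
            by (simp add: frame_def phase_defs)
          note static4 = static_frame[OF static3 this, simplified] and fr4 = frameD[OF this, simplified]
          let ?Y = "{v. v < n \<and> s4 ''y'' v = 1}"
          have y4: "\<forall>v<n. s4 ''y'' v \<le> 1" and closed: "closed ?al ?Y"
            and low: "\<And>T. trap ?st ?al T \<Longrightarrow> \<forall>v\<in>T. ?len v \<le> d \<Longrightarrow> \<forall>v\<in>T. s4 ''y'' v \<noteq> 1"
            and t4: "t4 \<le> n * (d * 200 + 200) + 100"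
            using 1 by (auto simp: eqs3)
          have eqs4: "s4 ''len'' = ?len" "s4 ''inl'' = ?inl" "s4 ''al'' = ?al" "s4 ''st'' = ?st" "s4 ''d'' 0 = d"
            "s4 ''lim'' 0 = lim"
            using eqs3 d1 by (simp_all add: fr1 fr2 fr3 fr4)
          have ok4: "lists_ok ?al (s4 ''inl'') (s4 ''len'')"
            using ok1 by (simp add: eqs4)
          show ?case
          proof (rule run_mono, rule run_frame, rule run_kill[OF static4 ok4 eqs4(3,4) y4], goal_cases)
            case (1 t5 s5)
            then have "frame [''ch'', ''v'', ''st'', ''len'', ''al'', ''d''] s4 s5"
              by (simp add: frame_def phase_defs)
            note static5 = static_frame[OF static4 this, simplified] and fr5 = frameD[OF this, simplified]
            have ok5: "lists_ok (s5 ''al'') (s5 ''inl'') (s5 ''len'')" and lim5: "s5 ''lim'' 0 = lim"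
              using 1 eqs4 by (simp_all add: fr5)
            have t5: "t5 + 200 * len_sum (s5 ''len'') \<le> 200 * len_sum ?len + n * 200 + 200"
              using 1 eqs4 by simp
            have total: "10 + (t1 + (t2 + (t3 + (t4 + t5)))) + 200 * len_sum (s5 ''len'') \<le>
                200 * len_sum (s ''len'') + 3000 * N * d"
              using t1 t2 t3 t4 t5 cost by (simp add: algebra_simps)
            show ?case
            proof (cases "alive_states ?st \<subseteq> ?Y")
              case True
              then have eqs5: "s5 ''st'' = ?st" "s5 ''al'' = ?al" "s5 ''d'' 0 = 2 * d"
                using 1 eqs4 by simp_all
              \<comment> \<open>All alive states were marked, so a trap cannot consist of low states
                only; its long row certifies more than \<open>d\<close> live incoming pairs.\<close>
              have "\<exists>v\<in>T. 2 * d < 2 * (indeg ?al v + 1)" if T: "trap ?st ?al T" "T \<noteq> {}" for T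
              proof -
                have sub: "T \<subseteq> alive_states ?st"
                  using T by (simp add: trap_def)
                then have "\<not> (\<forall>v\<in>T. s4 ''y'' v \<noteq> 1)"
                  using T True by blast
                then obtain v where v: "v \<in> T" "d < ?len v"
                  using low[OF T(1)] not_less by blast
                then have "v < n"
                  using sub by (auto simp: alive_states_def)
                then have "d < indeg ?al v"
                  using rows v unfolding row_done_def by force
                then show ?thesis
                  using v by force
              qed
              then have "main_inv s5"
                using static5 lim5 ok5 ainv d1 eqs5 unfolding main_inv_def by simp
              moreover have "3000 * N * (4 * alive_count ?st ?al + (2 * lim - 2 * d)) + 3000 * N * d \<le>
                  3000 * N * (4 * alive_count ?st ?al + (2 * lim - d))"
                unfolding add_mult_distrib2[symmetric] using d1 by (intro mult_le_mono2) simp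
              ultimately show ?thesis
                using total eqs5 d by (simp add: potential_def)
            next
              case False
              then have killed: "killed ?st ?al ?Y (s5 ''st'') (s5 ''al'')" and d5: "s5 ''d'' 0 = 1"
                using 1 eqs4 by simp_all
              have main5: "main_inv s5"
                using static5 lim5 ok5 killed_invariant[OF ainv closed killed] d1 d5
                unfolding main_inv_def by auto
              \<comment> \<open>The unmarked alive states form a nonempty trap, to which the clause
                inherited from the previous level applies.\<close>
              obtain v where v: "v \<in> alive_states ?st" "v \<notin> ?Y" "d < 2 * (indeg ?al v + 1)"
                using traps[OF complement_trap[OF ainv closed]] False by blast
              have "alive_count (s5 ''st'') (s5 ''al'') + indeg ?al v + 1 \<le> alive_count ?st ?al"
                by (rule killed_count[OF killed v(1,2)])
              from potential_drop[OF this v(3) d1(1), of "2 * lim"]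
              have "4 * alive_count (s5 ''st'') (s5 ''al'') + (2 * lim - 1) + d \<le>
                  4 * alive_count ?st ?al + (2 * lim - d)"
                using d1 by simp
              then have "3000 * N * (4 * alive_count (s5 ''st'') (s5 ''al'') + (2 * lim - 1)) + 3000 * N * d \<le>
                  3000 * N * (4 * alive_count ?st ?al + (2 * lim - d))"
                unfolding add_mult_distrib2[symmetric] by (rule mult_le_mono2)
              with main5 show ?thesis
                using total d5 d by (simp add: potential_def)
            qed
          qed
        qed
      qed
    qed
  qed
qed

text \<open>With \<open>1 \<le> n\<close> and \<open>n \<le> N\<close> the bracket in the potential
  is at most \<open>4 * (N + n) + 2 * lim \<le> 16 * N\<close>, whence 48000.\<close>

lemma potential_le:
  assumes inv: "main_inv s" and n: "0 < n"
  shows "potential s \<le> 48000 * (N * N) + 200 * (n * N)"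
proof -
  have "n * 1 \<le> n * k"
    using k_pos by (intro mult_le_mono2) simp
  then have nN: "n \<le> N"
    by (simp add: N_def)
  have "4 * alive_count (s ''st'') (s ''al'') + (2 * lim - s ''d'' 0) \<le> 4 * (N + n) + 2 * lim"
    using alive_count_le[of "s ''st''" "s ''al''"] by simp
  also have "\<dots> \<le> 16 * N"
    using nN n by (simp add: lim_def)
  finally have "3000 * N * (4 * alive_count (s ''st'') (s ''al'') + (2 * lim - s ''d'' 0)) \<le> 3000 * N * (16 * N)"
    by (rule mult_le_mono2)
  moreover have "len_sum (s ''len'') \<le> n * N"
  proof -
    have "lists_ok (s ''al'') (s ''inl'') (s ''len'')"
      using inv by (simp add: main_inv_def)
    then have "len_sum (s ''len'') \<le> (\<Sum>v<n. N)"
      unfolding len_sum_def by (intro sum_mono lists_ok_len) auto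
    then show ?thesis
      by simp
  qed
  moreover have "3000 * N * (16 * N) = 48000 * (N * N)"
    by simp
  ultimately show ?thesis
    unfolding potential_def by linarith
qed

lemma run_rounds:
  assumes inv: "main_inv s" and n: "0 < n"
  shows "run (While (Less (V ''d'') (V ''lim'')) round_code) s
    (\<lambda>t s'. winning = alive_states (s' ''st'') \<and> t \<le> 10 + potential s)"
proof (rule run_mono, rule run_While[where I = main_inv and \<Phi> = potential, OF inv], goal_cases)
  case (1 s1)
  have "s1 ''d'' 0 < lim"
    using 1(1,2) by (simp add: main_inv_def)
  from run_round[OF 1(1) this n] show ?case
    by (rule run_mono) simp
next
  case (2 t s1)
  have inv1: "main_inv s1"
    using 2 by blast
  then have "s1 ''lim'' 0 = lim"
    by (simp add: main_inv_def)
  then have ge: "lim \<le> s1 ''d'' 0"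
    using 2 by simp
  have "T = {}" if T: "trap (s1 ''st'') (s1 ''al'') T" for T
  proof (rule ccontr)
    assume "T \<noteq> {}"
    then obtain v where "s1 ''d'' 0 < 2 * (indeg (s1 ''al'') v + 1)"
      using inv1 T unfolding main_inv_def by blast
    then show False
      using ge indeg_le[of "s1 ''al''" v] by (simp add: lim_def)
  qed
  then have "winning = alive_states (s1 ''st'')"
    using inv1 by (intro no_trap_winning) (auto simp: main_inv_def)
  then show ?case
    using 2 by simp
qed

end

text \<open>Formulated with an abstract equivalence \<open>E\<close>, because class representatives
  exist only once \<open>rep_code\<close> has run; the locale \<open>class_arena\<close> is
  interpreted at that point of the execution.\<close>

lemma run_solve:
  assumes input: "s ''states'' 0 = n" "s ''moves'' 0 = g" "s ''actions'' 0 = k" "s ''init'' 0 = p0" "p0 < n"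
    and k: "0 < k" and g: "0 < g"
    and delta: "\<forall>p<n. \<forall>c<g. s ''delta'' (p * g + c) < n" and act: "\<forall>c<g. s ''act'' c < k"
    and info: "\<forall>p<n. \<forall>q<n. 0 < s ''info'' (p * n + q) \<longleftrightarrow> E p q"
    and refl: "\<And>p. p < n \<Longrightarrow> E p p" and sym: "\<And>p q. E p q \<Longrightarrow> E q p"
    and trans: "\<And>p q u. E p q \<Longrightarrow> E q u \<Longrightarrow> E p u" and bound: "\<And>p q. E p q \<Longrightarrow> p < n"
    and color: "\<forall>p<n. 0 < s ''color'' p \<longleftrightarrow> target p"
    and edge: "\<And>p a q. p < n \<Longrightarrow> edge p a q \<longleftrightarrow> \<not> (r \<and> target p) \<and> (\<exists>c<g. s ''act'' c = a \<and> q = s ''delta'' (p * g + c))"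
  shows "run (solve_code r) s (\<lambda>t s'. s' ''out'' 0 =
      (if \<exists>a<k. \<forall>c<g. s ''act'' c = a \<longrightarrow> s ''delta'' (p0 * g + c) \<in> arena.winning n k edge target E then 1 else 0) \<and>
      t \<le> 100000 * k * k * (n ^ 2 + n * g))"
proof -
  define M where "M = n * k"
  show ?thesis
    unfolding solve_code_def run_Seq run_Store
  proof (rule run_mono, rule run_frame, rule run_rows[where s = s, OF input(1,3)], goal_cases)
    case (1 t1 s1)
    then have "frame [''N'', ''p'', ''rk'', ''a'', ''src'', ''al''] s s1"
      by (simp add: frame_def rows_code_def)
    note fr1 = frameD[OF this, simplified]
    have s1: "s1 ''N'' 0 = M" "\<forall>p<n. s1 ''rk'' p = p * k" "\<forall>e<M. s1 ''src'' e = e div k" "\<forall>e<M. s1 ''al'' e = 1"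
      and t1: "t1 \<le> n * (k * 100 + 100) + 100"
      using 1 by (auto simp: M_def)
    have in1: "s1 ''states'' 0 = n"
      using input by (simp add: fr1)
    show ?case
    proof (rule run_mono, rule run_frame, rule run_table[where s = s1, OF in1 s1(1)], goal_cases)
      case (1 t2 s2)
      then have "frame [''x'', ''v'', ''rN'', ''len'', ''st'', ''e'', ''m''] s1 s2"
        by (simp add: frame_def table_code_def)
      note fr2 = frameD[OF this, simplified]
      have s2: "\<forall>v<n. s2 ''rN'' v = v * M" "\<forall>v<n. s2 ''len'' v = 0" "\<forall>v<n. s2 ''st'' v = 1" "\<forall>y<n * M. s2 ''m'' y = 0"
        and t2: "t2 \<le> n * (M * 100 + 100) + 100"
        using 1 by auto
      have in2: "s2 ''states'' 0 = n" "s2 ''moves'' 0 = g" "M = n * k" "\<forall>v<n. s2 ''rN'' v = v * M"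
        "\<forall>p<n. s2 ''rk'' p = p * k" "\<forall>p<n. \<forall>c<g. s2 ''delta'' (p * g + c) < n" "\<forall>c<g. s2 ''act'' c < k"
        "\<forall>y<n * M. s2 ''m'' y = 0"
        using input s1 s2 delta act by (simp_all add: fr1 fr2 M_def)
      show ?case
      proof (rule run_mono, rule run_frame, rule run_edges[where s = s2 and r = r, OF in2], goal_cases)
        case (1 t3 s3)
        then have "frame [''x'', ''p'', ''c'', ''m''] s2 s3"
          by (simp add: frame_def edges_code_def)
        note fr3 = frameD[OF this, simplified]
        have t3: "t3 \<le> n * (g * 100 + 100) + 100"
          using 1 by auto
        have eqs: "s2 ''color'' = s ''color''" "s2 ''delta'' = s ''delta''" "s2 ''act'' = s ''act''"
          by (simp_all add: fr1 fr2)
        have m3: "0 < s3 ''m'' (v * M + e) \<longleftrightarrow> edge (e div k) (e mod k) v" if "v < n" "e < M" for v e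
        proof -
          have p: "e div k < n"
            using that by (simp add: M_def less_mult_imp_div_less)
          have "0 < s3 ''m'' (v * M + e) \<longleftrightarrow> (\<exists>p c. p < n \<and> c < g \<and> \<not> (r \<and> 0 < s ''color'' p) \<and>
              s ''delta'' (p * g + c) = v \<and> p * k + s ''act'' c = e)"
            using 1[THEN conjunct1, THEN conjunct1, unfolded eqs, rule_format, OF that] .
          also have "\<dots> \<longleftrightarrow> (\<exists>p c. p < n \<and> c < g \<and> \<not> (r \<and> target p) \<and> s ''delta'' (p * g + c) = v \<and>
              p = e div k \<and> s ''act'' c = e mod k)"
          proof -
            \<comment> \<open>Since actions are below \<open>k\<close>, the number of a pair
              determines its state and its action.\<close>
            have dec: "p * k + s ''act'' c = e \<longleftrightarrow> p = e div k \<and> s ''act'' c = e mod k" if "c < g" for p c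
            proof -
              have "s ''act'' c < k"
                using act that by blast
              then show ?thesis
                by auto
            qed
            have "p < n \<and> c < g \<and> \<not> (r \<and> 0 < s ''color'' p) \<and> s ''delta'' (p * g + c) = v \<and>
                p * k + s ''act'' c = e \<longleftrightarrow>
              p < n \<and> c < g \<and> \<not> (r \<and> target p) \<and> s ''delta'' (p * g + c) = v \<and>
                p = e div k \<and> s ''act'' c = e mod k" for p c
            proof (cases "p < n \<and> c < g")
              case True
              then show ?thesis
                using color dec[of c p] by simp
            qed auto
            note eq = this
            show ?thesis
              by (rule ex_cong1)+ (rule eq)
          qed
          also have "\<dots> \<longleftrightarrow> edge (e div k) (e mod k) v"
            unfolding edge[OF p] using p by blast
          finally show ?thesis .
        qed
        have in3: "s3 ''states'' 0 = n" "s3 ''N'' 0 = M" "\<forall>v<n. s3 ''rN'' v = v * M" "\<forall>v<n. s3 ''len'' v = 0"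
          using in2 s1 s2 by (simp_all add: fr2 fr3)
        show ?case
        proof (rule run_mono, rule run_frame, rule run_lists[where s = s3, OF in3], goal_cases)
          case (1 t4 s4)
          then have "frame [''v'', ''e'', ''inl'', ''len''] s3 s4"
            by (simp add: frame_def lists_code_def)
          note fr4 = frameD[OF this, simplified]
          have t4: "t4 \<le> n * (M * 100 + 100) + 100"
            using 1 by auto
          have lists: "rowlist M (s4 ''inl'') (s4 ''len'') v = filter (\<lambda>e. edge (e div k) (e mod k) v) [0..<M]"
            if "v < n" for v
            using 1 that m3 by (auto intro: filter_cong)
          have in4: "s4 ''states'' 0 = n" "\<forall>p<n. \<forall>q<n. 0 < s4 ''info'' (p * n + q) \<longleftrightarrow> E p q"
            using in3 info by (simp_all add: fr1 fr2 fr3 fr4)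
          show ?case
          proof (rule run_mono, rule run_frame, rule run_rep[where s = s4 and n = n and E = E], goal_cases)
            case (7 t5 s5)
            then have "frame [''x'', ''p'', ''q'', ''rep''] s4 s5"
              by (simp add: frame_def rep_code_def)
            note fr5 = frameD[OF this, simplified]
            let ?rep = "s5 ''rep''"
            have rep: "\<forall>p<n. ?rep p < n" "\<And>p q. E p q \<longleftrightarrow> p < n \<and> q < n \<and> ?rep p = ?rep q"
              and t5: "t5 \<le> n * (n * 100 + 100) + 100"
              using 7 by auto
            interpret class_arena n k edge target E ?rep
            proof
              show "a < k \<and> q < n" if "p < n" "edge p a q" for p a q
                using that edge[OF that(1)] act delta by auto
            qed (use rep k in auto)
            have NM: "N = M"
              by (simp add: N_def M_def)
            have in5: "s5 ''N'' 0 = n * k" "\<forall>p<n. s5 ''rk'' p = p * k" "\<forall>e<n * k. s5 ''src'' e = e div k"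
              "\<forall>p<n. s5 ''rep'' p < n"
              using rep s1 by (simp_all add: fr2 fr3 fr4 fr5 M_def)
            show ?case
            proof (rule run_mono, rule run_frame, rule run_cls[where s = s5, OF in5], goal_cases)
              case (1 t6 s6)
              then have "frame [''e'', ''cle''] s5 s6"
                by (simp add: frame_def cls_code_def)
              note fr6 = frameD[OF this, simplified]
              have cle: "\<forall>e<M. s6 ''cle'' e = cls e" and t6: "t6 \<le> M * 100 + 100"
                using 1 by (auto simp: cls_def M_def)
              note fr = fr1 fr2 fr3 fr4 fr5 fr6
              let ?s = "s6(''d'' := (s6 ''d'')(aval (Const 0) s6 := aval (Const 1) s6))"
              let ?s = "?s(''lim'' := (?s ''lim'')(aval (Const 0) ?s := aval (Plus (Plus (V ''N'') (V ''N'')) (Const 2)) ?s))"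
              have s: "?s = s6(''d'' := (s6 ''d'')(0 := 1), ''lim'' := (s6 ''lim'')(0 := lim))"
                using s1(1) by (simp add: lim_def fr NM)
              have inN: "s6 ''N'' 0 = M" "s6 ''rN'' = s2 ''rN''" "s6 ''src'' = s1 ''src''" "s6 ''rep'' = ?rep"
                "s6 ''color'' = s ''color''" "s6 ''states'' = s ''states''" "s6 ''al'' = s1 ''al''" "s6 ''st'' = s2 ''st''"
                "s6 ''inl'' = s4 ''inl''" "s6 ''len'' = s4 ''len''"
                using s1 by (simp_all add: fr)
              have static: "static ?s"
                unfolding s static_def NM using input s1 s2 cle color by (simp add: inN)
              have al: "s1 ''al'' (cls e) = 1" if "e < M" for e
                using s1(4) cls_less[of e] that by (simp add: NM)
              have "row_ok (s1 ''al'') v (rowlist M (s4 ''inl'') (s4 ''len'') v)" if "v < n" for v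
                unfolding lists[OF that] row_ok_def in_edge_def NM by auto
              then have ok: "lists_ok (s1 ''al'') (s4 ''inl'') (s4 ''len'')"
                by (simp add: lists_ok_def NM)
              have inv: "invariant (s2 ''st'') (s1 ''al'')"
                unfolding invariant_def
              proof (intro conjI ballI allI impI)
                have alive: "alive_states (s2 ''st'') = {..<n}"
                  using s2(3) rep by (auto simp: alive_states_def)
                show "winning \<subseteq> alive_states (s2 ''st'')"
                  unfolding alive using winning_less by blast
                show "0 < s1 ''al'' (?rep p * k + a)" if "p \<in> winning" "a < k" for p a
                  using s1(4) pair_less[of "?rep p" a] rep winning_less that by (simp add: NM)
                show "v \<in> alive_states (s2 ''st'')" if "e < N" "in_edge e v" for e v
                  unfolding alive using that edge_bound pair_div_less unfolding in_edge_def by blast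
              qed
              have main: "main_inv ?s"
                using static ok inv unfolding s main_inv_def by (auto simp: inN lim_def)
              have n: "0 < n"
                using \<open>p0 < n\<close> by simp
              show ?case
                unfolding run_Store run_Seq
              proof (rule run_mono, rule run_frame, rule run_rounds[OF main n], goal_cases)
                case (1 t7 s7)
                let ?W = "[''v'', ''y'', ''j'', ''len'', ''inl'', ''e'', ''cnt'', ''tl'', ''u'', ''qu'', ''hd'', ''ch'', ''st'', ''al'', ''d'']"
                from 1 have "frame ?W ?s s7"
                  by (simp add: frame_def phase_defs round_code_def)
                note fr7 = frameD[OF this, simplified]
                have win: "winning = alive_states (s7 ''st'')" and t7: "t7 \<le> 10 + potential ?s"
                  using 1 by auto
                have in7: "s7 ''init'' 0 = p0" "s7 ''moves'' 0 = g" "s7 ''actions'' 0 = k" "p0 < n"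
                  "\<forall>c<g. s7 ''act'' c < k" "\<forall>p<n. s7 ''rep'' p = ?rep p" "\<forall>c<g. s7 ''delta'' (p0 * g + c) < n"
                  using input act delta by (simp_all add: fr7 fr)
                have eqs7: "s7 ''act'' = s ''act''" "s7 ''delta'' = s ''delta''"
                  by (simp_all add: fr7 fr)
                show ?case
                proof (rule run_mono, rule run_final[where s = s7, OF in7 HOL.refl], goal_cases)
                  case (1 t8 s8)
                  then have t8: "t8 \<le> n * 100 + g * 100 + k * 100 + 100" by blast
                  have time: "t1 + (t2 + (t3 + (t4 + (t5 + (t6 + (3 + (9 + (t7 + t8)))))))) \<le> 100000 * k * k * (n ^ 2 + n * g)"
                  proof -
                    \<comment> \<open>\<open>A\<close> dominates every term in \<open>n\<close> and
                      \<open>k\<close>, including the potential, and \<open>B\<close> the reading of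
                      the transition table; the bound in the claim is exactly
                      \<open>100000 * A + 100000 * B\<close>.\<close>
                    define A B where "A = (n * k) * (n * k)" and "B = (k * k) * (n * g)"
                    have goal: "100000 * k * k * (n ^ 2 + n * g) = 100000 * A + 100000 * B"
                      by (simp add: A_def B_def power2_eq_square algebra_simps)
                    have "1 \<le> n * k"
                      using n k by simp
                    have A1: "n * k \<le> A"
                      unfolding A_def using \<open>1 \<le> n * k\<close> by simp
                    have A2: "n \<le> n * k" "k \<le> n * k"
                      using n k by simp_all
                    have A3: "n * n \<le> A" "n * (n * k) \<le> A"
                      unfolding A_def using A2 by (intro mult_le_mono; simp)+
                    have "1 * (n * g) \<le> k * k * (n * g)"
                      using k by (intro mult_le_mono1) simp
                    then have B1: "n * g \<le> B"
                      by (simp add: B_def)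
                    have B2: "g \<le> n * g"
                      using n by simp
                    have pot: "t7 \<le> 10 + (48000 * A + 200 * (n * (n * k)))"
                      using t7 potential_le[OF main n] by (simp add: NM M_def A_def)
                    have "t1 \<le> 100 * (n * k) + 100 * n + 100" "t2 \<le> 100 * (n * (n * k)) + 100 * n + 100"
                      "t3 \<le> 100 * (n * g) + 100 * n + 100" "t4 \<le> 100 * (n * (n * k)) + 100 * n + 100"
                      "t5 \<le> 100 * (n * n) + 100 * n + 100" "t6 \<le> 100 * (n * k) + 100"
                      using t1 t2 t3 t4 t5 t6 by (simp_all add: M_def algebra_simps)
                    then show ?thesis
                      unfolding goal using t8 pot A1 A2 A3 B1 B2 \<open>1 \<le> n * k\<close> by linarith
                  qed
                  have out: "s8 ''out'' 0 = (if \<exists>a<k. \<forall>c<g. s ''act'' c = a \<longrightarrow> s ''delta'' (p0 * g + c) \<in> winning then 1 else 0)"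
                    using 1 unfolding eqs7 win by blast
                  show ?case
                    by (intro conjI, rule out, use time in simp)
                qed
              qed
            qed
          next
            case 1
            show ?case
              by (rule in4(1))
          next
            case 2
            show ?case
              by (rule in4(2))
          next
            case (3 p)
            then show ?case
              by (rule refl)
          next
            case (4 p q)
            then show ?case
              by (rule sym)
          next
            case (5 p q u)
            then show ?case
              by (rule trans)
          next
            case (6 p q)
            then show ?case
              by (rule bound)
          qed
        qed
      qed
    qed
  qed
qed

text \<open>The program is chosen before \<open>k\<close>, as it reads the number of actions from
  its input; \<open>k\<close> enters only the constant \<open>100000 * k * k\<close>. The two
  objectives use programs that differ in one test, which drops the moves out of colour 1.\<close>

theorem theorem6:
  shows "\<forall>L\<in>{Reach, Buchi}. \<exists>prog. \<forall>k. \<exists>K. synthesis_in_time prog L k (\<lambda>n g. K * (n ^ 2 + n * g))"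
proof
  fix L :: "nat stream set" assume L: "L \<in> {Reach, Buchi}"
  define r where "r \<longleftrightarrow> L = Reach"
  have L_r: "L = (if r then Reach else Buchi)"
    using L by (auto simp: r_def)
  have "synthesis_in_time (solve_code r) L k (\<lambda>n g. 100000 * k * k * (n ^ 2 + n * g))" for k
    unfolding synthesis_in_time_def
  proof (intro allI impI, elim conjE)
    fix G :: "(nat, nat, nat) game" and g n h s
    assume G: "regular_game G" "moves G = {..<g}" "actions G = {..<k}" "colors G = {0, 1}"
      and h: "rectangular_morphism G {..<n} h" and input: "input_state G n h s"
    define succ where "succ p c = s ''delta'' (p * g + c)" for p c
    have card: "card (moves G) = g" "card (actions G) = k"
      by (simp_all add: G)
    interpret numbered_game G g n k h succ "s ''color''" r
    proof
      show "succ (h \<tau>) c = h (\<tau> @ [c])" if "\<tau> \<in> histories G" "c < g" for \<tau> c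
        using input that by (simp add: input_state_def card G succ_def)
    qed (use G h input in \<open>auto simp: regular_game_def input_state_def\<close>)
    have reach: "\<exists>\<tau>\<in>histories G. p = h \<tau>" if "p < n" for p
      using h that by (auto simp: rectangular_morphism_def)
    have act: "s ''act'' c = act G c" if "c < g" for c
      using input that by (simp add: input_state_def G)
    have "0 < g"
      using act_image k_pos by (metis gr0I image_empty lessThan_0 lessThan_empty_iff)
    have "run (solve_code r) s (\<lambda>t s'. s' ''out'' 0 =
        (if \<exists>a<k. \<forall>c<g. s ''act'' c = a \<longrightarrow> s ''delta'' (h [] * g + c) \<in> winning then 1 else 0) \<and>
        t \<le> 100000 * k * k * (n ^ 2 + n * g))"
    proof (rule run_solve)
      show "s ''states'' 0 = n" "s ''moves'' 0 = g" "s ''actions'' 0 = k" "s ''init'' 0 = h []"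
        using input by (simp_all add: input_state_def card)
      show "h [] < n"
        by (simp add: h_less)
      show "\<forall>p<n. \<forall>c<g. s ''delta'' (p * g + c) < n"
        using reach succ h_less by (metis snoc_history succ_def)
      show "\<forall>c<g. s ''act'' c < k"
        using act act_image by auto
      show "\<forall>p<n. \<forall>q<n. 0 < s ''info'' (p * n + q) \<longleftrightarrow> game_eqv p q"
      proof (intro allI impI)
        fix p q assume "p < n" "q < n"
        then obtain \<tau> where "\<tau> \<in> histories G" "p = h \<tau>"
          using reach by blast
        then show "0 < s ''info'' (p * n + q) \<longleftrightarrow> game_eqv p q"
          using input \<open>q < n\<close> by (simp add: input_state_def game_eqv_info)
      qed
      show "game_eqv p p" if "p < n" for p
        using reach[OF that] game_eqv_refl by auto
      show "p < n" if "game_eqv p q" for p q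
        using that indist_histories h_less by (auto simp: game_eqv_def)
      show "\<forall>p<n. 0 < s ''color'' p \<longleftrightarrow> game_target p"
      proof (intro allI impI)
        fix p assume "p < n"
        then obtain \<tau> where "\<tau> \<in> histories G" "p = h \<tau>"
          using reach by blast
        then show "0 < s ''color'' p \<longleftrightarrow> game_target p"
          using col color_cases by (fastforce simp: game_target_def)
      qed
      show "game_edge p a q \<longleftrightarrow> \<not> (r \<and> game_target p) \<and>
          (\<exists>c<g. s ''act'' c = a \<and> q = s ''delta'' (p * g + c))" for p a q
        using act by (auto simp: game_edge_def game_target_def succ_def)
    qed (use k_pos \<open>0 < g\<close> game_eqv_sym game_eqv_trans in blast)+
    then obtain t s' where "exec (solve_code r) s t s'" "t \<le> 100000 * k * k * (n ^ 2 + n * g)"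
        "s' ''out'' 0 = (if \<exists>a<k. \<forall>c<g. s ''act'' c = a \<longrightarrow> s ''delta'' (h [] * g + c) \<in> winning then 1 else 0)"
      unfolding run_def by blast
    moreover have "(\<exists>a<k. \<forall>c<g. s ''act'' c = a \<longrightarrow> s ''delta'' (h [] * g + c) \<in> winning) \<longleftrightarrow>
        (\<exists>\<alpha>. player_strategy G \<alpha> \<and> almost_sure_winning G L \<alpha>)"
      unfolding L_r almost_sure_winning_iff using act by (auto simp: succ_def)
    ultimately show "\<exists>t s'. exec (solve_code r) s t s' \<and> t \<le> 100000 * k * k * (n ^ 2 + n * g) \<and>
        s' ''out'' 0 = (if \<exists>\<alpha>. player_strategy G \<alpha> \<and> almost_sure_winning G L \<alpha> then 1 else 0)"
      by metis
  qed
  then show "\<exists>prog. \<forall>k. \<exists>K. synthesis_in_time prog L k (\<lambda>n g. K * (n ^ 2 + n * g))"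
    by blast
qed

end
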